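(* Let $U$ be a vector space over a field $\mathbb{F}$, $\Pi\subset U^*$ a total subspace, $\mathcal{H}$ a unital associative $\mathbb{F}$-algebra, and $\mathcal{A}$ an algebra with $\mathfrak{F}_\Pi(U)\subset\mathcal{A}\subset\operatorname{End}(U)$. Let $t\in\mathfrak{F}_\Pi(U)$. If $d\geq1$ satisfies $d\le\deg(t)$, then $\mathcal{A}\otimes\mathcal{H}$ is a $(t;d)$-free subset of $\mathcal{Q}=\operatorname{End}_{\mathcal{H}}(U\otimes\mathcal{H})$. In particular, $\mathcal{A}\otimes\mathcal{H}$ is a $d$-free subset of $\mathcal{Q}$.
   Context: $\Pi\subset U^*$ is total if for each $u\ne0$ some $f\in\Pi$ has $f(u)\neq 0$; $\mathfrak{F}_\Pi(U)$ is spanned by operators $u\mapsto f(u)v$ with $v\in U$, $f\in\Pi$. $U\otimes\mathcal{H}$ is a right $\mathcal{H}$-module via $(u\otimes k)h=u\otimes kh$, and $\mathcal{Q}$ is its algebra of $\mathcal{H}$-module endomorphisms, with center $\mathcal{C}$. $\mathcal{A}\otimes\mathcal{H}$ is identified with its image in $\mathcal{Q}$ under $a\otimes h\mapsto T_{a,h}$, $T_{a,h}(u\otimes k)=au\otimes hk$; in particular $t$ is identified with $T_{t,1}$. $\deg(t)$ is the degree of the minimal polynomial of $t$ over $\mathbb{F}$. Functional identities: let $\mathfrak{Q}$ be a unital ring with center $\mathfrak{C}$, $\mathfrak{R}\subset\mathfrak{Q}$. For $m\ge1$ and $\bar x_m=(x_1,\dots,x_m)\in\mathfrak{R}^m$,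 $\bar x_m^i$ omits $x_i$ and $\bar x_m^{ij}$ omits $x_i,x_j$ (for $m=1$ a function of $\bar x^i_m$ is a constant in $\mathfrak{Q}$, for $m=2$ a function of $\bar x^{ij}_m$ is a constant). For $I,J\subseteq\{1,\dots,m\}$ and functions $E_i,F_j:\mathfrak{R}^{m-1}\to\mathfrak{Q}$ consider (FI) $\sum_{i\in I}E_i(\bar x_m^i)x_i+\sum_{j\in J}x_jF_j(\bar x_m^j)=0$ for all $\bar x_m$, and (FI$_c$) the same expression lying in $\mathfrak{C}$ for all $\bar x_m$. A standard solution is: there exist $p_{ij}:\mathfrak{R}^{m-2}\to\mathfrak{Q}$ ($i\in I,j\in J,i\ne j$) and $\lambda_k:\mathfrak{R}^{m-1}\to\mathfrak{C}$ ($k\in I\cup J$, with $\lambda_k=0$ if $k\notin I\cap J$) such that $E_i(\bar x^i_m)=\sum_{j\in J,j\ne i}x_jp_{ij}(\bar x_m^{ij})+\lambda_i(\bar x^i_m)$ and $F_j(\bar x^j_m)=-\sum_{i\in I,i\ne j}p_{ij}(\bar x_m^{ij})x_i-\lambda_j(\bar x^j_m)$. $\mathfrak{R}$ is $d$-free in $\mathfrak{Q}$ if for all $m,I,J$: when $\max\{|I|,|J|\}\le d$, (FI) implies a standard solution; when $\max\{|I|,|J|\}\le d-1$, (FI$_c$) implies a standard solution. For $t\in\mathfrak{Q}$ with $t\mathfrak{R}\subseteq\mathfrak{R}$ (and $t^0=1$), integers $a,b\ge0$ and functions $E_{iu},F_{jv}:\mathfrak{R}^{m-1}\to\mathfrak{Q}$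 ($0\le u\le a$, $0\le v\le b$), consider $\sum_{i\in I}\sum_{u=0}^aE_{iu}(\bar x^i_m)x_it^u+\sum_{j\in J}\sum_{v=0}^bt^vx_jF_{jv}(\bar x^j_m)=0$ for all $\bar x_m$; a standard solution is: $E_{iu}(\bar x^i_m)=\sum_{j\in J,j\ne i}\sum_{v=0}^bt^vx_jp_{iujv}(\bar x^{ij}_m)+\sum_{v=0}^b\lambda_{iuv}(\bar x^i_m)t^v$ and $F_{jv}(\bar x^j_m)=-\sum_{i\in I,i\ne j}\sum_{u=0}^ap_{iujv}(\bar x^{ij}_m)x_it^u-\sum_{u=0}^a\lambda_{juv}(\bar x^j_m)t^u$ for some $p_{iujv}:\mathfrak{R}^{m-2}\to\mathfrak{Q}$, $\lambda_{kuv}:\mathfrak{R}^{m-1}\to\mathfrak{C}$ with $\lambda_{kuv}=0$ if $k\notin I\cap J$. $\mathfrak{R}$ is $(t;d)$-free in $\mathfrak{Q}$ if for all $m,I,J,a,b$ with $\max\{|I|+a,|J|+b\}\le d$ this identity implies a standard solution. *)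

theory Defs
  imports "HOL-Algebra.Ring" "HOL-Library.Poly_Mapping" "HOL-Computational_Algebra.Polynomial"
begin

text \<open>Tuples of length m are lists (positions 0..m-1 instead of 1..m).
  omit K xs drops the entries at positions in K (so omit {i} xs is the tuple with x_i omitted).\<close>

definition omit :: "nat set \<Rightarrow> 'a list \<Rightarrow> 'a list" where
  "omit K xs = nths xs (- K)"

definition rcenter :: "('a, 'b) ring_scheme \<Rightarrow> 'a set" where
  "rcenter Q = {z \<in> carrier Q. \<forall>x\<in>carrier Q. z \<otimes>\<^bsub>Q\<^esub> x = x \<otimes>\<^bsub>Q\<^esub> z}"

definition maps_into :: "'a set \<Rightarrow> nat \<Rightarrow> ('a list \<Rightarrow> 'a) \<Rightarrow> 'a set \<Rightarrow> bool" where
  "maps_into R k f S \<longleftrightarrow> (\<forall>ys\<in>lists R. length ys = k \<longrightarrow> f ys \<in> S)"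

definition FI_expr :: "('a, 'b) ring_scheme \<Rightarrow> nat set \<Rightarrow> nat set
    \<Rightarrow> (nat \<Rightarrow> 'a list \<Rightarrow> 'a) \<Rightarrow> (nat \<Rightarrow> 'a list \<Rightarrow> 'a) \<Rightarrow> 'a list \<Rightarrow> 'a" where
  "FI_expr Q I J E F xs =
     (\<Oplus>\<^bsub>Q\<^esub> i\<in>I. E i (omit {i} xs) \<otimes>\<^bsub>Q\<^esub> xs ! i) \<oplus>\<^bsub>Q\<^esub>
     (\<Oplus>\<^bsub>Q\<^esub> j\<in>J. xs ! j \<otimes>\<^bsub>Q\<^esub> F j (omit {j} xs))"

definition std_sol :: "('a, 'b) ring_scheme \<Rightarrow> 'a set \<Rightarrow> nat \<Rightarrow> nat set \<Rightarrow> nat set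
    \<Rightarrow> (nat \<Rightarrow> 'a list \<Rightarrow> 'a) \<Rightarrow> (nat \<Rightarrow> 'a list \<Rightarrow> 'a) \<Rightarrow> bool" where
  "std_sol Q R m I J E F \<longleftrightarrow>
    (\<exists>(p :: nat \<Rightarrow> nat \<Rightarrow> 'a list \<Rightarrow> 'a) (lam :: nat \<Rightarrow> 'a list \<Rightarrow> 'a).
      (\<forall>i\<in>I. \<forall>j\<in>J. i \<noteq> j \<longrightarrow> maps_into R (m - 2) (p i j) (carrier Q)) \<and>
      (\<forall>k\<in>I \<union> J. maps_into R (m - 1) (lam k) (rcenter Q)) \<and>
      (\<forall>k\<in>I \<union> J. k \<notin> I \<inter> J \<longrightarrow> maps_into R (m - 1) (lam k) {\<zero>\<^bsub>Q\<^esub>}) \<and>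
      (\<forall>xs\<in>lists R. length xs = m \<longrightarrow>
         (\<forall>i\<in>I. E i (omit {i} xs) =
             (\<Oplus>\<^bsub>Q\<^esub> j\<in>J - {i}. xs ! j \<otimes>\<^bsub>Q\<^esub> p i j (omit {i, j} xs))
               \<oplus>\<^bsub>Q\<^esub> lam i (omit {i} xs)) \<and>
         (\<forall>j\<in>J. F j (omit {j} xs) =
             (\<ominus>\<^bsub>Q\<^esub> (\<Oplus>\<^bsub>Q\<^esub> i\<in>I - {j}. p i j (omit {i, j} xs) \<otimes>\<^bsub>Q\<^esub> xs ! i))
               \<oplus>\<^bsub>Q\<^esub> (\<ominus>\<^bsub>Q\<^esub> lam j (omit {j} xs)))))"

definition d_free :: "'a set \<Rightarrow> ('a, 'b) ring_scheme \<Rightarrow> nat \<Rightarrow> bool" where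
  "d_free R Q d \<longleftrightarrow> R \<subseteq> carrier Q \<and>
    (\<forall>m I J E F. 1 \<le> m \<longrightarrow> I \<subseteq> {..<m} \<longrightarrow> J \<subseteq> {..<m} \<longrightarrow>
       (\<forall>i\<in>I. maps_into R (m - 1) (E i) (carrier Q)) \<longrightarrow>
       (\<forall>j\<in>J. maps_into R (m - 1) (F j) (carrier Q)) \<longrightarrow>
       ((max (card I) (card J) \<le> d \<longrightarrow>
           (\<forall>xs\<in>lists R. length xs = m \<longrightarrow> FI_expr Q I J E F xs = \<zero>\<^bsub>Q\<^esub>) \<longrightarrow>
           std_sol Q R m I J E F) \<and>
        (max (card I) (card J) \<le> d - 1 \<longrightarrow>
           (\<forall>xs\<in>lists R. length xs = m \<longrightarrow> FI_expr Q I J E F xs \<in> rcenter Q) \<longrightarrow>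
           std_sol Q R m I J E F)))"

definition tFI_expr :: "('a, 'b) ring_scheme \<Rightarrow> 'a \<Rightarrow> nat \<Rightarrow> nat \<Rightarrow> nat set \<Rightarrow> nat set
    \<Rightarrow> (nat \<Rightarrow> nat \<Rightarrow> 'a list \<Rightarrow> 'a) \<Rightarrow> (nat \<Rightarrow> nat \<Rightarrow> 'a list \<Rightarrow> 'a) \<Rightarrow> 'a list \<Rightarrow> 'a" where
  "tFI_expr Q t a b I J E F xs =
     (\<Oplus>\<^bsub>Q\<^esub> i\<in>I. \<Oplus>\<^bsub>Q\<^esub> u\<in>{..a}. E i u (omit {i} xs) \<otimes>\<^bsub>Q\<^esub> xs ! i \<otimes>\<^bsub>Q\<^esub> t [^]\<^bsub>Q\<^esub> u) \<oplus>\<^bsub>Q\<^esub>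
     (\<Oplus>\<^bsub>Q\<^esub> j\<in>J. \<Oplus>\<^bsub>Q\<^esub> v\<in>{..b}. t [^]\<^bsub>Q\<^esub> v \<otimes>\<^bsub>Q\<^esub> xs ! j \<otimes>\<^bsub>Q\<^esub> F j v (omit {j} xs))"

definition t_std_sol :: "('a, 'b) ring_scheme \<Rightarrow> 'a set \<Rightarrow> 'a \<Rightarrow> nat \<Rightarrow> nat \<Rightarrow> nat \<Rightarrow> nat set
    \<Rightarrow> nat set \<Rightarrow> (nat \<Rightarrow> nat \<Rightarrow> 'a list \<Rightarrow> 'a) \<Rightarrow> (nat \<Rightarrow> nat \<Rightarrow> 'a list \<Rightarrow> 'a) \<Rightarrow> bool" where
  "t_std_sol Q R t a b m I J E F \<longleftrightarrow>
    (\<exists>(p :: nat \<Rightarrow> nat \<Rightarrow> nat \<Rightarrow> nat \<Rightarrow> 'a list \<Rightarrow> 'a) (lam :: nat \<Rightarrow> nat \<Rightarrow> nat \<Rightarrow> 'a list \<Rightarrow> 'a).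
      (\<forall>i\<in>I. \<forall>u\<le>a. \<forall>j\<in>J. \<forall>v\<le>b. i \<noteq> j \<longrightarrow> maps_into R (m - 2) (p i u j v) (carrier Q)) \<and>
      (\<forall>k\<in>I \<union> J. \<forall>u\<le>a. \<forall>v\<le>b. maps_into R (m - 1) (lam k u v) (rcenter Q)) \<and>
      (\<forall>k\<in>I \<union> J. \<forall>u\<le>a. \<forall>v\<le>b. k \<notin> I \<inter> J \<longrightarrow> maps_into R (m - 1) (lam k u v) {\<zero>\<^bsub>Q\<^esub>}) \<and>
      (\<forall>xs\<in>lists R. length xs = m \<longrightarrow>
         (\<forall>i\<in>I. \<forall>u\<le>a. E i u (omit {i} xs) =
             (\<Oplus>\<^bsub>Q\<^esub> j\<in>J - {i}. \<Oplus>\<^bsub>Q\<^esub> v\<in>{..b}. t [^]\<^bsub>Q\<^esub> v \<otimes>\<^bsub>Q\<^esub> xs ! j \<otimes>\<^bsub>Q\<^esub> p i u j v (omit {i, j} xs))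
               \<oplus>\<^bsub>Q\<^esub> (\<Oplus>\<^bsub>Q\<^esub> v\<in>{..b}. lam i u v (omit {i} xs) \<otimes>\<^bsub>Q\<^esub> t [^]\<^bsub>Q\<^esub> v)) \<and>
         (\<forall>j\<in>J. \<forall>v\<le>b. F j v (omit {j} xs) =
             (\<ominus>\<^bsub>Q\<^esub> (\<Oplus>\<^bsub>Q\<^esub> i\<in>I - {j}. \<Oplus>\<^bsub>Q\<^esub> u\<in>{..a}. p i u j v (omit {i, j} xs) \<otimes>\<^bsub>Q\<^esub> xs ! i \<otimes>\<^bsub>Q\<^esub> t [^]\<^bsub>Q\<^esub> u))
               \<oplus>\<^bsub>Q\<^esub> (\<ominus>\<^bsub>Q\<^esub> (\<Oplus>\<^bsub>Q\<^esub> u\<in>{..a}. lam j u v (omit {j} xs) \<otimes>\<^bsub>Q\<^esub> t [^]\<^bsub>Q\<^esub> u)))))"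

text \<open>(t;d)-freeness; the notion is defined for t \<in> Q with t R \<subseteq> R, which is included.\<close>
definition td_free :: "'a set \<Rightarrow> ('a, 'b) ring_scheme \<Rightarrow> 'a \<Rightarrow> nat \<Rightarrow> bool" where
  "td_free R Q t d \<longleftrightarrow> R \<subseteq> carrier Q \<and> t \<in> carrier Q \<and> (\<forall>x\<in>R. t \<otimes>\<^bsub>Q\<^esub> x \<in> R) \<and>
    (\<forall>m I J a b E F. 1 \<le> m \<longrightarrow> I \<subseteq> {..<m} \<longrightarrow> J \<subseteq> {..<m} \<longrightarrow>
       max (card I + a) (card J + b) \<le> d \<longrightarrow>
       (\<forall>i\<in>I. \<forall>u\<le>a. maps_into R (m - 1) (E i u) (carrier Q)) \<longrightarrow>
       (\<forall>j\<in>J. \<forall>v\<le>b. maps_into R (m - 1) (F j v) (carrier Q)) \<longrightarrow>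
       (\<forall>xs\<in>lists R. length xs = m \<longrightarrow> tFI_expr Q t a b I J E F xs = \<zero>\<^bsub>Q\<^esub>) \<longrightarrow>
       t_std_sol Q R t a b m I J E F)"

definition finrank_ops :: "('f::field \<Rightarrow> 'u::ab_group_add \<Rightarrow> 'u) \<Rightarrow> ('u \<Rightarrow> 'f) set \<Rightarrow> ('u \<Rightarrow> 'u) set" where
  "finrank_ops scaleU Ps = {(\<lambda>u. \<Sum>i<n. scaleU (c i * fs i u) (vs i)) | (n::nat) c fs vs. \<forall>i<n. fs i \<in> Ps}"

definition poly_op :: "('f::field \<Rightarrow> 'u::ab_group_add \<Rightarrow> 'u) \<Rightarrow> 'f poly \<Rightarrow> ('u \<Rightarrow> 'u) \<Rightarrow> ('u \<Rightarrow> 'u)" where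
  "poly_op scaleU p T = (\<lambda>u. \<Sum>i\<le>degree p. scaleU (coeff p i) ((T ^^ i) u))"

definition deg_op :: "('f::field \<Rightarrow> 'u::ab_group_add \<Rightarrow> 'u) \<Rightarrow> ('u \<Rightarrow> 'u) \<Rightarrow> nat" where
  "deg_op scaleU T = (LEAST n. \<exists>p::'f poly. p \<noteq> 0 \<and> degree p = n \<and> poly_op scaleU p T = (\<lambda>_. 0))"

text \<open>U \<otimes> H is the quotient of the free F-vector space on U \<times> H (finitely supported
  functions) by the subspace N spanned by the bilinearity relations.\<close>

definition vscale :: "'f::field \<Rightarrow> ('a \<Rightarrow>\<^sub>0 'f) \<Rightarrow> ('a \<Rightarrow>\<^sub>0 'f)" where
  "vscale c x = Poly_Mapping.map (\<lambda>y. c * y) x"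

inductive_set tensN :: "('f::field \<Rightarrow> 'u::ab_group_add \<Rightarrow> 'u) \<Rightarrow> ('f \<Rightarrow> 'h::ring_1 \<Rightarrow> 'h)
    \<Rightarrow> (('u \<times> 'h) \<Rightarrow>\<^sub>0 'f) set" for scaleU scaleH where
  zero: "0 \<in> tensN scaleU scaleH"
| addl: "Poly_Mapping.single (u + u', h) 1 - Poly_Mapping.single (u, h) 1 - Poly_Mapping.single (u', h) 1
           \<in> tensN scaleU scaleH"
| addr: "Poly_Mapping.single (u, h + h') 1 - Poly_Mapping.single (u, h) 1 - Poly_Mapping.single (u, h') 1
           \<in> tensN scaleU scaleH"
| scl: "Poly_Mapping.single (scaleU c u, h) 1 - Poly_Mapping.single (u, h) c \<in> tensN scaleU scaleH"
| scr: "Poly_Mapping.single (u, scaleH c h) 1 - Poly_Mapping.single (u, h) c \<in> tensN scaleU scaleH"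
| sum: "x \<in> tensN scaleU scaleH \<Longrightarrow> y \<in> tensN scaleU scaleH \<Longrightarrow> x + y \<in> tensN scaleU scaleH"
| smul: "x \<in> tensN scaleU scaleH \<Longrightarrow> vscale c x \<in> tensN scaleU scaleH"

definition tclass :: "('f::field \<Rightarrow> 'u::ab_group_add \<Rightarrow> 'u) \<Rightarrow> ('f \<Rightarrow> 'h::ring_1 \<Rightarrow> 'h)
    \<Rightarrow> (('u \<times> 'h) \<Rightarrow>\<^sub>0 'f) \<Rightarrow> (('u \<times> 'h) \<Rightarrow>\<^sub>0 'f) set" where
  "tclass scaleU scaleH x = {y. x - y \<in> tensN scaleU scaleH}"

definition UH :: "('f::field \<Rightarrow> 'u::ab_group_add \<Rightarrow> 'u) \<Rightarrow> ('f \<Rightarrow> 'h::ring_1 \<Rightarrow> 'h)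
    \<Rightarrow> (('u \<times> 'h) \<Rightarrow>\<^sub>0 'f) set set" where
  "UH scaleU scaleH = range (tclass scaleU scaleH)"

definition cadd :: "'v::plus set \<Rightarrow> 'v set \<Rightarrow> 'v set" where
  "cadd X Y = {x + y | x y. x \<in> X \<and> y \<in> Y}"

definition ractV :: "(('u \<times> 'h::ring_1) \<Rightarrow>\<^sub>0 'f::field) \<Rightarrow> 'h \<Rightarrow> (('u \<times> 'h) \<Rightarrow>\<^sub>0 'f)" where
  "ractV x h = (\<Sum>p\<in>Poly_Mapping.keys x. Poly_Mapping.single (fst p, snd p * h) (Poly_Mapping.lookup x p))"

definition ract :: "('f::field \<Rightarrow> 'u::ab_group_add \<Rightarrow> 'u) \<Rightarrow> ('f \<Rightarrow> 'h::ring_1 \<Rightarrow> 'h)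
    \<Rightarrow> (('u \<times> 'h) \<Rightarrow>\<^sub>0 'f) set \<Rightarrow> 'h \<Rightarrow> (('u \<times> 'h) \<Rightarrow>\<^sub>0 'f) set" where
  "ract scaleU scaleH X h = (\<Union>x\<in>X. tclass scaleU scaleH (ractV x h))"

text \<open>Q = End_H(U \<otimes> H): additive maps of U \<otimes> H commuting with the right H-action
  (these are automatically F-linear), made extensional outside the carrier.\<close>
definition Qset :: "('f::field \<Rightarrow> 'u::ab_group_add \<Rightarrow> 'u) \<Rightarrow> ('f \<Rightarrow> 'h::ring_1 \<Rightarrow> 'h)
    \<Rightarrow> ((('u \<times> 'h) \<Rightarrow>\<^sub>0 'f) set \<Rightarrow> (('u \<times> 'h) \<Rightarrow>\<^sub>0 'f) set) set" where
  "Qset scaleU scaleH = {\<phi>.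
      (\<forall>X\<in>UH scaleU scaleH. \<phi> X \<in> UH scaleU scaleH) \<and>
      (\<forall>X\<in>UH scaleU scaleH. \<forall>Y\<in>UH scaleU scaleH. \<phi> (cadd X Y) = cadd (\<phi> X) (\<phi> Y)) \<and>
      (\<forall>X\<in>UH scaleU scaleH. \<forall>h. \<phi> (ract scaleU scaleH X h) = ract scaleU scaleH (\<phi> X) h) \<and>
      (\<forall>X. X \<notin> UH scaleU scaleH \<longrightarrow> \<phi> X = undefined)}"

definition Qring :: "('f::field \<Rightarrow> 'u::ab_group_add \<Rightarrow> 'u) \<Rightarrow> ('f \<Rightarrow> 'h::ring_1 \<Rightarrow> 'h)
    \<Rightarrow> ((('u \<times> 'h) \<Rightarrow>\<^sub>0 'f) set \<Rightarrow> (('u \<times> 'h) \<Rightarrow>\<^sub>0 'f) set) ring" where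
  "Qring scaleU scaleH =
    \<lparr>carrier = Qset scaleU scaleH,
     monoid.mult = (\<lambda>\<phi> \<psi> X. if X \<in> UH scaleU scaleH then \<phi> (\<psi> X) else undefined),
     one = (\<lambda>X. if X \<in> UH scaleU scaleH then X else undefined),
     zero = (\<lambda>X. if X \<in> UH scaleU scaleH then tclass scaleU scaleH 0 else undefined),
     add = (\<lambda>\<phi> \<psi> X. if X \<in> UH scaleU scaleH then cadd (\<phi> X) (\<psi> X) else undefined)\<rparr>"

definition TmapV :: "('u \<Rightarrow> 'u) \<Rightarrow> 'h::ring_1 \<Rightarrow> (('u \<times> 'h) \<Rightarrow>\<^sub>0 'f::field) \<Rightarrow> (('u \<times> 'h) \<Rightarrow>\<^sub>0 'f)" where
  "TmapV a h x = (\<Sum>p\<in>Poly_Mapping.keys x. Poly_Mapping.single (a (fst p), h * snd p) (Poly_Mapping.lookup x p))"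

definition Tmap :: "('f::field \<Rightarrow> 'u::ab_group_add \<Rightarrow> 'u) \<Rightarrow> ('f \<Rightarrow> 'h::ring_1 \<Rightarrow> 'h)
    \<Rightarrow> ('u \<Rightarrow> 'u) \<Rightarrow> 'h \<Rightarrow> (('u \<times> 'h) \<Rightarrow>\<^sub>0 'f) set \<Rightarrow> (('u \<times> 'h) \<Rightarrow>\<^sub>0 'f) set" where
  "Tmap scaleU scaleH a h =
     (\<lambda>X. if X \<in> UH scaleU scaleH then (\<Union>x\<in>X. tclass scaleU scaleH (TmapV a h x)) else undefined)"

text \<open>The image of A \<otimes> H in Q: all finite sums of the T_{a,h}, a \<in> A, h \<in> H.\<close>
definition AtensH :: "('f::field \<Rightarrow> 'u::ab_group_add \<Rightarrow> 'u) \<Rightarrow> ('f \<Rightarrow> 'h::ring_1 \<Rightarrow> 'h)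
    \<Rightarrow> ('u \<Rightarrow> 'u) set \<Rightarrow> ((('u \<times> 'h) \<Rightarrow>\<^sub>0 'f) set \<Rightarrow> (('u \<times> 'h) \<Rightarrow>\<^sub>0 'f) set) set" where
  "AtensH scaleU scaleH A =
     {(\<Oplus>\<^bsub>Qring scaleU scaleH\<^esub> i\<in>{..<n}. Tmap scaleU scaleH (as i) (hs i)) | (n::nat) as hs. \<forall>i<n. as i \<in> A}"

end

theory Submission
  imports Defs
begin

text \<open>
  Replacing a variable \<open>x\<^sub>k\<close> by \<open>t x\<^sub>k\<close> and subtracting \<open>t\<close> times the identity removes all summands
  \<open>t\<^sup>v x\<^sub>k F\<^sub>k\<^sub>v\<close> and raises \<open>b\<close> by one. The coefficients of the new identity determine those of the old one
  by descending recursion on \<open>v\<close>, so induction reduces \<open>J\<close>, and symmetrically \<open>I\<close>, to at most one element.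
  The remaining identities are solved with rank one operators: since \<open>1, t, \<dots>, t\<^sup>d\<^sup>-\<^sup>1\<close> are linearly
  independent and \<open>\<Pi>\<close> is total, there are \<open>f\<^sub>s \<in> \<Pi>\<close> and vectors \<open>w\<^sub>s\<close> such that \<open>\<Sum>\<^sub>s f\<^sub>s(t\<^sup>u w\<^sub>s)\<close> is
  \<open>1\<close> for \<open>u = c\<close> and \<open>0\<close> for the other \<open>u < d\<close>. Substituting \<open>u \<mapsto> f\<^sub>s(u) w\<close> and evaluating at \<open>w\<^sub>s\<close>
  isolates the coefficient of \<open>t\<^sup>c\<close>.

  If the identity only has central values, the same substitutions with two operators \<open>N\<close> (on the left) and \<open>M\<close>
  (on the right) in place of \<open>t\<close> eliminate every summand and leave
  \<open>\<Sum> \<theta>\<^sub>r\<^sub>s N\<^sup>r M\<^sup>s = 0\<close> with central \<open>\<theta>\<^sub>r\<^sub>s\<close> and \<open>r, s < d\<close>. As \<open>dim U \<ge> deg t \<ge> d\<close>, one can take for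
  \<open>N\<close> and \<open>M\<close> the two opposite shifts along \<open>d\<close> independent vectors, whose products \<open>N\<^sup>r M\<^sup>s\<close>
  are independent; hence all \<open>\<theta>\<^sub>r\<^sub>s\<close> vanish.
\<close>

section \<open>Rings of additive endomorphisms\<close>

text \<open>The sums \<open>card I + a\<close> and \<open>card J + b\<close> are the right
  quantities to bound because removing an index from \<open>J\<close> at the cost of raising
  \<open>b\<close> by one keeps \<open>card J + b\<close> fixed. When one index is left on a side,
  the exponent there is below \<open>d\<close>, exactly the range in which the powers of
  \<open>t\<close> are independent. Although d-freeness does not mention \<open>t\<close>, its
  identities with value zero are the case \<open>a = b = 0\<close>, and \<open>t\<close> drives
  their solution.

  For central values \<open>t\<close> cannot serve on both sides: \<open>N = M = t\<close> could at
  best determine the sums of the \<open>\<theta>\<close> over fixed \<open>r + s\<close>. Each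
  removed index raises an exponent from 0 by one, so at most \<open>d - 1\<close> indices on a side
  keep the exponents below \<open>d\<close>.

  The formal obstacle is that \<open>Q\<close> is a ring with a carrier, of maps between equivalence
  classes, and that tuples are lists with omitted entries. \<open>Q\<close> is therefore embedded in
  a type-class ring of additive maps by means of a linear complement of the tensor relations, the
  algebra is done there, and the solution is carried back at the end.\<close>

typedef (overloaded) ('m::ab_group_add) aend = "{f :: 'm \<Rightarrow> 'm. \<forall>x y. f (x + y) = f x + f y}"
  morphisms app Aend
  by (rule exI[of _ "\<lambda>x. 0"]) simp

setup_lifting type_definition_aend

lemma app_add: "app f (x + y) = app f x + app f y"
  using app[of f] by simp

lemma app_0 [simp]: "app f 0 = 0"
  using app_add[of f 0 0] by simp

lemma app_minus: "app f (- x) = - app f x"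
  using app_add[of f x "- x"] by (simp add: eq_neg_iff_add_eq_0 add.commute)

lemma app_sum: "app f (sum g S) = (\<Sum>s\<in>S. app f (g s))"
  by (induction S rule: infinite_finite_induct) (auto simp: app_add)

text \<open>The class \<open>ring\<close> has no unit, which suits its later use: the identity of
  \<open>Q\<close> will become an idempotent of this ring rather than the identity map.\<close>

instantiation aend :: (ab_group_add) ring
begin
lift_definition zero_aend :: "'a aend" is "\<lambda>x. 0" by simp
lift_definition plus_aend :: "'a aend \<Rightarrow> 'a aend \<Rightarrow> 'a aend" is "\<lambda>f g x. f x + g x"
  by (simp add: algebra_simps)
lift_definition minus_aend :: "'a aend \<Rightarrow> 'a aend \<Rightarrow> 'a aend" is "\<lambda>f g x. f x - g x"
  by (simp add: algebra_simps)
lift_definition uminus_aend :: "'a aend \<Rightarrow> 'a aend" is "\<lambda>f x. - f x"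
  by (simp add: algebra_simps)
lift_definition times_aend :: "'a aend \<Rightarrow> 'a aend \<Rightarrow> 'a aend" is "\<lambda>f g x. f (g x)"
  by simp
instance
proof
  fix a b c :: "'a aend"
  show "a + b + c = a + (b + c)" by transfer (simp add: algebra_simps)
  show "a + b = b + a" by transfer (simp add: algebra_simps)
  show "0 + a = a" by transfer simp
  show "- a + a = 0" by transfer simp
  show "a - b = a + - b" by transfer simp
  show "a * b * c = a * (b * c)" by transfer simp
  show "(a + b) * c = a * c + b * c" by transfer simp
  show "a * (b + c) = a * b + a * c" by transfer simp
qed
end

lemma app_plus [simp]: "app (f + g) x = app f x + app g x" by transfer simp
lemma app_minus_left [simp]: "app (f - g) x = app f x - app g x" by transfer simp
lemma app_uminus_left [simp]: "app (- f) x = - app f x" by transfer simp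
lemma app_zero_left [simp]: "app 0 x = 0" by transfer simp
lemma app_times [simp]: "app (f * g) x = app f (app g x)" by transfer simp

lemma app_sum_left: "app (sum g S) x = (\<Sum>s\<in>S. app (g s) x)"
  by (induction S rule: infinite_finite_induct) auto

lemma aend_eqI: "(\<And>x. app f x = app g x) \<Longrightarrow> f = g"
  by transfer auto

section \<open>Functional identities in an abstract ring\<close>

lemma sum_swap4:
  "(\<Sum>j\<in>J. \<Sum>v\<in>V. \<Sum>i\<in>I. \<Sum>u\<in>U. g j v i u) = (\<Sum>i\<in>I. \<Sum>u\<in>U. \<Sum>j\<in>J. \<Sum>v\<in>V. g j v i u)"
proof -
  have "(\<Sum>j\<in>J. \<Sum>v\<in>V. \<Sum>i\<in>I. \<Sum>u\<in>U. g j v i u) = (\<Sum>j\<in>J. \<Sum>i\<in>I. \<Sum>v\<in>V. \<Sum>u\<in>U. g j v i u)"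
    by (rule sum.cong[OF refl], rule sum.swap)
  also have "\<dots> = (\<Sum>j\<in>J. \<Sum>i\<in>I. \<Sum>u\<in>U. \<Sum>v\<in>V. g j v i u)"
    by (rule sum.cong[OF refl], rule sum.cong[OF refl], rule sum.swap)
  also have "\<dots> = (\<Sum>i\<in>I. \<Sum>j\<in>J. \<Sum>u\<in>U. \<Sum>v\<in>V. g j v i u)"
    by (rule sum.swap)
  also have "\<dots> = (\<Sum>i\<in>I. \<Sum>u\<in>U. \<Sum>j\<in>J. \<Sum>v\<in>V. g j v i u)"
    by (rule sum.cong[OF refl], rule sum.swap)
  finally show ?thesis .
qed

text \<open>\<open>L\<close> and \<open>Rt\<close> stand for left and right multiplication by
  \<open>t\<close>, and \<open>mid\<close> says \<open>x (t y) = (x t) y\<close>. With the product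
  as a parameter instead of the class operation, the opposite product is an instance with
  \<open>L\<close> and \<open>Rt\<close> exchanged, so that each argument about \<open>J\<close>
  also serves for \<open>I\<close>.\<close>

locale fi_ops =
  fixes mul :: "'q::ab_group_add \<Rightarrow> 'q \<Rightarrow> 'q" (infixl "\<star>" 70)
    and L Rt :: "'q \<Rightarrow> 'q" and Q C R :: "'q set"
  assumes mul_addl: "(x + y) \<star> z = x \<star> z + y \<star> z"
    and mul_addr: "x \<star> (y + z) = x \<star> y + x \<star> z"
    and mul_assoc: "(x \<star> y) \<star> z = x \<star> (y \<star> z)"
    and L_add: "L (x + y) = L x + L y"
    and Rt_add: "Rt (x + y) = Rt x + Rt y"
    and L_mul: "L (x \<star> y) = L x \<star> y"
    and Rt_mul: "Rt (x \<star> y) = x \<star> Rt y"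
    and mid: "x \<star> L y = Rt x \<star> y"
    and L_Rt: "L (Rt x) = Rt (L x)"
    and Q_0: "0 \<in> Q" and Q_diff: "x \<in> Q \<Longrightarrow> y \<in> Q \<Longrightarrow> x - y \<in> Q"
    and Q_mul: "x \<in> Q \<Longrightarrow> y \<in> Q \<Longrightarrow> x \<star> y \<in> Q"
    and Q_L: "x \<in> Q \<Longrightarrow> L x \<in> Q" and Q_Rt: "x \<in> Q \<Longrightarrow> Rt x \<in> Q"
    and C_0: "0 \<in> C" and C_diff: "x \<in> C \<Longrightarrow> y \<in> C \<Longrightarrow> x - y \<in> C"
    and C_Q: "C \<subseteq> Q" and C_comm: "c \<in> C \<Longrightarrow> x \<in> Q \<Longrightarrow> c \<star> x = x \<star> c"
    and R_Q: "R \<subseteq> Q" and R_L: "x \<in> R \<Longrightarrow> L x \<in> R" and R_Rt: "x \<in> R \<Longrightarrow> Rt x \<in> R"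
begin

text \<open>Tuples are functions on all of \<open>nat\<close>; a function of \<open>x\<close> with \<open>x\<^sub>i\<close> omitted is one that is
  independent of \<open>x\<^sub>i\<close>.\<close>
definition X :: "(nat \<Rightarrow> 'q) set" where "X = {x. \<forall>i. x i \<in> R}"

definition indep :: "nat \<Rightarrow> ((nat \<Rightarrow> 'q) \<Rightarrow> 'q) \<Rightarrow> bool" where
  "indep i G \<longleftrightarrow> (\<forall>x\<in>X. \<forall>r\<in>R. G (x(i := r)) = G x)"

definition coef :: "nat \<Rightarrow> ((nat \<Rightarrow> 'q) \<Rightarrow> 'q) \<Rightarrow> bool" where
  "coef i G \<longleftrightarrow> indep i G \<and> (\<forall>x\<in>X. G x \<in> Q)"

definition coef2 :: "nat \<Rightarrow> nat \<Rightarrow> ((nat \<Rightarrow> 'q) \<Rightarrow> 'q) \<Rightarrow> bool" where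
  "coef2 i j G \<longleftrightarrow> indep i G \<and> indep j G \<and> (\<forall>x\<in>X. G x \<in> (if i = j then C else Q))"

text \<open>For \<open>i = j\<close> the argument \<open>x\<^sub>j\<close> is the omitted one, so
  the summand consists only of the central coefficient and a power of \<open>t\<close>.\<close>

definition lterm :: "nat \<Rightarrow> nat \<Rightarrow> nat \<Rightarrow> (nat \<Rightarrow> 'q) \<Rightarrow> 'q \<Rightarrow> 'q" where
  "lterm i j v x y = (if i = j then (L ^^ v) y else (L ^^ v) (x j) \<star> y)"

definition rterm :: "nat \<Rightarrow> nat \<Rightarrow> nat \<Rightarrow> (nat \<Rightarrow> 'q) \<Rightarrow> 'q \<Rightarrow> 'q" where
  "rterm i j u x y = (if i = j then (Rt ^^ u) y else y \<star> (Rt ^^ u) (x i))"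

definition lhs :: "nat set \<Rightarrow> nat set \<Rightarrow> nat \<Rightarrow> nat \<Rightarrow> (nat \<Rightarrow> nat \<Rightarrow> (nat \<Rightarrow> 'q) \<Rightarrow> 'q)
    \<Rightarrow> (nat \<Rightarrow> nat \<Rightarrow> (nat \<Rightarrow> 'q) \<Rightarrow> 'q) \<Rightarrow> (nat \<Rightarrow> 'q) \<Rightarrow> 'q" where
  "lhs I J a b E F x = (\<Sum>i\<in>I. \<Sum>u\<le>a. E i u x \<star> (Rt ^^ u) (x i))
     + (\<Sum>j\<in>J. \<Sum>v\<le>b. (L ^^ v) (x j) \<star> F j v x)"

text \<open>A single family \<open>p\<close> carries both parts of a standard solution: \<open>p i u j v\<close> for \<open>i \<noteq> j\<close> is \<open>p\<^sub>i\<^sub>u\<^sub>j\<^sub>v\<close>, and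
  \<open>p k u k v\<close> is \<open>\<lambda>\<^sub>k\<^sub>u\<^sub>v\<close>.\<close>
definition sol :: "nat set \<Rightarrow> nat set \<Rightarrow> nat \<Rightarrow> nat \<Rightarrow> (nat \<Rightarrow> nat \<Rightarrow> (nat \<Rightarrow> 'q) \<Rightarrow> 'q)
    \<Rightarrow> (nat \<Rightarrow> nat \<Rightarrow> (nat \<Rightarrow> 'q) \<Rightarrow> 'q) \<Rightarrow> bool" where
  "sol I J a b E F \<longleftrightarrow> (\<exists>p. (\<forall>i\<in>I. \<forall>u\<le>a. \<forall>j\<in>J. \<forall>v\<le>b. coef2 i j (p i u j v)) \<and>
     (\<forall>x\<in>X. (\<forall>i\<in>I. \<forall>u\<le>a. E i u x = (\<Sum>j\<in>J. \<Sum>v\<le>b. lterm i j v x (p i u j v x))) \<and>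
            (\<forall>j\<in>J. \<forall>v\<le>b. F j v x = - (\<Sum>i\<in>I. \<Sum>u\<le>a. rterm i j u x (p i u j v x)))))"

definition only_std :: "nat set \<Rightarrow> nat set \<Rightarrow> nat \<Rightarrow> nat \<Rightarrow> bool" where
  "only_std I J a b \<longleftrightarrow> (\<forall>E F. (\<forall>i\<in>I. \<forall>u\<le>a. coef i (E i u)) \<longrightarrow> (\<forall>j\<in>J. \<forall>v\<le>b. coef j (F j v)) \<longrightarrow>
     (\<forall>x\<in>X. lhs I J a b E F x = 0) \<longrightarrow> sol I J a b E F)"

lemma mul_0l [simp]: "0 \<star> x = 0" using mul_addl[of 0 0 x] by simp
lemma mul_0r [simp]: "x \<star> 0 = 0" using mul_addr[of x 0 0] by simp
lemma mul_diffl: "(x - y) \<star> z = x \<star> z - y \<star> z"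
  using mul_addl[of "x - y" y z] by (simp add: algebra_simps)
lemma mul_diffr: "x \<star> (y - z) = x \<star> y - x \<star> z"
  using mul_addr[of x "y - z" z] by (simp add: algebra_simps)
lemma mul_minusr: "x \<star> (- y) = - (x \<star> y)" using mul_diffr[of x 0 y] by simp
lemma mul_suml: "sum g S \<star> z = (\<Sum>s\<in>S. g s \<star> z)"
  by (induction S rule: infinite_finite_induct) (auto simp: mul_addl)
lemma mul_sumr: "z \<star> sum g S = (\<Sum>s\<in>S. z \<star> g s)"
  by (induction S rule: infinite_finite_induct) (auto simp: mul_addr)
lemma L_0 [simp]: "L 0 = 0" using L_add[of 0 0] by simp
lemma Rt_0 [simp]: "Rt 0 = 0" using Rt_add[of 0 0] by simp
lemma L_diff: "L (x - y) = L x - L y"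
  using L_add[of "x - y" y] by (simp add: algebra_simps)
lemma Rt_diff: "Rt (x - y) = Rt x - Rt y"
  using Rt_add[of "x - y" y] by (simp add: algebra_simps)
lemma L_sum: "L (sum g S) = (\<Sum>s\<in>S. L (g s))"
  by (induction S rule: infinite_finite_induct) (auto simp: L_add)
lemma Ln_mul: "(L ^^ v) (x \<star> y) = (L ^^ v) x \<star> y"
  by (induction v) (auto simp: L_mul)
lemma Rtn_mul: "(Rt ^^ v) (x \<star> y) = x \<star> (Rt ^^ v) y"
  by (induction v) (auto simp: Rt_mul)
lemma Ln_diff: "(L ^^ v) (x - y) = (L ^^ v) x - (L ^^ v) y"
  by (induction v) (auto simp: L_diff)
lemma Rtn_diff: "(Rt ^^ v) (x - y) = (Rt ^^ v) x - (Rt ^^ v) y"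
  by (induction v) (auto simp: Rt_diff)
lemma Rtn_L: "(Rt ^^ u) (L x) = L ((Rt ^^ u) x)"
  by (induction u) (auto simp: L_Rt)
lemma L_Ln: "(L ^^ v) (L x) = L ((L ^^ v) x)"
  by (induction v) auto
lemma rterm_diff: "rterm i j u x (y - z) = rterm i j u x y - rterm i j u x z"
  by (simp add: rterm_def Rtn_diff mul_diffl)
lemma Q_uminus: "x \<in> Q \<Longrightarrow> - x \<in> Q" using Q_diff[OF Q_0] by force
lemma Q_add: "x \<in> Q \<Longrightarrow> y \<in> Q \<Longrightarrow> x + y \<in> Q" using Q_diff[of x "- y"] Q_uminus by force
lemma Q_sum: "(\<And>s. s \<in> S \<Longrightarrow> g s \<in> Q) \<Longrightarrow> sum g S \<in> Q"
  by (induction S rule: infinite_finite_induct) (auto simp: Q_0 Q_add)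
lemma Q_Ln: "x \<in> Q \<Longrightarrow> (L ^^ v) x \<in> Q" by (induction v) (auto simp: Q_L)
lemma Q_Rtn: "x \<in> Q \<Longrightarrow> (Rt ^^ v) x \<in> Q" by (induction v) (auto simp: Q_Rt)

lemma X_R: "x \<in> X \<Longrightarrow> x i \<in> R" by (simp add: X_def)
lemma X_Q: "x \<in> X \<Longrightarrow> x i \<in> Q" using X_R R_Q by auto
lemma X_upd: "x \<in> X \<Longrightarrow> r \<in> R \<Longrightarrow> x(i := r) \<in> X" by (simp add: X_def)
lemma X_shift: "x \<in> X \<Longrightarrow> x(k := L (x k)) \<in> X" by (simp add: X_upd R_L X_R)

text \<open>The common value is \<open>x\<^sub>j p x\<^sub>i\<close> off the diagonal and a central multiple of \<open>x\<^sub>i\<close> on it.\<close>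
lemma lterm_rterm:
  assumes "y \<in> (if i = j then C else Q)" "x \<in> X"
  shows "lterm i j v x y \<star> (Rt ^^ u) (x i) = (L ^^ v) (x j) \<star> rterm i j u x y"
proof (cases "i = j")
  case True
  then have "(L ^^ v) y \<star> (Rt ^^ u) (x i) = (L ^^ v) ((Rt ^^ u) (y \<star> x i))"
    by (simp add: Ln_mul Rtn_mul)
  also have "y \<star> x i = x i \<star> y"
    using assms True X_Q C_comm by auto
  finally show ?thesis using True by (simp add: lterm_def rterm_def Ln_mul Rtn_mul)
next
  case False
  then show ?thesis by (simp add: lterm_def rterm_def mul_assoc)
qed

lemma indep_shift:
  assumes "indep i G" shows "indep i (\<lambda>x. G (x(k := L (x k))))"
proof -
  have "G ((x(i := r))(k := L ((x(i := r)) k))) = G (x(k := L (x k)))" if "x \<in> X" "r \<in> R" for x r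
  proof (cases "i = k")
    case True
    then show ?thesis using assms that R_L X_R unfolding indep_def by simp
  next
    case False
    then have "(x(i := r))(k := L ((x(i := r)) k)) = (x(k := L (x k)))(i := r)"
      by (auto simp: fun_upd_twist)
    then show ?thesis using assms that X_shift unfolding indep_def by simp
  qed
  then show ?thesis unfolding indep_def by blast
qed

lemma indep_same: "indep k G \<Longrightarrow> x \<in> X \<Longrightarrow> G (x(k := L (x k))) = G x"
  using R_L X_R unfolding indep_def by simp

lemma indep_L: "indep i G \<Longrightarrow> indep i (\<lambda>x. L (G x))"
  unfolding indep_def by simp

lemma indep_Rt: "indep i G \<Longrightarrow> indep i (\<lambda>x. Rt (G x))"
  unfolding indep_def by simp

lemma indep_diff: "indep i G \<Longrightarrow> indep i H \<Longrightarrow> indep i (\<lambda>x. G x - H x)"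
  unfolding indep_def by simp

lemma coef2_diff: "coef2 i j G \<Longrightarrow> coef2 i j H \<Longrightarrow> coef2 i j (\<lambda>x. G x - H x)"
  unfolding coef2_def indep_def using C_diff Q_diff by auto

text \<open>Up to sign, the shape that a standard solution prescribes for one function
  \<open>F j v\<close>. It is isolated because the recursion in \<open>only_std_remove\<close>
  establishes it for one \<open>v\<close> at a time.\<close>

definition rform :: "nat set \<Rightarrow> nat \<Rightarrow> nat \<Rightarrow> ((nat \<Rightarrow> 'q) \<Rightarrow> 'q) \<Rightarrow> bool" where
  "rform I a j f \<longleftrightarrow> (\<exists>p. (\<forall>i\<in>I. \<forall>u\<le>a. coef2 i j (p i u)) \<and>
     (\<forall>x\<in>X. f x = (\<Sum>i\<in>I. \<Sum>u\<le>a. rterm i j u x (p i u x))))"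

lemma rformE:
  assumes "rform I a j f"
  obtains p where "\<And>i u. i \<in> I \<Longrightarrow> u \<le> a \<Longrightarrow> coef2 i j (p i u)"
    "\<And>x. x \<in> X \<Longrightarrow> f x = (\<Sum>i\<in>I. \<Sum>u\<le>a. rterm i j u x (p i u x))"
  using assms[unfolded rform_def] by (elim exE conjE) (rule that, simp_all)

lemma solE:
  assumes "sol I J a b E F"
  obtains p where "\<And>i u j v. i \<in> I \<Longrightarrow> u \<le> a \<Longrightarrow> j \<in> J \<Longrightarrow> v \<le> b \<Longrightarrow> coef2 i j (p i u j v)"
    "\<And>x i u. x \<in> X \<Longrightarrow> i \<in> I \<Longrightarrow> u \<le> a \<Longrightarrow> E i u x = (\<Sum>j\<in>J. \<Sum>v\<le>b. lterm i j v x (p i u j v x))"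
    "\<And>x j v. x \<in> X \<Longrightarrow> j \<in> J \<Longrightarrow> v \<le> b \<Longrightarrow> F j v x = - (\<Sum>i\<in>I. \<Sum>u\<le>a. rterm i j u x (p i u j v x))"
  using assms[unfolded sol_def] by (elim exE conjE) (rule that, simp_all)

lemma rform_diff:
  assumes "rform I a j f" "rform I a j g" shows "rform I a j (\<lambda>x. f x - g x)"
proof -
  from assms obtain p q where p: "\<forall>i\<in>I. \<forall>u\<le>a. coef2 i j (p i u)"
      "\<forall>x\<in>X. f x = (\<Sum>i\<in>I. \<Sum>u\<le>a. rterm i j u x (p i u x))"
    and q: "\<forall>i\<in>I. \<forall>u\<le>a. coef2 i j (q i u)"
      "\<forall>x\<in>X. g x = (\<Sum>i\<in>I. \<Sum>u\<le>a. rterm i j u x (q i u x))"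
    unfolding rform_def by blast
  show ?thesis unfolding rform_def
    by (rule exI[of _ "\<lambda>i u x. p i u x - q i u x"])
      (use p q in \<open>auto simp: coef2_diff rterm_diff sum_subtractf\<close>)
qed

lemma rform_uminus:
  assumes "rform I a j f" shows "rform I a j (\<lambda>x. - f x)"
proof -
  have "rform I a j (\<lambda>x. f x - f x)" by (rule rform_diff[OF assms assms])
  from rform_diff[OF this assms] show ?thesis by simp
qed

lemma rform_cong: "rform I a j f \<Longrightarrow> (\<And>x. x \<in> X \<Longrightarrow> f x = g x) \<Longrightarrow> rform I a j g"
  unfolding rform_def by (elim ex_forward) auto

text \<open>In the summand \<open>i = k\<close> the new factor \<open>t\<close> stands between the
  coefficient and \<open>x\<^sub>k\<close> and is absorbed into the coefficient by
  \<open>mid\<close>. As \<open>k \<noteq> j\<close>, this never happens to a diagonal coefficient,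
  which has to stay central.\<close>

lemma rform_shift:
  assumes "rform I a j f" "k \<noteq> j" shows "rform I a j (\<lambda>x. f (x(k := L (x k))))"
proof -
  obtain p where p: "\<And>i u. i \<in> I \<Longrightarrow> u \<le> a \<Longrightarrow> coef2 i j (p i u)"
      "\<And>x. x \<in> X \<Longrightarrow> f x = (\<Sum>i\<in>I. \<Sum>u\<le>a. rterm i j u x (p i u x))"
    by (fact rformE[OF assms(1)])
  define q where "q i u x = (let y = p i u (x(k := L (x k))) in if i = k then Rt y else y)" for i u x
  have "coef2 i j (q i u)" if "i \<in> I" "u \<le> a" for i u
  proof -
    have ind: "indep i (q i u)" "indep j (q i u)"
      using p(1)[OF that] unfolding coef2_def q_def Let_def
      by (cases "i = k"; auto intro!: indep_Rt indep_shift)+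
    have "p i u (x(k := L (x k))) \<in> (if i = j then C else Q)" if "x \<in> X" for x
      using p(1)[OF \<open>i \<in> I\<close> \<open>u \<le> a\<close>] X_shift[OF that] unfolding coef2_def by blast
    then have "\<forall>x\<in>X. q i u x \<in> (if i = j then C else Q)"
      using assms(2) Q_Rt by (auto simp: q_def Let_def split: if_splits)
    with ind show ?thesis by (simp add: coef2_def)
  qed
  moreover have "f (x(k := L (x k))) = (\<Sum>i\<in>I. \<Sum>u\<le>a. rterm i j u x (q i u x))" if "x \<in> X" for x
    unfolding p(2)[OF X_shift[OF that]] using assms(2)
    by (intro sum.cong refl) (auto simp: rterm_def q_def Let_def Rtn_L mid)
  ultimately show ?thesis unfolding rform_def by blast
qed

lemma only_stdD:
  assumes "only_std I J a b" "\<And>i u. i \<in> I \<Longrightarrow> u \<le> a \<Longrightarrow> coef i (E i u)"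
    "\<And>j v. j \<in> J \<Longrightarrow> v \<le> b \<Longrightarrow> coef j (F j v)" "\<And>x. x \<in> X \<Longrightarrow> lhs I J a b E F x = 0"
  shows "sol I J a b E F"
  using assms unfolding only_std_def by simp

text \<open>Subtracting \<open>L\<close> of the identity from the identity at \<open>x\<^sub>k \<mapsto> L x\<^sub>k\<close> removes the
  summands with \<open>j = k\<close> at the cost of raising \<open>b\<close>.\<close>
lemma reduced_identity:
  assumes "finite I" "finite J" "k \<in> J"
    and E: "\<forall>i\<in>I. \<forall>u\<le>a. coef i (E i u)" and F: "\<forall>j\<in>J. \<forall>v\<le>b. coef j (F j v)"
    and id: "\<forall>x\<in>X. lhs I J a b E F x = 0"
    and only: "only_std I (J - {k}) a (Suc b)"
  shows "sol I (J - {k}) a (Suc b)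
     (\<lambda>i u x. if i = k then Rt (E k u x) - L (E k u x) else E i u (x(k := L (x k))) - L (E i u x))
     (\<lambda>j v x. (if v \<le> b then F j v (x(k := L (x k))) else 0)
            - (case v of 0 \<Rightarrow> 0 | Suc w \<Rightarrow> F j w x))"
    (is "sol _ _ _ _ ?E ?F")
proof -
  have cE: "coef i (?E i u)" if "i \<in> I" "u \<le> a" for i u
  proof -
    have ci: "indep i (E i u)" "\<And>x. x \<in> X \<Longrightarrow> E i u x \<in> Q"
      using E that unfolding coef_def by auto
    have "indep i (?E i u)"
      using ci(1) by (cases "i = k"; auto intro!: indep_diff indep_Rt indep_L indep_shift)
    moreover have "?E i u x \<in> Q" if "x \<in> X" for x
      using ci(2) X_shift that by (auto intro!: Q_diff Q_L Q_Rt)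
    ultimately show ?thesis unfolding coef_def by blast
  qed
  have cF: "coef j (?F j v)" if "j \<in> J - {k}" "v \<le> Suc b" for j v
  proof -
    have ci: "indep j (F j w)" "\<And>x. x \<in> X \<Longrightarrow> F j w x \<in> Q" if "w \<le> b" for w
      using F that \<open>j \<in> J - {k}\<close> unfolding coef_def by auto
    have "indep j (\<lambda>x. if v \<le> b then F j v (x(k := L (x k))) else 0)"
      using ci(1)[of v] indep_shift[of j "F j v" k] by (cases "v \<le> b") (auto simp: indep_def)
    moreover have "indep j (\<lambda>x. case v of 0 \<Rightarrow> 0 | Suc w \<Rightarrow> F j w x)"
      using ci(1) that(2) by (cases v) (auto simp: indep_def)
    ultimately have "indep j (?F j v)" by (rule indep_diff)
    moreover have "?F j v x \<in> Q" if "x \<in> X" for x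
      using ci(2) X_shift that \<open>v \<le> Suc b\<close> by (cases v) (auto intro!: Q_diff Q_0 Q_uminus simp del: fun_upd_apply)
    ultimately show ?thesis unfolding coef_def by blast
  qed
  have "lhs I (J - {k}) a (Suc b) ?E ?F x = 0" if x: "x \<in> X" for x
  proof -
    let ?y = "x(k := L (x k))"
    have y: "?y \<in> X" using x by (rule X_shift)
    \<comment> \<open>For \<open>i = k\<close> the coefficient is independent of
      \<open>x\<^sub>k\<close> and the new factor \<open>t\<close> lies to its right, so the
      difference has the coefficient \<open>E t - t E\<close>.\<close>
    have e: "E i u ?y \<star> (Rt ^^ u) (?y i) - L (E i u x \<star> (Rt ^^ u) (x i)) = ?E i u x \<star> (Rt ^^ u) (x i)"
      if "i \<in> I" "u \<le> a" for i u
    proof (cases "i = k")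
      case True
      then have "E i u ?y = E i u x" using E that x indep_same[of k "E k u" x] by (auto simp: coef_def)
      then show ?thesis using True by (simp add: Rtn_L mid L_mul mul_diffl)
    next
      case False
      then show ?thesis by (simp add: L_mul mul_diffl)
    qed
    \<comment> \<open>For \<open>j = k\<close> both parts agree, since \<open>F k v\<close> ignores
      \<open>x\<^sub>k\<close> and powers of \<open>t\<close> commute. For the other
      \<open>j\<close> the left factor \<open>t\<close> moves each old coefficient up by one power,
      whence the index shift and \<open>Suc b\<close>.\<close>
    have f: "(\<Sum>v\<le>b. (L ^^ v) (?y j) \<star> F j v ?y) - L (\<Sum>v\<le>b. (L ^^ v) (x j) \<star> F j v x)
        = (if j = k then 0 else \<Sum>v\<le>Suc b. (L ^^ v) (x j) \<star> ?F j v x)" if j: "j \<in> J" for j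
    proof (cases "j = k")
      case True
      have "F k v ?y = F k v x" if "v \<le> b" for v
        using F j True that x indep_same[of k "F k v" x] by (auto simp: coef_def)
      then show ?thesis using True by (simp add: L_sum L_mul L_Ln)
    next
      case False
      have "(\<Sum>v\<le>Suc b. (L ^^ v) (x j) \<star> ?F j v x)
          = (\<Sum>v\<le>Suc b. (L ^^ v) (x j) \<star> (if v \<le> b then F j v ?y else 0))
            - (\<Sum>v\<le>Suc b. (L ^^ v) (x j) \<star> (case v of 0 \<Rightarrow> 0 | Suc w \<Rightarrow> F j w x))"
        by (simp only: mul_diffr sum_subtractf)
      also have "(\<Sum>v\<le>Suc b. (L ^^ v) (x j) \<star> (if v \<le> b then F j v ?y else 0))
          = (\<Sum>v\<le>b. (L ^^ v) (?y j) \<star> F j v ?y)"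
        using False by (simp add: sum.atMost_Suc)
      also have "(\<Sum>v\<le>Suc b. (L ^^ v) (x j) \<star> (case v of 0 \<Rightarrow> 0 | Suc w \<Rightarrow> F j w x))
          = L (\<Sum>v\<le>b. (L ^^ v) (x j) \<star> F j v x)"
        by (subst sum.atMost_Suc_shift) (simp add: L_sum L_mul)
      finally show ?thesis by (simp only: False if_False)
    qed
    have "0 = lhs I J a b E F ?y - L (lhs I J a b E F x)"
      using id x y by simp
    also have "\<dots> = (\<Sum>i\<in>I. \<Sum>u\<le>a. E i u ?y \<star> (Rt ^^ u) (?y i) - L (E i u x \<star> (Rt ^^ u) (x i)))
       + (\<Sum>j\<in>J. (\<Sum>v\<le>b. (L ^^ v) (?y j) \<star> F j v ?y) - L (\<Sum>v\<le>b. (L ^^ v) (x j) \<star> F j v x))"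
      unfolding lhs_def by (simp only: L_add L_sum sum_subtractf) (simp add: algebra_simps)
    also have "\<dots> = (\<Sum>i\<in>I. \<Sum>u\<le>a. ?E i u x \<star> (Rt ^^ u) (x i))
       + (\<Sum>j\<in>J. if j = k then 0 else \<Sum>v\<le>Suc b. (L ^^ v) (x j) \<star> ?F j v x)"
      by (intro arg_cong2[where f = "(+)"] sum.cong refl e f) auto
    also have "(\<Sum>j\<in>J. if j = k then 0 else \<Sum>v\<le>Suc b. (L ^^ v) (x j) \<star> ?F j v x)
       = (\<Sum>j\<in>J - {k}. \<Sum>v\<le>Suc b. (L ^^ v) (x j) \<star> ?F j v x)"
      using assms(2,3) by (simp add: sum.remove[of J k])
    finally show ?thesis unfolding lhs_def by simp
  qed
  with cE cF show ?thesis
    by (intro only_stdD[OF only])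
qed

text \<open>After the recursion has brought the \<open>F j\<close> with \<open>j \<noteq> k\<close>
  into standard form, \<open>lterm_rterm\<close> turns their summands into summands ending in
  \<open>x\<^sub>i\<close>. These are added to the \<open>E i\<close>, and an identity with
  \<open>{k}\<close> in place of \<open>J\<close> remains, to which \<open>single\<close>
  applies.\<close>

lemma only_std_remove:
  assumes "finite I" "finite J" "k \<in> J"
    and only: "only_std I (J - {k}) a (Suc b)" and single: "only_std I {k} a b"
  shows "only_std I J a b"
  unfolding only_std_def
proof (intro allI impI)
  fix E F
  assume E: "\<forall>i\<in>I. \<forall>u\<le>a. coef i (E i u)" and F: "\<forall>j\<in>J. \<forall>v\<le>b. coef j (F j v)"
    and id: "\<forall>x\<in>X. lhs I J a b E F x = 0"
  define F' where "F' = (\<lambda>j v x. (if v \<le> b then F j v (x(k := L (x k))) else 0)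
            - (case v of 0 \<Rightarrow> 0 | Suc w \<Rightarrow> F j w x))"
  obtain p where p: "\<And>i u j v. i \<in> I \<Longrightarrow> u \<le> a \<Longrightarrow> j \<in> J - {k} \<Longrightarrow> v \<le> Suc b \<Longrightarrow> coef2 i j (p i u j v)"
    "\<And>x i u. x \<in> X \<Longrightarrow> i \<in> I \<Longrightarrow> u \<le> a \<Longrightarrow> (if i = k then Rt (E k u x) - L (E k u x) else E i u (x(k := L (x k))) - L (E i u x)) = (\<Sum>j\<in>J - {k}. \<Sum>v\<le>Suc b. lterm i j v x (p i u j v x))"
    "\<And>x j v. x \<in> X \<Longrightarrow> j \<in> J - {k} \<Longrightarrow> v \<le> Suc b \<Longrightarrow> F' j v x = - (\<Sum>i\<in>I. \<Sum>u\<le>a. rterm i j u x (p i u j v x))"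
    by (fact solE[OF reduced_identity[OF assms(1-3) E F id only, folded F'_def]])
  have rF: "rform I a j (F' j v)" if "j \<in> J - {k}" "v \<le> Suc b" for j v
  proof -
    have "rform I a j (\<lambda>x. \<Sum>i\<in>I. \<Sum>u\<le>a. rterm i j u x (p i u j v x))"
      unfolding rform_def by (rule exI[of _ "\<lambda>i u. p i u j v"]) (use p(1) that in auto)
    from rform_uminus[OF this] show ?thesis
      by (rule rform_cong) (simp add: p(3)[OF _ that])
  qed
  have fF: "rform I a j (F j v)" if "j \<in> J - {k}" "v \<le> b" for j v
  proof -
    \<comment> \<open>Induction on \<open>n = b - v\<close>. It starts from
      \<open>F' j (Suc b) = - F j b\<close> and continues with \<open>F j v = F j (Suc v)\<close> at
      the shifted tuple minus \<open>F' j (Suc v)\<close>.\<close>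
    have "rform I a j (F j (b - n))" if "n \<le> b" for n
      using that
    proof (induction n)
      case 0
      have "rform I a j (F' j (Suc b))" using \<open>j \<in> J - {k}\<close> by (intro rF) auto
      from rform_uminus[OF this] show ?case by (rule rform_cong) (auto simp: F'_def)
    next
      case (Suc n)
      then have b: "b - n = Suc (b - Suc n)" by simp
      have 1: "rform I a j (\<lambda>x. F j (b - n) (x(k := L (x k))))"
        using Suc \<open>j \<in> J - {k}\<close> by (intro rform_shift) auto
      have 2: "rform I a j (F' j (b - n))" using \<open>j \<in> J - {k}\<close> by (intro rF) auto
      from rform_diff[OF 1 2] show ?case
        by (rule rform_cong) (use b in \<open>auto simp: F'_def\<close>)
    qed
    from this[of "b - v"] that show ?thesis by simp
  qed
  define W where "W j v p \<longleftrightarrow> (\<forall>i\<in>I. \<forall>u\<le>a. coef2 i j (p i u)) \<and>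
     (\<forall>x\<in>X. F j v x = (\<Sum>i\<in>I. \<Sum>u\<le>a. rterm i j u x (p i u x)))" for j v p
  define P where "P j v = (SOME p. W j v p)" for j v
  have W: "W j v (P j v)" if "j \<in> J - {k}" "v \<le> b" for j v
  proof -
    have "\<exists>p. W j v p" using fF[OF that] by (simp add: rform_def W_def)
    then show ?thesis unfolding P_def by (rule someI_ex)
  qed
  have P: "\<And>i u j v. j \<in> J - {k} \<Longrightarrow> v \<le> b \<Longrightarrow> i \<in> I \<Longrightarrow> u \<le> a \<Longrightarrow> coef2 i j (P j v i u)"
     "\<And>j v x. j \<in> J - {k} \<Longrightarrow> v \<le> b \<Longrightarrow> x \<in> X \<Longrightarrow> F j v x = (\<Sum>i\<in>I. \<Sum>u\<le>a. rterm i j u x (P j v i u x))"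
    using W unfolding W_def by blast+
  \<comment> \<open>The original coefficient together with everything that the standard parts of the
    \<open>F j\<close>, \<open>j \<noteq> k\<close>, contribute on the left of
    \<open>x\<^sub>i\<close>.\<close>
  define E' where "E' i u x = E i u x + (\<Sum>j\<in>J - {k}. \<Sum>v\<le>b. lterm i j v x (P j v i u x))" for i u x
  have cE': "coef i (E' i u)" if "i \<in> I" "u \<le> a" for i u
  proof -
    have lt: "lterm i j v (x(i := r)) (P j v i u (x(i := r))) = lterm i j v x (P j v i u x)"
      if "j \<in> J - {k}" "v \<le> b" "x \<in> X" "r \<in> R" for j v x r
      using P(1)[OF that(1,2) \<open>i \<in> I\<close> \<open>u \<le> a\<close>] that unfolding coef2_def indep_def lterm_def by auto
    have "lterm i j v x (P j v i u x) \<in> Q" if "j \<in> J - {k}" "v \<le> b" "x \<in> X" for j v x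
    proof -
      have "P j v i u x \<in> Q"
        using P(1)[OF that(1,2) \<open>i \<in> I\<close> \<open>u \<le> a\<close>] that C_Q unfolding coef2_def by (auto split: if_splits)
      then show ?thesis using that X_Q unfolding lterm_def by (auto intro!: Q_Ln Q_mul)
    qed
    moreover have "indep i (E i u)" "\<forall>x\<in>X. E i u x \<in> Q" using E that by (auto simp: coef_def)
    ultimately show ?thesis using lt unfolding coef_def indep_def E'_def
      by (auto intro!: Q_add Q_sum simp del: fun_upd_apply)
  qed
  have "lhs I {k} a b E' F x = 0" if x: "x \<in> X" for x
  proof -
    have lr: "lterm i j v x (P j v i u x) \<star> (Rt ^^ u) (x i) = (L ^^ v) (x j) \<star> rterm i j u x (P j v i u x)"
      if "j \<in> J - {k}" "v \<le> b" "i \<in> I" "u \<le> a" for i u j v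
      using P(1)[OF that] x by (intro lterm_rterm) (auto simp: coef2_def)
    have "(\<Sum>j\<in>J - {k}. \<Sum>v\<le>b. (L ^^ v) (x j) \<star> F j v x)
       = (\<Sum>j\<in>J - {k}. \<Sum>v\<le>b. \<Sum>i\<in>I. \<Sum>u\<le>a. lterm i j v x (P j v i u x) \<star> (Rt ^^ u) (x i))"
      by (intro sum.cong refl) (simp add: P(2) x mul_sumr lr del: Diff_iff)
    also have "\<dots> = (\<Sum>i\<in>I. \<Sum>u\<le>a. \<Sum>j\<in>J - {k}. \<Sum>v\<le>b. lterm i j v x (P j v i u x) \<star> (Rt ^^ u) (x i))"
      by (rule sum_swap4)
    finally have *: "(\<Sum>j\<in>J - {k}. \<Sum>v\<le>b. (L ^^ v) (x j) \<star> F j v x)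
       = (\<Sum>i\<in>I. \<Sum>u\<le>a. (\<Sum>j\<in>J - {k}. \<Sum>v\<le>b. lterm i j v x (P j v i u x)) \<star> (Rt ^^ u) (x i))"
      by (simp add: mul_suml)
    have "lhs I {k} a b E' F x = lhs I J a b E F x"
      unfolding lhs_def E'_def using assms(2,3)
      by (simp add: sum.remove[of J k] * mul_addl sum.distrib algebra_simps)
    then show ?thesis using id x by simp
  qed
  then have sol: "sol I {k} a b E' F"
    using cE' F assms(3) by (intro only_stdD[OF single]) auto
  obtain p where p: "\<And>i u j v. i \<in> I \<Longrightarrow> u \<le> a \<Longrightarrow> j \<in> {k} \<Longrightarrow> v \<le> b \<Longrightarrow> coef2 i j (p i u j v)"
      "\<And>x i u. x \<in> X \<Longrightarrow> i \<in> I \<Longrightarrow> u \<le> a \<Longrightarrow> E' i u x = (\<Sum>j\<in>{k}. \<Sum>v\<le>b. lterm i j v x (p i u j v x))"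
      "\<And>x j v. x \<in> X \<Longrightarrow> j \<in> {k} \<Longrightarrow> v \<le> b \<Longrightarrow> F j v x = - (\<Sum>i\<in>I. \<Sum>u\<le>a. rterm i j u x (p i u j v x))"
    by (fact solE[OF sol])
  \<comment> \<open>\<open>P\<close> describes \<open>F j v\<close> itself, whereas a standard
    solution describes its negative; hence the sign.\<close>
  define q where "q i u j v x = (if j = k then p i u k v x else - P j v i u x)" for i u j v x
  have neg: "coef2 i j (\<lambda>x. - G x)" if "coef2 i j G" for i j G
    using coef2_diff[OF coef2_diff[OF that that] that] by simp
  have rneg: "rterm i j u x (- y) = - rterm i j u x y" and lneg: "lterm i j u x (- y) = - lterm i j u x y"
    for i j u x y
    using rterm_diff[of i j u x y y] rterm_diff[of i j u x 0 y] rterm_diff[of i j u x 0 0]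
      Ln_diff[of u 0 y] Ln_diff[of u 0 0]
    by (simp_all add: lterm_def mul_minusr)
  have "coef2 i j (q i u j v)" if "i \<in> I" "u \<le> a" "j \<in> J" "v \<le> b" for i u j v
    using p(1) P(1)[of j v i u] neg that unfolding q_def by (cases "j = k") auto
  moreover have "E i u x = (\<Sum>j\<in>J. \<Sum>v\<le>b. lterm i j v x (q i u j v x))" if "x \<in> X" "i \<in> I" "u \<le> a" for x i u
  proof -
    have "E i u x = E' i u x - (\<Sum>j\<in>J - {k}. \<Sum>v\<le>b. lterm i j v x (P j v i u x))"
      unfolding E'_def by simp
    also have "\<dots> = (\<Sum>v\<le>b. lterm i k v x (q i u k v x))
        + (\<Sum>j\<in>J - {k}. \<Sum>v\<le>b. lterm i j v x (q i u j v x))"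
      by (simp add: p(2) that q_def lneg sum_negf)
    finally show ?thesis using assms(2,3) by (simp add: sum.remove[of J k])
  qed
  moreover have "F j v x = - (\<Sum>i\<in>I. \<Sum>u\<le>a. rterm i j u x (q i u j v x))" if "x \<in> X" "j \<in> J" "v \<le> b" for x j v
    using p(3) P(2)[of j v x] that unfolding q_def by (cases "j = k") (auto simp: rneg sum_negf)
  ultimately show "sol I J a b E F" unfolding sol_def by blast
qed

text \<open>\<open>card J + b\<close> is invariant under the removal step, so the bound by
  \<open>d\<close> survives the induction: it leaves \<open>b \<le> d\<close> for empty
  \<open>J\<close> and \<open>b < d\<close> whenever an index is still present.\<close>

lemma only_std_all:
  assumes I: "finite I" and J: "finite J" "card J + b \<le> d"
    and empty: "\<And>b. b \<le> d \<Longrightarrow> only_std I {} a b"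
    and single: "\<And>k b. b < d \<Longrightarrow> k \<in> J \<Longrightarrow> only_std I {k} a b"
  shows "only_std I J a b"
  using J single
proof (induction "card J" arbitrary: J b)
  case 0
  then show ?case using empty by auto
next
  case (Suc n)
  then obtain k where k: "k \<in> J" by fastforce
  have n: "card (J - {k}) = n" using Suc.hyps(2) Suc.prems(1) k by simp
  have "only_std I (J - {k}) a (Suc b)"
  proof (rule Suc.hyps(1))
    show "card (J - {k}) + Suc b \<le> d" using Suc.prems(2) Suc.hyps(2)[symmetric] n by simp
    show "only_std I {l} a w" if "w < d" "l \<in> J - {k}" for l w
      using Suc.prems(3) that by simp
  qed (use n Suc.prems(1) in simp_all)
  moreover have "only_std I {k} a b"
    using Suc.prems(2) Suc.hyps(2)[symmetric] k by (intro Suc.prems(3)) simp_all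
  ultimately show ?case by (intro only_std_remove[OF I Suc.prems(1) k])
qed
end

section \<open>Left-right symmetry\<close>

lemma (in fi_ops) fi_ops_flip: "fi_ops (\<lambda>x y. y \<star> x) Rt L Q C R"
  by unfold_locales
    (auto simp: mul_addl mul_addr mul_assoc L_add Rt_add L_mul Rt_mul mid L_Rt
      Q_0 Q_diff Q_mul Q_L Q_Rt C_0 C_diff R_L R_Rt
      intro: C_Q[THEN subsetD] R_Q[THEN subsetD] C_comm[symmetric])

text \<open>Reversing the product exchanges \<open>E\<close> and \<open>F\<close>. The two formulas
  of a standard solution differ by a sign, so the coefficients change sign.\<close>

lemma only_std_flip:
  assumes "fi_ops mul L Rt Q C R"
    and only: "fi_ops.only_std (\<lambda>x y. mul y x) Rt L Q C R J I b a"
  shows "fi_ops.only_std mul L Rt Q C R I J a b"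
proof -
  interpret A: fi_ops mul L Rt Q C R by fact
  interpret B: fi_ops "\<lambda>x y. mul y x" Rt L Q C R
    by (rule A.fi_ops_flip)
  have coef2: "B.coef2 j i G = A.coef2 i j G" for i j G
    unfolding A.coef2_def by auto
  have lt: "B.lterm j i u x y = A.rterm i j u x y" and rt: "B.rterm j i u x y = A.lterm i j u x y" for i j u x y
    unfolding A.lterm_def B.lterm_def A.rterm_def B.rterm_def by auto
  have lhs: "B.lhs J I b a F E x = A.lhs I J a b E F x" for E F x
    unfolding A.lhs_def B.lhs_def by (simp add: add.commute)
  have rneg: "A.rterm i j u x (- y) = - A.rterm i j u x y" and lneg: "A.lterm i j u x (- y) = - A.lterm i j u x y"
    for i j u x y
    using A.rterm_diff[of i j u x y y] A.rterm_diff[of i j u x 0 y] A.rterm_diff[of i j u x 0 0]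
      A.Ln_diff[of u 0 y] A.Ln_diff[of u 0 0]
    by (simp_all add: A.lterm_def A.mul_minusr)
  have neg: "A.coef2 i j (\<lambda>x. - G x)" if "A.coef2 i j G" for i j G
    using A.coef2_diff[OF A.coef2_diff[OF that that] that] by simp
  show ?thesis unfolding A.only_std_def
  proof (intro allI impI)
    fix E F
    assume "\<forall>i\<in>I. \<forall>u\<le>a. A.coef i (E i u)" "\<forall>j\<in>J. \<forall>v\<le>b. A.coef j (F j v)"
      "\<forall>x\<in>A.X. A.lhs I J a b E F x = 0"
    then have sol: "B.sol J I b a F E"
      by (intro B.only_stdD[OF only]) (auto simp: lhs)
    obtain p where p: "\<And>i u j v. i \<in> J \<Longrightarrow> u \<le> b \<Longrightarrow> j \<in> I \<Longrightarrow> v \<le> a \<Longrightarrow> B.coef2 i j (p i u j v)"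
      "\<And>x i u. x \<in> B.X \<Longrightarrow> i \<in> J \<Longrightarrow> u \<le> b \<Longrightarrow> F i u x = (\<Sum>j\<in>I. \<Sum>v\<le>a. B.lterm i j v x (p i u j v x))"
      "\<And>x j v. x \<in> B.X \<Longrightarrow> j \<in> I \<Longrightarrow> v \<le> a \<Longrightarrow> E j v x = - (\<Sum>i\<in>J. \<Sum>u\<le>b. B.rterm i j u x (p i u j v x))"
      by (fact B.solE[OF sol])
    have p1: "A.coef2 i j (\<lambda>x. - p j v i u x)" if "i \<in> I" "u \<le> a" "j \<in> J" "v \<le> b" for i u j v
      using neg p(1)[OF that(3,4,1,2)] by (simp add: coef2)
    have p2: "E i u x = (\<Sum>j\<in>J. \<Sum>v\<le>b. A.lterm i j v x (- p j v i u x))"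
      if "x \<in> A.X" "i \<in> I" "u \<le> a" for x i u
      using p(3)[of x i u] that by (simp add: lneg rt sum_negf)
    have p3: "F j v x = - (\<Sum>i\<in>I. \<Sum>u\<le>a. A.rterm i j u x (- p j v i u x))"
      if "x \<in> A.X" "j \<in> J" "v \<le> b" for x j v
      using p(2)[of x j v] that by (simp add: rneg lt sum_negf)
    show "A.sol I J a b E F" unfolding A.sol_def
      by (rule exI[of _ "\<lambda>i u j v x. - p j v i u x"]) (use p1 p2 p3 in blast)
  qed
qed

section \<open>Reduction of small index sets to identities in one or two variables\<close>

lemma (in fi_ops) only_std_empty_empty: "only_std {} {} a b"
  unfolding only_std_def sol_def by simp

context fi_ops
begin

text \<open>With \<open>I\<close> empty the only standard solution is zero. All variables except
  \<open>x\<^sub>k\<close> are parameters, and the coefficients do not see \<open>x\<^sub>k\<close>,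
  so the question is one about constants in \<open>Q\<close>.\<close>

lemma only_std_empty_single:
  assumes "\<And>G. (\<And>v. v \<le> b \<Longrightarrow> G v \<in> Q) \<Longrightarrow> (\<And>x. x \<in> R \<Longrightarrow> (\<Sum>v\<le>b. (L ^^ v) x \<star> G v) = 0) \<Longrightarrow>
     \<forall>v\<le>b. G v = 0"
  shows "only_std {} {k} a b"
  unfolding only_std_def
proof (intro allI impI)
  fix E F
  assume F: "\<forall>j\<in>{k}. \<forall>v\<le>b. coef j (F j v)" and id: "\<forall>x\<in>X. lhs {} {k} a b E F x = 0"
  have "\<forall>v\<le>b. F k v x = 0" if x: "x \<in> X" for x
  proof (rule assms)
    show "F k v x \<in> Q" if "v \<le> b" for v using F x that by (simp add: coef_def)
    show "(\<Sum>v\<le>b. (L ^^ v) r \<star> F k v x) = 0" if r: "r \<in> R" for r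
    proof -
      have "F k v (x(k := r)) = F k v x" if "v \<le> b" for v
        using F x r that by (simp add: coef_def indep_def)
      moreover have "lhs {} {k} a b E F (x(k := r)) = 0" using id X_upd[OF x r] by blast
      ultimately show ?thesis by (simp add: lhs_def)
    qed
  qed
  then show "sol {} {k} a b E F" unfolding sol_def by simp
qed

text \<open>The identity is solved separately for each value of the other variables. The difficulty
  is to make the chosen coefficients independent of \<open>x\<^sub>k\<close>.\<close>

lemma only_std_diag:
  assumes base: "\<And>E F. (\<And>u. E u \<in> Q) \<Longrightarrow> (\<And>v. F v \<in> Q) \<Longrightarrow>
     (\<And>x. x \<in> R \<Longrightarrow> (\<Sum>u\<le>a. E u \<star> (Rt ^^ u) x) + (\<Sum>v\<le>b. (L ^^ v) x \<star> F v) = 0) \<Longrightarrow>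
     \<exists>p. (\<forall>u\<le>a. \<forall>v\<le>b. p u v \<in> C) \<and> (\<forall>u\<le>a. E u = (\<Sum>v\<le>b. (L ^^ v) (p u v))) \<and>
       (\<forall>v\<le>b. F v = - (\<Sum>u\<le>a. (Rt ^^ u) (p u v)))"
  shows "only_std {k} {k} a b"
  unfolding only_std_def
proof (intro allI impI)
  fix E F
  assume E: "\<forall>i\<in>{k}. \<forall>u\<le>a. coef i (E i u)" and F: "\<forall>j\<in>{k}. \<forall>v\<le>b. coef j (F j v)"
    and id: "\<forall>x\<in>X. lhs {k} {k} a b E F x = 0"
  \<comment> \<open>Zero outside the range of exponents makes \<open>e x\<close> and
    \<open>f x\<close> equal as functions when \<open>x\<^sub>k\<close> changes. \<open>P\<close>
    below depends on \<open>x\<close> through them only, hence not on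
    \<open>x\<^sub>k\<close>.\<close>
  define e where "e x u = (if u \<le> a then E k u x else 0)" for x u
  define f where "f x v = (if v \<le> b then F k v x else 0)" for x v
  define W where "W E F p \<longleftrightarrow> (\<forall>u\<le>a. \<forall>v\<le>b. p u v \<in> C) \<and> (\<forall>u\<le>a. E u = (\<Sum>v\<le>b. (L ^^ v) (p u v))) \<and>
       (\<forall>v\<le>b. F v = - (\<Sum>u\<le>a. (Rt ^^ u) (p u v)))" for E F :: "nat \<Rightarrow> 'q" and p
  define P where "P x = (SOME p. W (e x) (f x) p)" for x
  have ind: "e (x(k := r)) = e x" "f (x(k := r)) = f x" if "x \<in> X" "r \<in> R" for x r
    using E F that by (auto simp: e_def f_def coef_def indep_def)
  have W: "W (e x) (f x) (P x)" if x: "x \<in> X" for x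
  proof -
    have "\<exists>p. W (e x) (f x) p" unfolding W_def
    proof (rule base)
      show "e x u \<in> Q" "f x u \<in> Q" for u using E F x Q_0 by (auto simp: e_def f_def coef_def)
      fix r assume r: "r \<in> R"
      have "lhs {k} {k} a b E F (x(k := r)) = (\<Sum>u\<le>a. e (x(k := r)) u \<star> (Rt ^^ u) r) + (\<Sum>v\<le>b. (L ^^ v) r \<star> f (x(k := r)) v)"
        by (simp add: lhs_def e_def f_def)
      moreover have "lhs {k} {k} a b E F (x(k := r)) = 0" using id X_upd[OF x r] by blast
      ultimately show "(\<Sum>u\<le>a. e x u \<star> (Rt ^^ u) r) + (\<Sum>v\<le>b. (L ^^ v) r \<star> f x v) = 0"
        by (simp add: ind[OF x r])
    qed
    then show ?thesis unfolding P_def by (rule someI_ex)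
  qed
  have "indep k (\<lambda>x. P x u v)" for u v
    using ind unfolding indep_def P_def by simp
  then show "sol {k} {k} a b E F" unfolding sol_def
    by (intro exI[of _ "\<lambda>i u j v x. P x u v"]) (use W in \<open>auto simp: W_def coef2_def e_def f_def lterm_def rterm_def\<close>)
qed

text \<open>Here \<open>E l u\<close> still depends on \<open>x\<^sub>k\<close> and
  \<open>F k v\<close> on \<open>x\<^sub>l\<close>, so with the other variables fixed they become
  functions of one argument, while the coefficients sought are constants.\<close>

lemma only_std_offdiag:
  assumes base: "\<And>E F. (\<And>u x. x \<in> R \<Longrightarrow> E u x \<in> Q) \<Longrightarrow> (\<And>v x. x \<in> R \<Longrightarrow> F v x \<in> Q) \<Longrightarrow>
     (\<And>x y. x \<in> R \<Longrightarrow> y \<in> R \<Longrightarrow> (\<Sum>u\<le>a. E u x \<star> (Rt ^^ u) y) + (\<Sum>v\<le>b. (L ^^ v) x \<star> F v y) = 0) \<Longrightarrow>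
     \<exists>p. (\<forall>u\<le>a. \<forall>v\<le>b. p u v \<in> Q) \<and> (\<forall>x\<in>R. \<forall>u\<le>a. E u x = (\<Sum>v\<le>b. (L ^^ v) x \<star> p u v)) \<and>
       (\<forall>y\<in>R. \<forall>v\<le>b. F v y = - (\<Sum>u\<le>a. p u v \<star> (Rt ^^ u) y))"
    and kl: "l \<noteq> k"
  shows "only_std {l} {k} a b"
  unfolding only_std_def
proof (intro allI impI)
  fix E F
  assume E: "\<forall>i\<in>{l}. \<forall>u\<le>a. coef i (E i u)" and F: "\<forall>j\<in>{k}. \<forall>v\<le>b. coef j (F j v)"
    and id: "\<forall>x\<in>X. lhs {l} {k} a b E F x = 0"
  \<comment> \<open>Truncating to \<open>R\<close> and to the exponents in use again gives equality
    of functions, so that a choice made from \<open>e x\<close> and \<open>f x\<close> ignores both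
    \<open>x\<^sub>k\<close> and \<open>x\<^sub>l\<close>.\<close>
  define e where "e x u r = (if u \<le> a \<and> r \<in> R then E l u (x(k := r)) else 0)" for x u r
  define f where "f x v r = (if v \<le> b \<and> r \<in> R then F k v (x(l := r)) else 0)" for x v r
  define W where "W E F p \<longleftrightarrow> (\<forall>u\<le>a. \<forall>v\<le>b. p u v \<in> Q) \<and> (\<forall>x\<in>R. \<forall>u\<le>a. E u x = (\<Sum>v\<le>b. (L ^^ v) x \<star> p u v)) \<and>
       (\<forall>y\<in>R. \<forall>v\<le>b. F v y = - (\<Sum>u\<le>a. p u v \<star> (Rt ^^ u) y))" for E F :: "nat \<Rightarrow> 'q \<Rightarrow> 'q" and p
  define P where "P x = (SOME p. W (e x) (f x) p)" for x
  have indE: "E l u (x(l := r)) = E l u x" if "x \<in> X" "r \<in> R" "u \<le> a" for x r u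
    using E that by (auto simp: coef_def indep_def)
  have indF: "F k v (x(k := r)) = F k v x" if "x \<in> X" "r \<in> R" "v \<le> b" for x r v
    using F that by (auto simp: coef_def indep_def)
  have ek: "e (x(k := r)) = e x" and fl: "f (x(l := r)) = f x" for x r
    by (auto simp: e_def f_def fun_eq_iff)
  have el: "e (x(l := r)) = e x" if "x \<in> X" "r \<in> R" for x r
  proof (intro ext)
    fix u s
    show "e (x(l := r)) u s = e x u s"
      using indE[of "x(k := s)" r u] X_upd that kl by (simp add: e_def fun_upd_twist)
  qed
  have fk: "f (x(k := r)) = f x" if "x \<in> X" "r \<in> R" for x r
  proof (intro ext)
    fix u s
    show "f (x(k := r)) u s = f x u s"
      using indF[of "x(l := s)" r u] X_upd that kl by (simp add: f_def fun_upd_twist)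
  qed
  have W: "W (e x) (f x) (P x)" if x: "x \<in> X" for x
  proof -
    have "\<exists>p. W (e x) (f x) p" unfolding W_def
    proof (rule base)
      show "e x u r \<in> Q" "f x u r \<in> Q" if "r \<in> R" for u r
        using E F X_upd[OF x that] Q_0 by (auto simp: e_def f_def coef_def)
      fix r s assume r: "r \<in> R" and s: "s \<in> R"
      let ?y = "x(k := r, l := s)"
      have y: "?y \<in> X" using x r s X_upd by blast
      have "E l u ?y = e x u r" if "u \<le> a" for u
        using indE[OF X_upd[OF x r] s that] that r by (simp add: e_def)
      moreover have "F k v ?y = f x v s" if "v \<le> b" for v
        using indF[OF X_upd[OF x s] r that] that s by (simp add: f_def fun_upd_twist[OF kl[symmetric]])
      ultimately have "lhs {l} {k} a b E F ?y = (\<Sum>u\<le>a. e x u r \<star> (Rt ^^ u) s) + (\<Sum>v\<le>b. (L ^^ v) r \<star> f x v s)"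
        using kl by (simp add: lhs_def)
      moreover have "lhs {l} {k} a b E F ?y = 0" using id y by blast
      ultimately show "(\<Sum>u\<le>a. e x u r \<star> (Rt ^^ u) s) + (\<Sum>v\<le>b. (L ^^ v) r \<star> f x v s) = 0"
        by simp
    qed
    then show ?thesis unfolding P_def by (rule someI_ex)
  qed
  have ind: "indep k (\<lambda>x. P x u v)" "indep l (\<lambda>x. P x u v)" for u v
    using ek fl el fk unfolding indep_def P_def by simp_all
  have Pe: "E l u x = (\<Sum>v\<le>b. (L ^^ v) (x k) \<star> P x u v)" if "x \<in> X" "u \<le> a" for x u
  proof -
    have "e x u (x k) = E l u x" using that X_R by (simp add: e_def)
    then show ?thesis using W[OF that(1)] that X_R[OF that(1), of k] unfolding W_def by metis
  qed
  have Pf: "F k v x = - (\<Sum>u\<le>a. P x u v \<star> (Rt ^^ u) (x l))" if "x \<in> X" "v \<le> b" for x v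
  proof -
    have "f x v (x l) = F k v x" using that X_R by (simp add: f_def)
    then show ?thesis using W[OF that(1)] that X_R[OF that(1), of l] unfolding W_def by metis
  qed
  have "\<forall>u\<le>a. \<forall>v\<le>b. P x u v \<in> Q" if "x \<in> X" for x
    using W[OF that] unfolding W_def by blast
  then show "sol {l} {k} a b E F" unfolding sol_def
    by (intro exI[of _ "\<lambda>i u j v x. P x u v"]) (use ind Pe Pf kl in \<open>auto simp: coef2_def lterm_def rterm_def\<close>)
qed

end

text \<open>Reducing \<open>J\<close> leaves \<open>I\<close> and \<open>a\<close> untouched, and
  vice versa after reversing the product, so the two reductions do not interfere. They end in the
  four cases in which each side has at most one index.\<close>

theorem (in fi_ops) only_std_general:
  assumes I: "finite I" "card I + a \<le> d" and J: "finite J" "card J + b \<le> d"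
    and left: "\<And>b G. b < d \<Longrightarrow> (\<And>v. v \<le> b \<Longrightarrow> G v \<in> Q) \<Longrightarrow>
      (\<And>x. x \<in> R \<Longrightarrow> (\<Sum>v\<le>b. (L ^^ v) x \<star> G v) = 0) \<Longrightarrow> \<forall>v\<le>b. G v = 0"
    and right: "\<And>a G. a < d \<Longrightarrow> (\<And>u. u \<le> a \<Longrightarrow> G u \<in> Q) \<Longrightarrow>
      (\<And>x. x \<in> R \<Longrightarrow> (\<Sum>u\<le>a. G u \<star> (Rt ^^ u) x) = 0) \<Longrightarrow> \<forall>u\<le>a. G u = 0"
    and both: "\<And>k l a b. a < d \<Longrightarrow> b < d \<Longrightarrow> only_std {l} {k} a b"
  shows "only_std I J a b"
proof (rule only_std_all[OF I(1) J])
  interpret op: fi_ops "\<lambda>x y. y \<star> x" Rt L Q C R by (rule fi_ops_flip)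
  have flip: "only_std I' J' a' b'" if "op.only_std J' I' b' a'" for I' J' a' b'
    using only_std_flip[OF fi_ops_axioms] that by blast
  have flip': "op.only_std J' I' b' a'" if "only_std I' J' a' b'" for I' J' a' b'
    using only_std_flip[OF fi_ops_flip] that by blast
  show "only_std I {} a b'" for b'
  proof (rule flip, rule op.only_std_all[OF finite.emptyI I])
    show "op.only_std {} {} b' a'" for a' by (rule op.only_std_empty_empty)
    show "op.only_std {} {l} b' a'" if "a' < d" for l a'
      by (rule op.only_std_empty_single) (use right[OF that] in blast)
  qed
  show "only_std I {k} a b'" if "b' < d" for k b'
  proof (rule flip, rule op.only_std_all[OF _ I])
    show "op.only_std {k} {} b' a'" for a'
      by (rule flip', rule only_std_empty_single) (use left[OF that] in blast)
    show "op.only_std {k} {l} b' a'" if "a' < d" for l a'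
      using flip' both that \<open>b' < d\<close> by blast
  qed simp
qed

section \<open>Identities with central values\<close>

text \<open>\<open>L\<close> and \<open>Rt\<close> will be multiplications by two different
  operators, so \<open>mid\<close> has no counterpart here; that left and right multiplications
  commute is what remains.\<close>

locale commuting_shifts =
  fixes L Rt :: "'q::ab_group_add \<Rightarrow> 'q" and R C :: "'q set"
  assumes L_add: "L (x + y) = L x + L y" and Rt_add: "Rt (x + y) = Rt x + Rt y"
    and L_Rt: "L (Rt x) = Rt (L x)"
    and R_L: "x \<in> R \<Longrightarrow> L x \<in> R" and R_Rt: "x \<in> R \<Longrightarrow> Rt x \<in> R"
    and C_0: "0 \<in> C" and C_diff: "x \<in> C \<Longrightarrow> y \<in> C \<Longrightarrow> x - y \<in> C"
begin

definition X :: "(nat \<Rightarrow> 'q) set" where "X = {x. \<forall>i. x i \<in> R}"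

text \<open>Equivariance in one variable is all that matters about the summands \<open>E\<^sub>i x\<^sub>i\<close> and \<open>x\<^sub>j F\<^sub>j\<close> when
  the value of an identity is central.\<close>
definition only_zero :: "nat set \<Rightarrow> nat set \<Rightarrow> nat \<Rightarrow> nat \<Rightarrow> bool" where
  "only_zero I J c c' \<longleftrightarrow> (\<forall>g f \<theta>.
     (\<forall>i\<in>I. \<forall>x\<in>X. g i (x(i := Rt (x i))) = Rt (g i x)) \<longrightarrow>
     (\<forall>j\<in>J. \<forall>x\<in>X. f j (x(j := L (x j))) = L (f j x)) \<longrightarrow>
     (\<forall>r\<le>c. \<forall>s\<le>c'. \<forall>x\<in>X. \<theta> r s x \<in> C) \<longrightarrow>
     (\<forall>x\<in>X. (\<Sum>i\<in>I. g i x) + (\<Sum>j\<in>J. f j x) = (\<Sum>r\<le>c. \<Sum>s\<le>c'. (L ^^ r) ((Rt ^^ s) (\<theta> r s x)))) \<longrightarrow>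
     (\<forall>r\<le>c. \<forall>s\<le>c'. \<forall>x\<in>X. \<theta> r s x = 0))"

lemma only_zeroD:
  assumes "only_zero I J c c'" "\<And>i x. i \<in> I \<Longrightarrow> x \<in> X \<Longrightarrow> g i (x(i := Rt (x i))) = Rt (g i x)"
    "\<And>j x. j \<in> J \<Longrightarrow> x \<in> X \<Longrightarrow> f j (x(j := L (x j))) = L (f j x)"
    "\<And>r s x. r \<le> c \<Longrightarrow> s \<le> c' \<Longrightarrow> x \<in> X \<Longrightarrow> \<theta> r s x \<in> C"
    "\<And>x. x \<in> X \<Longrightarrow> (\<Sum>i\<in>I. g i x) + (\<Sum>j\<in>J. f j x) = (\<Sum>r\<le>c. \<Sum>s\<le>c'. (L ^^ r) ((Rt ^^ s) (\<theta> r s x)))"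
    "r \<le> c" "s \<le> c'" "x \<in> X"
  shows "\<theta> r s x = 0"
  using assms(1)[unfolded only_zero_def, rule_format, of g f \<theta> r s x] assms(2-) by simp

lemma L_0 [simp]: "L 0 = 0" using L_add[of 0 0] by simp
lemma Rt_0 [simp]: "Rt 0 = 0" using Rt_add[of 0 0] by simp
lemma L_diff: "L (x - y) = L x - L y"
  using L_add[of "x - y" y] by (simp add: algebra_simps)
lemma Rt_diff: "Rt (x - y) = Rt x - Rt y"
  using Rt_add[of "x - y" y] by (simp add: algebra_simps)
lemma L_sum: "L (sum g S) = (\<Sum>s\<in>S. L (g s))"
  by (induction S rule: infinite_finite_induct) (auto simp: L_add)
lemma Ln_diff: "(L ^^ v) (x - y) = (L ^^ v) x - (L ^^ v) y"
  by (induction v) (auto simp: L_diff)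
lemma Rtn_diff: "(Rt ^^ v) (x - y) = (Rt ^^ v) x - (Rt ^^ v) y"
  by (induction v) (auto simp: Rt_diff)
lemma Ln_0 [simp]: "(L ^^ v) 0 = 0" by (induction v) auto
lemma Rtn_0 [simp]: "(Rt ^^ v) 0 = 0" by (induction v) auto
lemma Ln_Rt: "(L ^^ v) (Rt x) = Rt ((L ^^ v) x)" by (induction v) (auto simp: L_Rt)
lemma Ln_Rtn: "(L ^^ v) ((Rt ^^ u) x) = (Rt ^^ u) ((L ^^ v) x)"
  by (induction u) (auto simp: Ln_Rt)

lemma X_L: "x \<in> X \<Longrightarrow> x(k := L (x k)) \<in> X"
  by (simp add: X_def R_L)

text \<open>The operator \<open>D\<close> below kills \<open>f k\<close> by equivariance. It
  preserves the equivariance of every \<open>g i\<close>, even for \<open>i = k\<close>, because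
  \<open>L\<close> and \<open>Rt\<close> commute.\<close>

lemma only_zero_remove:
  assumes J: "finite J" "k \<in> J" and only: "only_zero I (J - {k}) (Suc c) c'"
  shows "only_zero I J c c'"
  unfolding only_zero_def
proof (intro allI impI)
  fix g f \<theta>
  assume g: "\<forall>i\<in>I. \<forall>x\<in>X. g i (x(i := Rt (x i))) = Rt (g i x)"
    and f: "\<forall>j\<in>J. \<forall>x\<in>X. f j (x(j := L (x j))) = L (f j x)"
    and \<theta>: "\<forall>r\<le>c. \<forall>s\<le>c'. \<forall>x\<in>X. \<theta> r s x \<in> C"
    and eq: "\<forall>x\<in>X. (\<Sum>i\<in>I. g i x) + (\<Sum>j\<in>J. f j x) = (\<Sum>r\<le>c. \<Sum>s\<le>c'. (L ^^ r) ((Rt ^^ s) (\<theta> r s x)))"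
  define D where "D h x = h (x(k := L (x k))) - L (h x)" for h x
  define \<theta>' where "\<theta>' r s x = (if r \<le> c then \<theta> r s (x(k := L (x k))) else 0)
     - (case r of 0 \<Rightarrow> 0 | Suc w \<Rightarrow> \<theta> w s x)" for r s x
  have Dg: "D (g i) (x(i := Rt (x i))) = Rt (D (g i) x)" if "i \<in> I" "x \<in> X" for i x
  proof -
    let ?x = "x(i := Rt (x i))" and ?y = "x(k := L (x k))"
    have "?x(k := L (?x k)) = ?y(i := Rt (?y i))" by (auto simp: fun_eq_iff L_Rt)
    then show ?thesis using g that X_L[OF that(2)]
      by (simp only: D_def Rt_diff L_Rt)
  qed
  have Df: "D (f j) (x(j := L (x j))) = L (D (f j) x)" if "j \<in> J - {k}" "x \<in> X" for j x
  proof -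
    let ?x = "x(j := L (x j))" and ?y = "x(k := L (x k))"
    have "?x(k := L (?x k)) = ?y(j := L (?y j))" using that by (auto simp: fun_eq_iff)
    moreover have "j \<in> J" using that by blast
    ultimately show ?thesis using f that(2) X_L[OF that(2)]
      by (simp only: D_def L_diff)
  qed
  have Dk: "D (f k) x = 0" if "x \<in> X" for x
    using f J(2) that by (simp only: D_def diff_self)
  have \<theta>': "\<theta>' r s x \<in> C" if "r \<le> Suc c" "s \<le> c'" "x \<in> X" for r s x
    unfolding \<theta>'_def using that \<theta> X_L[OF that(3), of k] by (intro C_diff) (auto simp: C_0 split: nat.split)
  have "(\<Sum>i\<in>I. D (g i) x) + (\<Sum>j\<in>J - {k}. D (f j) x)
      = (\<Sum>r\<le>Suc c. \<Sum>s\<le>c'. (L ^^ r) ((Rt ^^ s) (\<theta>' r s x)))" if x: "x \<in> X" for x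
  proof -
    let ?y = "x(k := L (x k))"
    have "(\<Sum>i\<in>I. D (g i) x) + (\<Sum>j\<in>J - {k}. D (f j) x) = (\<Sum>i\<in>I. D (g i) x) + (\<Sum>j\<in>J. D (f j) x)"
      using J Dk[OF x] by (simp add: sum.remove[of J k])
    also have "\<dots> = ((\<Sum>i\<in>I. g i ?y) + (\<Sum>j\<in>J. f j ?y)) - L ((\<Sum>i\<in>I. g i x) + (\<Sum>j\<in>J. f j x))"
      unfolding D_def by (simp only: L_add L_sum sum_subtractf) (simp add: algebra_simps)
    also have "\<dots> = (\<Sum>r\<le>c. \<Sum>s\<le>c'. (L ^^ r) ((Rt ^^ s) (\<theta> r s ?y)))
        - L (\<Sum>r\<le>c. \<Sum>s\<le>c'. (L ^^ r) ((Rt ^^ s) (\<theta> r s x)))"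
      using eq x X_L[OF x] by (simp only:)
    also have "(\<Sum>r\<le>c. \<Sum>s\<le>c'. (L ^^ r) ((Rt ^^ s) (\<theta> r s ?y)))
       = (\<Sum>r\<le>Suc c. \<Sum>s\<le>c'. (L ^^ r) ((Rt ^^ s) (if r \<le> c then \<theta> r s ?y else 0)))"
      by simp
    also have "L (\<Sum>r\<le>c. \<Sum>s\<le>c'. (L ^^ r) ((Rt ^^ s) (\<theta> r s x)))
       = (\<Sum>r\<le>Suc c. \<Sum>s\<le>c'. (L ^^ r) ((Rt ^^ s) (case r of 0 \<Rightarrow> 0 | Suc w \<Rightarrow> \<theta> w s x)))"
      by (subst sum.atMost_Suc_shift) (simp add: L_sum)
    finally show ?thesis unfolding \<theta>'_def by (simp only: Ln_diff Rtn_diff sum_subtractf)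
  qed
  note eq' = this
  have z: "\<theta>' r s x = 0" if "r \<le> Suc c" "s \<le> c'" "x \<in> X" for r s x
    by (rule only_zeroD[OF only, where g = "\<lambda>i. D (g i)" and f = "\<lambda>j. D (f j)"])
      (fact Dg Df \<theta>' eq' that)+
  \<comment> \<open>Induction on \<open>n = c - r\<close>, starting from
    \<open>\<theta>' (Suc c) = - \<theta> c\<close>. The claim is made for all \<open>x\<close>
    because the step uses it at the shifted tuple.\<close>
  have "\<forall>x\<in>X. \<theta> (c - n) s x = 0" if "n \<le> c" "s \<le> c'" for n s
    using that(1)
  proof (induction n)
    case 0
    show ?case
    proof
      fix x assume "x \<in> X"
      then have "\<theta>' (Suc c) s x = 0" using that by (intro z) auto
      then show "\<theta> (c - 0) s x = 0" by (simp add: \<theta>'_def)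
    qed
  next
    case (Suc n)
    then have b: "c - n = Suc (c - Suc n)" by simp
    show ?case
    proof
      fix x assume x: "x \<in> X"
      then have "\<theta>' (c - n) s x = 0" using that by (intro z) auto
      moreover have "\<theta> (c - n) s (x(k := L (x k))) = 0" using Suc X_L[OF x] by simp
      ultimately show "\<theta> (c - Suc n) s x = 0"
        using b by (simp add: \<theta>'_def split: if_splits)
    qed
  qed
  then show "\<forall>x\<in>X. \<theta> r s x = 0" if "r \<le> c" "s \<le> c'" for r s
    using that by (metis diff_diff_cancel diff_le_self)
qed

lemma only_zero_all:
  assumes J: "finite J" "card J + c < d" and empty: "\<And>c. c < d \<Longrightarrow> only_zero I {} c c'"
  shows "only_zero I J c c'"
  using J
proof (induction "card J" arbitrary: J c)
  case 0
  then show ?case using empty by auto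
next
  case (Suc n)
  then obtain k where k: "k \<in> J" by fastforce
  have n: "card (J - {k}) = n" using Suc.hyps(2) Suc.prems(1) k by simp
  have "only_zero I (J - {k}) (Suc c) c'"
    by (rule Suc.hyps(1)) (use n Suc.prems Suc.hyps(2)[symmetric] in simp_all)
  then show ?case by (rule only_zero_remove[OF Suc.prems(1) k])
qed

lemma commuting_shifts_flip: "commuting_shifts Rt L R C"
  by unfold_locales (auto simp: L_add Rt_add L_Rt R_L R_Rt C_0 C_diff)

end

lemma only_zero_flip:
  assumes "commuting_shifts L Rt R C" and only: "commuting_shifts.only_zero Rt L R C J I c' c"
  shows "commuting_shifts.only_zero L Rt R C I J c c'"
proof -
  interpret A: commuting_shifts L Rt R C by fact
  interpret B: commuting_shifts Rt L R C by (rule A.commuting_shifts_flip)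
  show ?thesis unfolding A.only_zero_def
  proof (intro allI impI)
    fix g f \<theta>
    assume *: "\<forall>i\<in>I. \<forall>x\<in>A.X. g i (x(i := Rt (x i))) = Rt (g i x)"
      "\<forall>j\<in>J. \<forall>x\<in>A.X. f j (x(j := L (x j))) = L (f j x)"
      "\<forall>r\<le>c. \<forall>s\<le>c'. \<forall>x\<in>A.X. \<theta> r s x \<in> C"
      "\<forall>x\<in>A.X. (\<Sum>i\<in>I. g i x) + (\<Sum>j\<in>J. f j x) = (\<Sum>r\<le>c. \<Sum>s\<le>c'. (L ^^ r) ((Rt ^^ s) (\<theta> r s x)))"
    have eq: "\<forall>x\<in>A.X. (\<Sum>j\<in>J. f j x) + (\<Sum>i\<in>I. g i x) = (\<Sum>s\<le>c'. \<Sum>r\<le>c. (Rt ^^ s) ((L ^^ r) (\<theta> r s x)))"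
      using *(4) by (subst sum.swap) (simp add: add.commute A.Ln_Rtn)
    have "\<theta> r s x = 0" if "s \<le> c'" "r \<le> c" "x \<in> A.X" for r s x
      by (rule B.only_zeroD[OF only, where \<theta> = "\<lambda>s r. \<theta> r s"]) (use * eq that in auto)
    then show "\<forall>x\<in>A.X. \<theta> r s x = 0" if "r \<le> c" "s \<le> c'" for r s
      using that by blast
  qed
qed

text \<open>Starting from exponent 0, the removal of all indices ends with exponents up to
  \<open>card J\<close> on the left and \<open>card I\<close> on the right. The strict bounds on the
  cardinalities keep them below \<open>d\<close>, where \<open>indep\<close> applies.\<close>

theorem (in commuting_shifts) only_zero_general:
  assumes I: "finite I" "card I < d" and J: "finite J" "card J < d"
    and indep: "\<And>c c' \<theta>. c < d \<Longrightarrow> c' < d \<Longrightarrow> (\<And>r s. r \<le> c \<Longrightarrow> s \<le> c' \<Longrightarrow> \<theta> r s \<in> C) \<Longrightarrow>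
      (\<Sum>r\<le>c. \<Sum>s\<le>c'. (L ^^ r) ((Rt ^^ s) (\<theta> r s))) = 0 \<Longrightarrow> \<forall>r\<le>c. \<forall>s\<le>c'. \<theta> r s = 0"
  shows "only_zero I J 0 0"
proof (rule only_zero_all[OF J(1)])
  interpret op: commuting_shifts Rt L R C by (rule commuting_shifts_flip)
  show "card J + 0 < d" using J by simp
  show "only_zero I {} c 0" if "c < d" for c
  proof (rule only_zero_flip[OF commuting_shifts_axioms], rule op.only_zero_all[OF I(1)])
    show "card I + 0 < d" using I by simp
    show "op.only_zero {} {} c' c" if "c' < d" for c'
    proof (rule only_zero_flip[OF commuting_shifts_flip], unfold only_zero_def, intro allI impI)
      fix g f :: "nat \<Rightarrow> (nat \<Rightarrow> 'q) \<Rightarrow> 'q" and \<theta> r s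
      assume C: "\<forall>r\<le>c. \<forall>s\<le>c'. \<forall>x\<in>X. \<theta> r s x \<in> C" and rs: "r \<le> c" "s \<le> c'"
        and eq: "\<forall>x\<in>X. (\<Sum>i\<in>{}. g i x) + (\<Sum>j\<in>{}. f j x) = (\<Sum>r\<le>c. \<Sum>s\<le>c'. (L ^^ r) ((Rt ^^ s) (\<theta> r s x)))"
      show "\<forall>x\<in>X. \<theta> r s x = 0"
      proof
        fix x assume x: "x \<in> X"
        have "\<forall>r\<le>c. \<forall>s\<le>c'. \<theta> r s x = 0"
          by (rule indep[OF \<open>c < d\<close> \<open>c' < d\<close>]) (use C eq x in auto)
        then show "\<theta> r s x = 0" using rs by blast
      qed
    qed
  qed
qed

section \<open>Powers of a finite rank operator\<close>

text \<open>Duality for a subspace \<open>L\<close> of coordinate functions. In the induction step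
  the alternative is applied to the functions vanishing at \<open>s\<close>; a relation found there
  extends to \<open>L\<close> once the coefficient of the coordinate \<open>s\<close> is
  fixed.\<close>

lemma dual_or_relation:
  fixes L :: "('i \<Rightarrow> 'f::field) set"
  assumes comb: "\<And>l l' k. l \<in> L \<Longrightarrow> l' \<in> L \<Longrightarrow> (\<lambda>i. l i + k * l' i) \<in> L"
    and scale: "\<And>l k. l \<in> L \<Longrightarrow> (\<lambda>i. k * l i) \<in> L"
    and S: "finite S" "c \<notin> S"
  shows "(\<exists>l\<in>L. l c = 1 \<and> (\<forall>s\<in>S. l s = 0)) \<or> (\<exists>a. \<forall>l\<in>L. l c = (\<Sum>s\<in>S. a s * l s))"
  using S comb scale
proof (induction S arbitrary: L rule: finite_induct)
  case empty
  show ?case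
  proof (cases "\<exists>l\<in>L. l c \<noteq> 0")
    case True
    then obtain l where "l \<in> L" "l c \<noteq> 0" by blast
    then show ?thesis using empty.prems(3)[of l "1 / l c"] by (intro disjI1 bexI[of _ "\<lambda>i. 1 / l c * l i"]) auto
  qed auto
next
  case (insert s S)
  define L' where "L' = {l \<in> L. l s = 0}"
  have "(\<exists>l\<in>L'. l c = 1 \<and> (\<forall>s\<in>S. l s = 0)) \<or> (\<exists>a. \<forall>l\<in>L'. l c = (\<Sum>s\<in>S. a s * l s))"
    by (rule insert.IH) (use insert.prems in \<open>auto simp: L'_def\<close>)
  then consider l where "l \<in> L'" "l c = 1" "\<forall>s\<in>S. l s = 0"
    | a where "\<forall>l\<in>L'. l c = (\<Sum>s\<in>S. a s * l s)" by blast
  then show ?case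
  proof cases
    case 1
    then show ?thesis by (intro disjI1 bexI[of _ l]) (auto simp: L'_def)
  next
    case (2 a)
    have sum_upd: "(\<Sum>s'\<in>S. (if s' = s then y else a s') * l s') = (\<Sum>s'\<in>S. a s' * l s')" for y l
      using insert.hyps by (intro sum.cong) auto
    show ?thesis
    proof (cases "L' = L")
      case True
      have "\<forall>l\<in>L. l c = (\<Sum>s'\<in>insert s S. (if s' = s then 0 else a s') * l s')"
        using 2 True insert.hyps by (simp add: sum_upd)
      then show ?thesis by (intro disjI2 exI)
    next
      case False
      then obtain l where l: "l \<in> L" "l s \<noteq> 0" by (auto simp: L'_def)
      define m where "m = (\<lambda>i. 1 / l s * l i)"
      have m: "m \<in> L" "m s = 1" unfolding m_def by (rule insert.prems(3)[OF l(1)]) (simp add: l(2))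
      \<comment> \<open>The coefficient at \<open>s\<close> is forced by \<open>m\<close>, which is
        normalised to \<open>m s = 1\<close>. Subtracting \<open>l s\<close> times \<open>m\<close>
        from any \<open>l\<close> leads into \<open>L'\<close>, where the old relation
        holds.\<close>
      define b where "b = m c - (\<Sum>s\<in>S. a s * m s)"
      have "l c = b * l s + (\<Sum>s\<in>S. a s * l s)" if "l \<in> L" for l
      proof -
        have "(\<lambda>i. l i + (- l s) * m i) \<in> L'"
          using insert.prems(2)[OF that m(1), of "- l s"] m(2) by (simp add: L'_def)
        from bspec[OF 2 this] have "l c + (- l s) * m c = (\<Sum>s'\<in>S. a s' * (l s' + (- l s) * m s'))" .
        also have "\<dots> = (\<Sum>s'\<in>S. a s' * l s') - l s * (\<Sum>s'\<in>S. a s' * m s')"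
          by (simp add: algebra_simps sum.distrib sum_negf sum_subtractf sum_distrib_left)
        finally show ?thesis by (simp add: b_def algebra_simps)
      qed
      moreover have "(\<Sum>s'\<in>insert s S. (a(s := b)) s' * l s') = b * l s + (\<Sum>s\<in>S. a s * l s)" for l
        using insert.hyps by (simp add: sum_upd fun_upd_def)
      ultimately have "\<forall>l\<in>L. l c = (\<Sum>s'\<in>insert s S. (a(s := b)) s' * l s')" by simp
      then show ?thesis by (intro disjI2 exI)
    qed
  qed
qed

section \<open>Polynomials in one operator and the degree of its minimal polynomial\<close>

locale vs_op = vector_space scaleU for scaleU :: "'f::field \<Rightarrow> 'u::ab_group_add \<Rightarrow> 'u" +
  fixes t :: "'u \<Rightarrow> 'u"
  assumes t_lin: "Vector_Spaces.linear scaleU scaleU t"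
begin

abbreviation "ev \<equiv> \<lambda>p. poly_op scaleU p t"

lemma t_add: "t (x + y) = t x + t y" and t_scale: "t (scaleU c x) = scaleU c (t x)"
proof -
  interpret l: Vector_Spaces.linear scaleU scaleU t by (rule t_lin)
  show "t (x + y) = t x + t y" "t (scaleU c x) = scaleU c (t x)" by (rule l.add, rule l.scale)
qed

lemma t_0 [simp]: "t 0 = 0" using t_add[of 0 0] by simp

lemma tn_add: "(t ^^ n) (x + y) = (t ^^ n) x + (t ^^ n) y"
  by (induction n) (auto simp: t_add)
lemma tn_scale: "(t ^^ n) (scaleU c x) = scaleU c ((t ^^ n) x)"
  by (induction n) (auto simp: t_scale)
lemma t_sum: "t (sum g S) = (\<Sum>s\<in>S. t (g s))"
  by (induction S rule: infinite_finite_induct) (auto simp: t_add)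

lemma ev_eq:
  assumes "degree p < n" shows "ev p u = (\<Sum>i<n. scaleU (coeff p i) ((t ^^ i) u))"
  unfolding poly_op_def
  by (rule sum.mono_neutral_left) (use assms in \<open>auto simp: coeff_eq_0\<close>)

lemma ev_add: "ev (p + q) u = ev p u + ev q u"
proof -
  define n where "n = Suc (max (degree p) (degree q))"
  have "degree p < n" "degree q < n" "degree (p + q) < n"
    using degree_add_le_max[of p q] by (auto simp: n_def)
  then show ?thesis by (simp add: ev_eq sum.distrib scale_left_distrib)
qed

lemma ev_smult: "ev (smult c p) u = scaleU c (ev p u)"
proof -
  define n where "n = Suc (degree p)"
  have "degree p < n" "degree (smult c p) < n" by (auto simp: n_def)
  then show ?thesis by (simp add: ev_eq scale_sum_right)
qed

lemma ev_pCons: "ev (pCons c p) u = scaleU c u + t (ev p u)"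
proof -
  define n where "n = Suc (degree p)"
  have "degree p < n" "degree (pCons c p) < Suc n"
    by (auto simp: n_def)
  then show ?thesis by (simp add: ev_eq t_sum t_scale sum.lessThan_Suc_shift del: sum.lessThan_Suc)
qed

lemma ev_0 [simp]: "ev 0 u = 0" by (simp add: poly_op_def)

lemma ev_mult: "ev (p * q) u = ev p (ev q u)"
proof (induction p)
  case 0
  then show ?case by simp
next
  case (pCons c p)
  have "ev (pCons c p * q) u = ev (smult c q) u + ev (pCons 0 (p * q)) u"
    by (simp add: ev_add)
  also have "\<dots> = ev (pCons c p) (ev q u)"
    by (simp only: ev_smult ev_pCons pCons.IH) simp
  finally show ?case .
qed

lemma ev_add_arg: "ev p (u + v) = ev p u + ev p v"
  by (simp add: poly_op_def tn_add scale_right_distrib sum.distrib)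
lemma ev_scale_arg: "ev p (scaleU c u) = scaleU c (ev p u)"
  by (simp add: poly_op_def tn_scale scale_sum_right mult.commute)
lemma ev_t: "ev p (t u) = t (ev p u)"
  by (simp add: poly_op_def t_sum t_scale funpow_swap1)

lemma ev_tn: "ev p ((t ^^ n) u) = (t ^^ n) (ev p u)"
  by (induction n) (auto simp: ev_t)

lemma ev_monom: "ev (monom 1 k) u = (t ^^ k) u"
proof (induction k)
  case 0
  show ?case by (simp add: monom_0 ev_pCons)
next
  case (Suc k)
  then show ?case by (simp add: monom_Suc ev_pCons)
qed

lemma invariant_span:
  assumes "t ` B \<subseteq> span B" "x \<in> span B" shows "t x \<in> span B"
  using assms(2)
proof (induction rule: span_induct_alt)
  case base
  show ?case by (simp add: span_zero)
next
  case (step c x y)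
  then show ?case using assms(1) by (auto simp: t_add t_scale intro!: span_add span_scale)
qed

lemma invariant_ev:
  assumes "t ` B \<subseteq> span B" "x \<in> span B" shows "ev p x \<in> span B"
proof -
  have "(t ^^ i) x \<in> span B" for i
    by (induction i) (use assms invariant_span in auto)
  then show ?thesis unfolding poly_op_def by (intro span_sum span_scale)
qed

text \<open>Modulo \<open>span B\<close>, a combination of the first \<open>k\<close> iterates of
  \<open>w\<close> is a polynomial of degree below \<open>k\<close> in the operator, applied to
  \<open>w\<close>. The alternative \<open>p = 0\<close> covers \<open>k = 0\<close>.\<close>

lemma span_orbit:
  assumes "x \<in> span (B \<union> (\<lambda>i. (t ^^ i) w) ` {..<k})"
  shows "\<exists>p. (p = 0 \<or> degree p < k) \<and> x - ev p w \<in> span B"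
  using assms
proof (induction rule: span_induct_alt)
  case base
  show ?case by (intro exI[of _ 0]) (simp add: span_zero)
next
  case (step c x y)
  from step.IH obtain p where p: "p = 0 \<or> degree p < k" "y - ev p w \<in> span B" by blast
  show ?case
  proof (cases "x \<in> B")
    case True
    then have "scaleU c x \<in> span B" by (intro span_scale span_base)
    then have "scaleU c x + (y - ev p w) \<in> span B" using p(2) by (rule span_add)
    then show ?thesis using p(1) by (intro exI[of _ p]) (simp add: algebra_simps)
  next
    case False
    then obtain i where i: "i < k" "x = (t ^^ i) w" using step.hyps by blast
    have "degree (smult c (monom 1 i) + p) < k"
      using i p(1) degree_monom_le[of c i] by (intro degree_add_less) (auto simp: smult_monom)
    moreover have "scaleU c x + y - ev (smult c (monom 1 i) + p) w = y - ev p w"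
      by (simp only: ev_add ev_smult ev_monom i) simp
    ultimately show ?thesis using p(2) by (intro exI[of _ "smult c (monom 1 i) + p"]) (simp only: simp_thms)
  qed
qed

text \<open>The part of the Cayley-Hamilton theorem that bounds the degree of the minimal polynomial,
  by splitting off cyclic subspaces.\<close>
lemma annihilator_mod:
  assumes dim: "\<And>B. finite B \<Longrightarrow> independent B \<Longrightarrow> card B < d"
    and B: "finite B" "independent B" "t ` B \<subseteq> span B"
  shows "\<exists>p. p \<noteq> 0 \<and> degree p + card B < d \<and> (\<forall>u. ev p u \<in> span B)"
  using B
proof (induction "d - card B" arbitrary: B rule: less_induct)
  case less
  show ?case
  proof (cases "span B = UNIV")
    case True
    then show ?thesis using dim[OF less.prems(1,2)] by (intro exI[of _ 1]) auto
  next
    case False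
    then obtain w where w: "w \<notin> span B" by blast
    define D where "D k = B \<union> (\<lambda>i. (t ^^ i) w) ` {..<k}" for k
    have D0: "D 0 = B" and DS: "D (Suc k) = insert ((t ^^ k) w) (D k)" for k
      by (auto simp: D_def lessThan_Suc)
    have fin: "finite (D k)" for k using less.prems(1) by (simp add: D_def)
    have ind: "independent (D k) \<and> card (D k) = card B + k"
      if "\<And>i. i < k \<Longrightarrow> (t ^^ i) w \<notin> span (D i)" for k
      using that
    proof (induction k)
      case 0
      then show ?case using less.prems by (simp add: D0)
    next
      case (Suc k)
      then have IH: "independent (D k)" "card (D k) = card B + k" by auto
      have "(t ^^ k) w \<notin> span (D k)" using Suc.prems by blast
      moreover from this have "(t ^^ k) w \<notin> D k" using span_base by blast
      ultimately show ?case using IH fin by (simp add: DS independent_insert)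
    qed
    \<comment> \<open>Otherwise \<open>D d\<close> would be independent with at least
      \<open>d\<close> elements. The least such \<open>k\<close> is the degree of the minimal
      polynomial of \<open>w\<close> modulo \<open>span B\<close>.\<close>
    have "\<exists>k. (t ^^ k) w \<in> span (D k)"
    proof (rule ccontr)
      assume "\<not> ?thesis"
      with ind[of d] dim[OF fin[of d]] show False by auto
    qed
    then obtain k where k: "(t ^^ k) w \<in> span (D k)" and least: "\<And>i. i < k \<Longrightarrow> (t ^^ i) w \<notin> span (D i)"
      using exists_least_iff[of "\<lambda>k. (t ^^ k) w \<in> span (D k)"] by blast
    have kpos: "k > 0" using k w by (cases k) (auto simp: D0)
    have indk: "independent (D k)" "card (D k) = card B + k" using ind[OF least] by auto
    have inv: "t ` D k \<subseteq> span (D k)"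
    proof
      fix y assume "y \<in> t ` D k"
      then consider b where "b \<in> B" "y = t b" | i where "i < k" "y = (t ^^ Suc i) w"
        by (auto simp: D_def)
      then show "y \<in> span (D k)"
      proof cases
        case 1
        then show ?thesis using less.prems(3) span_mono[of B "D k"] by (auto simp: D_def)
      next
        case (2 i)
        show ?thesis
        proof (cases "Suc i = k")
          case True
          then show ?thesis using 2 k by simp
        next
          case False
          then show ?thesis using 2 by (intro span_base) (auto simp: D_def simp del: funpow.simps)
        qed
      qed
    qed
    have "d - card (D k) < d - card B" using dim[OF fin indk(1)] indk(2) kpos by simp
    then obtain p where p: "p \<noteq> 0" "degree p + card (D k) < d" "\<And>u. ev p u \<in> span (D k)"
      using less.hyps[OF _ fin indk(1) inv] by blast
    obtain r where r: "r = 0 \<or> degree r < k" "(t ^^ k) w - ev r w \<in> span B"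
      using span_orbit[of "(t ^^ k) w" B w k] k by (auto simp: D_def)
    \<comment> \<open>The monic polynomial of degree \<open>k\<close> that sends \<open>w\<close>
      into \<open>span B\<close>. As \<open>span B\<close> is invariant and \<open>q\<close>
      commutes with \<open>t\<close>, it sends all of \<open>span (D k)\<close> there.\<close>
    define q where "q = monom 1 k + smult (- 1) r"
    have "coeff q k = 1" using r(1) coeff_eq_0[of r k] by (auto simp: q_def)
    then have q0: "q \<noteq> 0" by auto
    have qdeg: "degree q \<le> k" unfolding q_def
      using r(1) by (intro degree_add_le) (auto simp: degree_monom_le)
    have qw: "ev q w \<in> span B"
      using r(2) by (simp only: q_def ev_add ev_smult ev_monom) simp
    have qD: "ev q x \<in> span B" if "x \<in> span (D k)" for x
      using that
    proof (induction rule: span_induct_alt)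
      case base
      have "ev q 0 = 0" using ev_scale_arg[of q 0 0] by simp
      then show ?case by (simp add: span_zero)
    next
      case (step c x y)
      have "ev q x \<in> span B"
      proof (cases "x \<in> B")
        case True
        then show ?thesis using invariant_ev[OF less.prems(3)] span_base by blast
      next
        case False
        then obtain i where "x = (t ^^ i) w" using step.hyps by (auto simp: D_def)
        moreover have "(t ^^ i) (ev q w) \<in> span B"
          by (induction i) (use qw invariant_span[OF less.prems(3)] in auto)
        ultimately show ?thesis by (simp add: ev_tn)
      qed
      then show ?case using step.IH by (simp add: ev_add_arg ev_scale_arg span_add span_scale)
    qed
    \<comment> \<open>\<open>p\<close> maps \<open>U\<close> into \<open>span (D k)\<close> and
      \<open>q\<close> maps that into \<open>span B\<close>. The degree of \<open>q\<close>, at most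
      \<open>k\<close>, is paid for by \<open>card (D k) = card B + k\<close>.\<close>
    have "degree (q * p) + card B < d"
      using p(1,2) q0 qdeg indk(2) by (simp add: degree_mult_eq)
    moreover have "\<forall>u. ev (q * p) u \<in> span B" using qD p(3) by (simp add: ev_mult)
    moreover have "q * p \<noteq> 0" using p(1) q0 by simp
    ultimately show ?thesis by blast
  qed
qed

text \<open>If all finite independent sets had fewer than \<open>d\<close> elements,
  \<open>annihilator_mod\<close> with \<open>B = {}\<close> would produce a nonzero annihilating
  polynomial of degree below \<open>d\<close>, against the minimality in
  \<open>deg_op\<close>.\<close>

lemma independent_card_deg_op:
  assumes "d \<le> deg_op scaleU t"
  obtains B where "finite B" "independent B" "card B \<ge> d"
proof (rule ccontr)
  assume "\<not> thesis"
  then have dim: "\<And>B. finite B \<Longrightarrow> independent B \<Longrightarrow> card B < d" using that not_le by blast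
  obtain p where p: "p \<noteq> 0" "degree p < d" "\<And>u. ev p u = 0"
    using annihilator_mod[OF dim, of "{}"] independent_empty by auto
  then have "degree p < deg_op scaleU t" using assms by simp
  from not_less_Least[OF this[unfolded deg_op_def]] p show False by auto
qed

text \<open>The relation is the second alternative of \<open>dual_or_relation\<close>; read as a
  polynomial, it would annihilate \<open>t\<close> in a degree below \<open>deg_op\<close>.\<close>

lemma powers_relation_trivial:
  assumes d: "d \<le> deg_op scaleU t" and c: "c < d"
    and rel: "\<And>u. (t ^^ c) u = (\<Sum>i\<in>{..<d} - {c}. scaleU (a i) ((t ^^ i) u))"
  shows False
proof -
  define p where "p = monom 1 c - (\<Sum>i\<in>{..<d} - {c}. monom (a i) i)"
  have co: "coeff p j = (if j = c then 1 else if j < d then - a j else 0)" for j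
    using c by (auto simp: p_def coeff_sum)
  have "coeff p c = 1" by (simp add: co)
  then have p0: "p \<noteq> 0" by auto
  have deg: "degree p < d" using c by (intro degree_lessI) (auto simp: co p0)
  have "ev p u = 0" for u
  proof -
    have "ev p u = (\<Sum>i<d. scaleU (coeff p i) ((t ^^ i) u))" by (rule ev_eq[OF deg])
    also have "\<dots> = (t ^^ c) u + (\<Sum>i\<in>{..<d} - {c}. scaleU (- a i) ((t ^^ i) u))"
      using c by (subst sum.remove[of _ c]) (auto simp: co intro!: sum.cong)
    finally show ?thesis by (simp add: rel sum_negf)
  qed
  moreover have "degree p < deg_op scaleU t" using d deg by simp
  ultimately show False using not_less_Least[of "degree p"] p0 unfolding deg_op_def by blast
qed

end

section \<open>Dual systems in a total space of functionals\<close>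

definition rank_one :: "('f::field \<Rightarrow> 'u::ab_group_add \<Rightarrow> 'u) \<Rightarrow> 'u \<Rightarrow> ('u \<Rightarrow> 'f) \<Rightarrow> 'u \<Rightarrow> 'u" where
  "rank_one scaleU w f = (\<lambda>u. scaleU (f u) w)"

locale total_space =
  fixes scaleU :: "'f::field \<Rightarrow> 'u::ab_group_add \<Rightarrow> 'u" and Ps :: "('u \<Rightarrow> 'f) set"
  assumes U_vs: "vector_space scaleU"
    and Pi_dual: "f \<in> Ps \<Longrightarrow> Vector_Spaces.linear scaleU (*) f"
    and Pi_zero: "(\<lambda>_. 0) \<in> Ps"
    and Pi_add: "f \<in> Ps \<Longrightarrow> g \<in> Ps \<Longrightarrow> (\<lambda>u. f u + g u) \<in> Ps"
    and Pi_scale: "f \<in> Ps \<Longrightarrow> (\<lambda>u. c * f u) \<in> Ps"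
    and Pi_total: "u \<noteq> 0 \<Longrightarrow> \<exists>f\<in>Ps. f u \<noteq> 0"
begin

sublocale vector_space scaleU by (rule U_vs)

lemma Ps_add: "f \<in> Ps \<Longrightarrow> f (x + y) = f x + f y"
  and Ps_scale: "f \<in> Ps \<Longrightarrow> f (scaleU c x) = c * f x"
proof -
  assume "f \<in> Ps"
  then interpret l: Vector_Spaces.linear scaleU "(*)" f by (rule Pi_dual)
  show "f (x + y) = f x + f y" "f (scaleU c x) = c * f x" by (rule l.add, rule l.scale)
qed

lemma Ps_sum: "f \<in> Ps \<Longrightarrow> f (sum g S) = (\<Sum>s\<in>S. f (g s))"
proof (induction S rule: infinite_finite_induct)
  case (infinite A)
  then show ?case using Ps_scale[of f 0 0] by simp
next
  case empty
  then show ?case using Ps_scale[of f 0 0] by simp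
qed (simp add: Ps_add)

lemma eq_by_Ps: "(\<And>f. f \<in> Ps \<Longrightarrow> f u = f v) \<Longrightarrow> u = v"
proof (rule ccontr)
  assume eq: "\<And>f. f \<in> Ps \<Longrightarrow> f u = f v" and "u \<noteq> v"
  then obtain f where "f \<in> Ps" "f (u - v) \<noteq> 0" using Pi_total[of "u - v"] by auto
  moreover have "f (u - v) + f v = f u" using Ps_add[OF \<open>f \<in> Ps\<close>, of "u - v" v] by simp
  ultimately show False using eq[of f] by simp
qed

text \<open>The values of the functionals in \<open>Ps\<close> at the given vectors form a subspace,
  so \<open>dual_or_relation\<close> applies; totality turns a relation between values into one
  between vectors.\<close>

lemma dual_system:
  assumes "finite S" "c \<notin> S"
  shows "(\<exists>f\<in>Ps. f (us c) = 1 \<and> (\<forall>s\<in>S. f (us s) = 0)) \<or> (\<exists>a. us c = (\<Sum>s\<in>S. scaleU (a s) (us s)))"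
proof -
  have "(\<exists>l\<in>(\<lambda>f i. f (us i)) ` Ps. l c = 1 \<and> (\<forall>s\<in>S. l s = 0))
     \<or> (\<exists>a. \<forall>l\<in>(\<lambda>f i. f (us i)) ` Ps. l c = (\<Sum>s\<in>S. a s * l s))"
  proof (rule dual_or_relation)
    show "(\<lambda>i. k * l i) \<in> (\<lambda>f i. f (us i)) ` Ps" if "l \<in> (\<lambda>f i. f (us i)) ` Ps" for l k
      using that Pi_scale[of _ k] by force
    show "(\<lambda>i. l i + k * l' i) \<in> (\<lambda>f i. f (us i)) ` Ps"
      if "l \<in> (\<lambda>f i. f (us i)) ` Ps" "l' \<in> (\<lambda>f i. f (us i)) ` Ps" for l l' k
    proof -
      from that obtain f g where "f \<in> Ps" "l = (\<lambda>i. f (us i))" "g \<in> Ps" "l' = (\<lambda>i. g (us i))" by auto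
      then show ?thesis using Pi_add[of f "\<lambda>u. k * g u"] Pi_scale[of g k] by force
    qed
  qed (use assms in auto)
  then show ?thesis
  proof
    assume "\<exists>a. \<forall>l\<in>(\<lambda>f i. f (us i)) ` Ps. l c = (\<Sum>s\<in>S. a s * l s)"
    then obtain a where a: "\<And>f. f \<in> Ps \<Longrightarrow> f (us c) = (\<Sum>s\<in>S. a s * f (us s))" by auto
    have "us c = (\<Sum>s\<in>S. scaleU (a s) (us s))"
      by (rule eq_by_Ps) (simp add: a Ps_sum Ps_scale)
    then show ?thesis by blast
  qed auto
qed

lemma rank_one_linear:
  assumes "f \<in> Ps" shows "Vector_Spaces.linear scaleU scaleU (rank_one scaleU w f)"
  by unfold_locales (simp_all add: rank_one_def Ps_add Ps_scale assms scale_left_distrib)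

lemma sum_rank_one_linear:
  assumes "\<And>i. i < n \<Longrightarrow> fs i \<in> Ps"
  shows "Vector_Spaces.linear scaleU scaleU (\<lambda>u. \<Sum>i<n::nat. scaleU (c i * fs i u) (vs i))"
  by unfold_locales
    (use assms in \<open>simp_all add: Ps_add Ps_scale scale_left_distrib algebra_simps sum.distrib scale_sum_right\<close>)

lemma finrank_linear:
  assumes "T \<in> finrank_ops scaleU Ps" shows "Vector_Spaces.linear scaleU scaleU T"
proof -
  from assms obtain n :: nat and c fs vs where T: "T = (\<lambda>u. \<Sum>i<n. scaleU (c i * fs i u) (vs i))"
    and fs: "\<forall>i<n. fs i \<in> Ps"
    unfolding finrank_ops_def by blast
  show ?thesis unfolding T by (rule sum_rank_one_linear) (use fs in blast)
qed

lemma rank_one_finrank: "f \<in> Ps \<Longrightarrow> rank_one scaleU w f \<in> finrank_ops scaleU Ps"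
  unfolding finrank_ops_def rank_one_def
  by (intro CollectI exI[of _ 1] exI[of _ "\<lambda>_. 1"] exI[of _ "\<lambda>_. f"] exI[of _ "\<lambda>_. w"]) auto

lemma sum_rank_one_finrank:
  "(\<And>i. i < n \<Longrightarrow> fs i \<in> Ps) \<Longrightarrow> (\<lambda>u. \<Sum>i<n::nat. scaleU (fs i u) (vs i)) \<in> finrank_ops scaleU Ps"
  unfolding finrank_ops_def
  by (intro CollectI exI[of _ n] exI[of _ "\<lambda>_. 1"] exI[of _ fs] exI[of _ vs]) auto

end

locale total_space_op = total_space scaleU Ps
  for scaleU :: "'f::field \<Rightarrow> 'u::ab_group_add \<Rightarrow> 'u" and Ps +
  fixes t :: "'u \<Rightarrow> 'u" and d :: nat
  assumes t_fin: "t \<in> finrank_ops scaleU Ps" and d_le: "d \<le> deg_op scaleU t"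
begin

sublocale vs_op scaleU t
  by (rule vs_op.intro[OF U_vs]) (rule vs_op_axioms.intro[OF finrank_linear[OF t_fin]])

text \<open>The values \<open>f (t\<^sup>u w)\<close> for single pairs \<open>(f, w)\<close> are not
  closed under addition, so sums over finitely many pairs are used. The other alternative of
  \<open>dual_or_relation\<close> would be a linear relation among the powers of
  \<open>t\<close>.\<close>

lemma dual_powers:
  assumes c: "c < d"
  obtains n :: nat and fs ws where "\<And>s. s < n \<Longrightarrow> fs s \<in> Ps"
    "\<And>u. u < d \<Longrightarrow> (\<Sum>s<n. fs s ((t ^^ u) (ws s))) = (if u = c then 1 else 0)"
proof -
  \<comment> \<open>Lists of pairs make closure immediate: appending adds the values, and scaling
    the functionals scales them.\<close>
  define val where "val xs u = (\<Sum>(f, w)\<leftarrow>xs. f ((t ^^ u) w))" for xs :: "(('u \<Rightarrow> 'f) \<times> 'u) list" and u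
  define L where "L = {val xs | xs. \<forall>(f, w)\<in>set xs. f \<in> Ps}"
  have scale: "(\<lambda>i. k * l i) \<in> L" if l: "l \<in> L" for l k
  proof -
    from l obtain xs where xs: "\<forall>(f, w)\<in>set xs. f \<in> Ps" "l = val xs" unfolding L_def by blast
    have "(\<lambda>i. k * l i) = val (map (\<lambda>(f, w). (\<lambda>u. k * f u, w)) xs)"
      by (simp add: fun_eq_iff xs(2) val_def sum_list_const_mult[symmetric] o_def case_prod_unfold)
    moreover have "\<forall>(f, w)\<in>set (map (\<lambda>(f, w). (\<lambda>u. k * f u, w)) xs). f \<in> Ps"
      using xs(1) Pi_scale by auto
    ultimately show ?thesis unfolding L_def by blast
  qed
  have plus: "(\<lambda>i. l i + l' i) \<in> L" if l: "l \<in> L" "l' \<in> L" for l l'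
  proof -
    from l obtain xs ys where xs: "\<forall>(f, w)\<in>set xs. f \<in> Ps" "l = val xs"
      and ys: "\<forall>(f, w)\<in>set ys. f \<in> Ps" "l' = val ys" unfolding L_def by blast
    have "(\<lambda>i. l i + l' i) = val (xs @ ys)" by (simp add: fun_eq_iff xs ys val_def)
    moreover have "\<forall>(f, w)\<in>set (xs @ ys). f \<in> Ps" using xs ys by auto
    ultimately show ?thesis unfolding L_def by blast
  qed
  have "(\<exists>l\<in>L. l c = 1 \<and> (\<forall>s\<in>{..<d} - {c}. l s = 0)) \<or> (\<exists>a. \<forall>l\<in>L. l c = (\<Sum>s\<in>{..<d} - {c}. a s * l s))"
    by (rule dual_or_relation) (auto intro!: plus scale)
  moreover have False if a: "\<And>l. l \<in> L \<Longrightarrow> l c = (\<Sum>s\<in>{..<d} - {c}. a s * l s)" for a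
  proof (rule powers_relation_trivial[OF d_le c])
    fix w
    show "(t ^^ c) w = (\<Sum>i\<in>{..<d} - {c}. scaleU (a i) ((t ^^ i) w))"
    proof (rule eq_by_Ps)
      fix f assume f: "f \<in> Ps"
      then have "val [(f, w)] \<in> L" unfolding L_def by force
      from a[OF this] show "f ((t ^^ c) w) = f (\<Sum>i\<in>{..<d} - {c}. scaleU (a i) ((t ^^ i) w))"
        using f by (simp add: val_def Ps_sum Ps_scale)
    qed
  qed
  ultimately obtain xs where xs: "\<forall>(f, w)\<in>set xs. f \<in> Ps" "val xs c = 1" "\<And>s. s < d \<Longrightarrow> s \<noteq> c \<Longrightarrow> val xs s = 0"
    unfolding L_def by blast
  show thesis
  proof (rule that[of "length xs" "\<lambda>s. fst (xs ! s)" "\<lambda>s. snd (xs ! s)"])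
    show "fst (xs ! s) \<in> Ps" if "s < length xs" for s
      using xs(1) nth_mem[OF that] by (auto simp: case_prod_unfold)
    show "(\<Sum>s<length xs. fst (xs ! s) ((t ^^ u) (snd (xs ! s)))) = (if u = c then 1 else 0)" if "u < d" for u
    proof -
      have "(\<Sum>s<length xs. fst (xs ! s) ((t ^^ u) (snd (xs ! s)))) = val xs u"
        by (simp add: val_def sum_list_sum_nth atLeast0LessThan case_prod_unfold)
      then show ?thesis using xs that by auto
    qed
  qed
qed

text \<open>The dimension bound supplies \<open>d\<close> independent vectors, which excludes the
  second alternative of \<open>dual_system\<close> for each of them.\<close>

lemma dual_basis:
  obtains e f where "\<And>i. i < d \<Longrightarrow> f i \<in> Ps" "\<And>i j. i < d \<Longrightarrow> j < d \<Longrightarrow> f i (e j) = (if i = j then 1 else 0)"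
proof -
  obtain B' where B': "finite B'" "independent B'" "card B' \<ge> d"
    by (rule independent_card_deg_op[OF d_le])
  obtain B where "B \<subseteq> B'" "card B = d" using B'(3) by (meson obtain_subset_with_card_n)
  then have B: "finite B" "independent B" "card B = d"
    using B' finite_subset independent_mono by blast+
  obtain e where e: "bij_betw e {..<d} B"
    using ex_bij_betw_nat_finite[OF B(1)] B(3) by (auto simp: atLeast0LessThan)
  have "\<exists>f\<in>Ps. \<forall>j<d. f (e j) = (if i = j then 1 else 0)" if i: "i < d" for i
  proof -
    have "\<not> (e i = (\<Sum>s\<in>{..<d} - {i}. scaleU (a s) (e s)))" for a
    proof
      assume eq: "e i = (\<Sum>s\<in>{..<d} - {i}. scaleU (a s) (e s))"
      have "e s \<in> B - {e i}" if "s \<in> {..<d} - {i}" for s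
        using e that i by (auto simp: bij_betw_def inj_on_def)
      then have "e i \<in> span (B - {e i})"
        by (subst eq) (intro span_sum span_scale span_base)
      moreover have "e i \<in> B" using e i by (auto simp: bij_betw_def)
      ultimately show False using B(2) unfolding dependent_def by blast
    qed
    then obtain f where f: "f \<in> Ps" "f (e i) = 1" "\<forall>s\<in>{..<d} - {i}. f (e s) = 0"
      using dual_system[of "{..<d} - {i}" i e] by auto
    show ?thesis by (rule bexI[OF _ f(1)]) (use f in auto)
  qed
  then have "\<forall>i. \<exists>f. i < d \<longrightarrow> f \<in> Ps \<and> (\<forall>j<d. f (e j) = (if i = j then 1 else 0))" by blast
  from choice[OF this] obtain f where "\<forall>i<d. f i \<in> Ps \<and> (\<forall>j<d. f i (e j) = (if i = j then 1 else 0))" by blast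
  then show thesis using that by blast
qed

end

section \<open>Operators on a tensor product\<close>

text \<open>\<open>V\<close> models the tensor product inside an ambient group that
  \<open>proj\<close> retracts onto \<open>V\<close>; \<open>rho k\<close> is the right action and
  \<open>pair f\<close> is the contraction of the first factor by \<open>f\<close>. Elements of
  \<open>Qs\<close> are additive maps of the whole group that factor through \<open>proj\<close>, so
  they are determined on \<open>V\<close>. The quotient construction enters only through these
  properties.\<close>

locale tensor_rep = total_space_op scaleU Ps t d
  for scaleU :: "'f::field \<Rightarrow> 'u::ab_group_add \<Rightarrow> 'u" and Ps t d +
  fixes scaleH :: "'f \<Rightarrow> 'h::ring_1 \<Rightarrow> 'h"
    and V :: "'m::ab_group_add set" and tens :: "'u \<Rightarrow> 'h \<Rightarrow> 'm" and rho :: "'h \<Rightarrow> 'm \<Rightarrow> 'm"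
    and pair :: "('u \<Rightarrow> 'f) \<Rightarrow> 'm \<Rightarrow> 'h" and proj :: "'m \<Rightarrow> 'm"
    and T :: "('u \<Rightarrow> 'u) \<Rightarrow> 'h \<Rightarrow> 'm aend" and Qs R :: "'m aend set"
  assumes H_vs: "vector_space scaleH"
    and H_right: "scaleH c (h * h') = h * scaleH c h'"
    and V_0: "0 \<in> V" and V_add: "x \<in> V \<Longrightarrow> y \<in> V \<Longrightarrow> x + y \<in> V" and V_uminus: "x \<in> V \<Longrightarrow> - x \<in> V"
    and tens_V: "tens u h \<in> V"
    and tens_addl: "tens (u + u') h = tens u h + tens u' h"
    and tens_addr: "tens u (h + h') = tens u h + tens u h'"
    and tens_scale: "tens (scaleU c u) h = tens u (scaleH c h)"
    and V_induct: "z \<in> V \<Longrightarrow> P 0 \<Longrightarrow> (\<And>w h z. z \<in> V \<Longrightarrow> P z \<Longrightarrow> P (tens w h + z)) \<Longrightarrow> P z"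
    and rho_V: "z \<in> V \<Longrightarrow> rho k z \<in> V"
    and rho_add: "y \<in> V \<Longrightarrow> z \<in> V \<Longrightarrow> rho k (y + z) = rho k y + rho k z"
    and rho_tens: "rho k (tens w h) = tens w (h * k)"
    and pair_add: "f \<in> Ps \<Longrightarrow> y \<in> V \<Longrightarrow> z \<in> V \<Longrightarrow> pair f (y + z) = pair f y + pair f z"
    and pair_tens: "f \<in> Ps \<Longrightarrow> pair f (tens w h) = scaleH (f w) h"
    and proj_V: "proj z \<in> V" and proj_id: "z \<in> V \<Longrightarrow> proj z = z"
    and proj_add: "proj (x + y) = proj x + proj y"
    and Qs_def: "Qs = {q. (\<forall>z. app q z \<in> V) \<and> (\<forall>z. app q (proj z) = app q z) \<and>
      (\<forall>z\<in>V. \<forall>h. app q (rho h z) = rho h (app q z))}"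
    and T_Q: "Vector_Spaces.linear scaleU scaleU a \<Longrightarrow> T a h \<in> Qs"
    and T_tens: "Vector_Spaces.linear scaleU scaleU a \<Longrightarrow> app (T a h) (tens w k) = tens (a w) (h * k)"
    and R_Q: "R \<subseteq> Qs"
    and R_T: "a \<in> finrank_ops scaleU Ps \<Longrightarrow> T a h \<in> R"
    and R_left: "a \<in> finrank_ops scaleU Ps \<Longrightarrow> q \<in> R \<Longrightarrow> T a 1 * q \<in> R"
    and R_right: "a \<in> finrank_ops scaleU Ps \<Longrightarrow> q \<in> R \<Longrightarrow> q * T a 1 \<in> R"
begin

interpretation H: vector_space scaleH by (rule H_vs)

definition Cs :: "'m aend set" where "Cs = {c \<in> Qs. \<forall>x\<in>Qs. c * x = x * c}"

abbreviation L :: "'m aend \<Rightarrow> 'm aend" where "L \<equiv> \<lambda>x. T t 1 * x"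
abbreviation Rt :: "'m aend \<Rightarrow> 'm aend" where "Rt \<equiv> \<lambda>x. x * T t 1"

lemma V_sum: "(\<And>s. s \<in> S \<Longrightarrow> g s \<in> V) \<Longrightarrow> sum g S \<in> V"
  by (induction S rule: infinite_finite_induct) (auto simp: V_0 V_add)
lemma V_diff: "x \<in> V \<Longrightarrow> y \<in> V \<Longrightarrow> x - y \<in> V"
  using V_add[of x "- y"] V_uminus[of y] by simp

lemma tens_0r [simp]: "tens u 0 = 0" using tens_addr[of u 0 0] by simp
lemma tens_minusr: "tens u (- h) = - tens u h" using tens_addr[of u h "- h"] by (simp add: eq_neg_iff_add_eq_0 add.commute)
lemma tens_sumr: "tens u (sum g S) = (\<Sum>s\<in>S. tens u (g s))"
  by (induction S rule: infinite_finite_induct) (auto simp: tens_addr)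
lemma tens_suml: "tens (sum g S) h = (\<Sum>s\<in>S. tens (g s) h)"
proof -
  have [simp]: "tens 0 h = 0" using tens_addl[of 0 0 h] by simp
  show ?thesis by (induction S rule: infinite_finite_induct) (auto simp: tens_addl)
qed
lemma rho_0 [simp]: "rho k 0 = 0" using rho_add[OF V_0 V_0, of k] by simp
lemma rho_sum: "(\<And>s. s \<in> S \<Longrightarrow> g s \<in> V) \<Longrightarrow> rho k (sum g S) = (\<Sum>s\<in>S. rho k (g s))"
  by (induction S rule: infinite_finite_induct) (auto simp: rho_add V_sum)
lemma pair_0: "f \<in> Ps \<Longrightarrow> pair f 0 = 0" using pair_add[OF _ V_0 V_0, of f] by simp
lemma pair_sum: "f \<in> Ps \<Longrightarrow> (\<And>s. s \<in> S \<Longrightarrow> g s \<in> V) \<Longrightarrow> pair f (sum g S) = (\<Sum>s\<in>S. pair f (g s))"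
  by (induction S rule: infinite_finite_induct) (auto simp: pair_add V_sum pair_0)

lemma Q_V: "q \<in> Qs \<Longrightarrow> app q z \<in> V" and Q_proj: "q \<in> Qs \<Longrightarrow> app q (proj z) = app q z"
  and Q_rho: "q \<in> Qs \<Longrightarrow> z \<in> V \<Longrightarrow> app q (rho h z) = rho h (app q z)"
  by (auto simp: Qs_def)

lemma proj_0 [simp]: "proj 0 = 0" using proj_add[of 0 0] by simp
lemma rho_uminus: "z \<in> V \<Longrightarrow> rho k (- z) = - rho k z"
  using rho_add[of z "- z" k] V_uminus[of z] by (simp add: eq_neg_iff_add_eq_0 add.commute)

lemma Q_0: "0 \<in> Qs" by (simp add: Qs_def V_0)
lemma Q_diff: "x \<in> Qs \<Longrightarrow> y \<in> Qs \<Longrightarrow> x - y \<in> Qs"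
  using rho_add[of "app x z" "- app y z" for z] by (auto simp: Qs_def V_diff V_uminus rho_uminus)
lemma Q_mul: "x \<in> Qs \<Longrightarrow> y \<in> Qs \<Longrightarrow> x * y \<in> Qs" by (simp add: Qs_def)

lemma Q_ext:
  assumes "x \<in> Qs" "y \<in> Qs" "\<And>w h. app x (tens w h) = app y (tens w h)"
  shows "x = y"
proof (rule aend_eqI)
  fix z
  have "app x z = app y z" if "z \<in> V" for z
    using that by (rule V_induct) (simp_all add: app_add assms(3))
  from this[OF proj_V] show "app x z = app y z" using assms by (simp add: Q_proj)
qed

lemma ex_Q:
  assumes "\<And>z. z \<in> V \<Longrightarrow> g z \<in> V" "\<And>y z. y \<in> V \<Longrightarrow> z \<in> V \<Longrightarrow> g (y + z) = g y + g z"
    "\<And>z h. z \<in> V \<Longrightarrow> g (rho h z) = rho h (g z)"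
  obtains q where "q \<in> Qs" "\<And>z. z \<in> V \<Longrightarrow> app q z = g z"
proof -
  have "app (Aend (\<lambda>z. g (proj z))) = (\<lambda>z. g (proj z))"
    by (rule Aend_inverse) (simp add: assms(2) proj_V proj_add)
  then show thesis
    by (intro that[of "Aend (\<lambda>z. g (proj z))"]) (simp_all add: Qs_def assms proj_V proj_id rho_V)
qed

lemma t_linear: "Vector_Spaces.linear scaleU scaleU t" by (rule finrank_linear[OF t_fin])

lemma app_Tn_tens:
  assumes "Vector_Spaces.linear scaleU scaleU a"
  shows "(app (T a 1) ^^ n) (tens w h) = tens ((a ^^ n) w) h"
  by (induction n) (auto simp: T_tens assms)

lemma app_Ln: "app (((*) s ^^ n) x) z = (app s ^^ n) (app x z)"
  by (induction n) auto
lemma app_Rtn: "app (((\<lambda>x. x * s) ^^ n) x) z = app x ((app s ^^ n) z)"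
  by (induction n arbitrary: z) (auto simp: funpow_swap1)

lemma app_funpow_add: "(app s ^^ n) (x + y) = (app s ^^ n) x + (app s ^^ n) y"
  by (induction n) (auto simp: app_add)
lemma app_funpow_uminus: "(app s ^^ n) (- x) = - (app s ^^ n) x"
  by (induction n) (auto simp: app_minus)
lemma app_funpow_0 [simp]: "(app s ^^ n) 0 = 0" by (induction n) auto
lemma app_funpow_sum: "(app s ^^ n) (sum g S) = (\<Sum>s'\<in>S. (app s ^^ n) (g s'))"
  by (induction S rule: infinite_finite_induct) (auto simp: app_funpow_add)
lemma app_funpow_V: "s \<in> Qs \<Longrightarrow> z \<in> V \<Longrightarrow> (app s ^^ n) z \<in> V"
  by (induction n) (auto simp: Q_V)
lemma app_funpow_rho: "s \<in> Qs \<Longrightarrow> z \<in> V \<Longrightarrow> (app s ^^ n) (rho h z) = rho h ((app s ^^ n) z)"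
  by (induction n) (auto simp: Q_rho app_funpow_V)

lemma app_rank_one_tens:
  assumes "f \<in> Ps"
  shows "app (T (rank_one scaleU w f) h) (tens u k) = tens w (h * scaleH (f u) k)"
  unfolding T_tens[OF rank_one_linear[OF assms]]
  by (simp add: rank_one_def tens_scale H_right)

lemma app_rank_one:
  assumes "f \<in> Ps" "z \<in> V" shows "app (T (rank_one scaleU w f) h) z = tens w (h * pair f z)"
  using assms(2)
  by (rule V_induct)
    (simp_all add: pair_0 assms(1) app_add app_rank_one_tens pair_add tens_V pair_tens
      distrib_left tens_addr)

text \<open>Induction on the number of summands. If some \<open>f\<close> is 1 on the last vector
  and 0 on the others, its \<open>H\<close>-component vanishes; otherwise that vector is a
  combination of the others and its summand can be absorbed.\<close>

lemma pair_total:
  assumes "z \<in> V" "\<And>f. f \<in> Ps \<Longrightarrow> pair f z = 0" shows "z = 0"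
proof -
  have "\<exists>n us hs. z = (\<Sum>i<n::nat. tens (us i) (hs i))"
    using assms(1)
  proof (rule V_induct)
    show "\<exists>n us hs. 0 = (\<Sum>i<n::nat. tens (us i) (hs i))" by (intro exI[of _ 0]) simp
    fix w h z
    assume "\<exists>n us hs. z = (\<Sum>i<n::nat. tens (us i) (hs i))"
    then obtain n us hs where z: "z = (\<Sum>i<n::nat. tens (us i) (hs i))" by blast
    have "tens w h + z = (\<Sum>i<Suc n. tens ((us(n := w)) i) ((hs(n := h)) i))"
      by (simp add: z)
    then show "\<exists>n us hs. tens w h + z = (\<Sum>i<n::nat. tens (us i) (hs i))" by blast
  qed
  then obtain n us hs where z: "z = (\<Sum>i<n::nat. tens (us i) (hs i))" by blast
  have "(\<Sum>i<n::nat. tens (us i) (hs i)) = 0" if "\<And>f. f \<in> Ps \<Longrightarrow> (\<Sum>i<n. scaleH (f (us i)) (hs i)) = 0" for n us hs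
    using that
  proof (induction n arbitrary: hs)
    case 0
    then show ?case by simp
  next
    case (Suc n)
    from dual_system[of "{..<n}" n us]
    consider f where "f \<in> Ps" "f (us n) = 1" "\<forall>s<n. f (us s) = 0"
      | a where "us n = (\<Sum>s<n. scaleU (a s) (us s))" by auto
    then show ?case
    proof cases
      case (1 f)
      then have "hs n = 0" using Suc.prems[OF 1(1)] by simp
      then show ?thesis using Suc.prems by (simp add: Suc.IH)
    next
      case (2 a)
      \<comment> \<open>The absorbed form: the last component is spread over the others with the
        weights \<open>a i\<close>, which gives a sum of \<open>n\<close> terms.\<close>
      have "(\<Sum>i<n. scaleH (f (us i)) (hs i + scaleH (a i) (hs n))) = 0" if "f \<in> Ps" for f
        using Suc.prems[OF that] that
        by (simp add: 2 Ps_sum Ps_scale H.scale_right_distrib sum.distrib H.scale_sum_left mult.commute)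
      from Suc.IH[OF this] show ?thesis
        by (simp add: 2 tens_addr sum.distrib tens_suml tens_scale)
    qed
  qed
  moreover have "(\<Sum>i<n. scaleH (f (us i)) (hs i)) = 0" if "f \<in> Ps" for f
    using assms(2)[OF that] by (simp add: z pair_sum that tens_V pair_tens)
  ultimately show ?thesis using z by simp
qed

text \<open>Contracting the relation at \<open>w = ws s\<close> by \<open>fs s\<close> and summing
  over the family of \<open>dual_powers\<close> cancels every exponent but \<open>c\<close>.\<close>

lemma powers_tens_independent:
  assumes "b < d" "\<And>w. (\<Sum>v\<le>b. tens ((t ^^ v) w) (y v)) = 0" "c \<le> b"
  shows "y c = 0"
proof -
  have c: "c < d" using assms by simp
  obtain n :: nat and fs ws where fam: "\<And>s. s < n \<Longrightarrow> fs s \<in> Ps"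
    "\<And>u. u < d \<Longrightarrow> (\<Sum>s<n. fs s ((t ^^ u) (ws s))) = (if u = c then 1 else 0)"
    by (fact dual_powers[OF c])
  have "0 = (\<Sum>s<n. pair (fs s) (\<Sum>v\<le>b. tens ((t ^^ v) (ws s)) (y v)))"
    by (simp add: assms(2) pair_0 fam(1))
  also have "\<dots> = (\<Sum>s<n. \<Sum>v\<le>b. scaleH (fs s ((t ^^ v) (ws s))) (y v))"
    by (intro sum.cong refl) (simp add: pair_sum fam(1) tens_V pair_tens)
  also have "\<dots> = (\<Sum>v\<le>b. scaleH (\<Sum>s<n. fs s ((t ^^ v) (ws s))) (y v))"
    by (subst sum.swap) (simp add: H.scale_sum_left)
  also have "\<dots> = (\<Sum>v\<le>b. if v = c then y v else 0)"
    using assms(1) by (intro sum.cong refl) (auto simp: fam(2))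
  also have "\<dots> = y c" using assms(3) by simp
  finally show ?thesis by simp
qed

text \<open>A rank one operator built from \<open>f\<close> replaces each \<open>z v\<close> by
  \<open>pair f (z v)\<close> in the second tensor factor; these contractions vanish by independence
  of the powers, and they separate the points of \<open>V\<close>.\<close>

lemma powers_vectors_independent:
  assumes b: "b < d" and z: "\<And>v. v \<le> b \<Longrightarrow> z v \<in> V"
    and eq: "\<And>x. x \<in> R \<Longrightarrow> (\<Sum>v\<le>b. (app (T t 1) ^^ v) (app x (z v))) = 0" and c: "c \<le> b"
  shows "z c = 0"
proof (rule pair_total)
  show "z c \<in> V" using z c by blast
  fix f assume f: "f \<in> Ps"
  have "(\<Sum>v\<le>b. tens ((t ^^ v) w) (pair f (z v))) = 0" for w
  proof -
    have "(\<Sum>v\<le>b. (app (T t 1) ^^ v) (app (T (rank_one scaleU w f) 1) (z v))) = 0"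
      by (intro eq R_T rank_one_finrank f)
    then show ?thesis by (simp add: app_rank_one f z app_Tn_tens t_linear)
  qed
  from powers_tens_independent[OF b this c] show "pair f (z c) = 0" .
qed

lemma left_independent:
  assumes "b < d" "\<And>v. v \<le> b \<Longrightarrow> G v \<in> Qs" "\<And>x. x \<in> R \<Longrightarrow> (\<Sum>v\<le>b. (L ^^ v) x * G v) = 0"
  shows "\<forall>v\<le>b. G v = 0"
proof (intro allI impI aend_eqI)
  fix c z assume c: "c \<le> b"
  have "app (G c) z = 0"
  proof (rule powers_vectors_independent[OF assms(1) _ _ c])
    show "app (G v) z \<in> V" if "v \<le> b" for v using assms(2)[OF that] by (rule Q_V)
    fix x assume "x \<in> R"
    from arg_cong[OF assms(3)[OF this], of "\<lambda>q. app q z"]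
    show "(\<Sum>v\<le>b. (app (T t 1) ^^ v) (app x (app (G v) z))) = 0"
      by (simp add: app_sum_left app_Ln)
  qed
  then show "app (G c) z = app 0 z" by simp
qed

text \<open>The family depends on \<open>a\<close> and \<open>c\<close> only, not on
  \<open>G\<close>, \<open>w\<close> or \<open>h\<close>. One choice therefore yields
  \<open>G c\<close> on all pure tensors, and these determine an element of
  \<open>Qs\<close>.\<close>

lemma extract_coefficient:
  assumes "a < d" "c \<le> a"
  obtains n :: nat and fs ws where "\<And>s. s < n \<Longrightarrow> fs s \<in> Ps"
    "\<And>G w h. (\<Sum>s<n. app (\<Sum>u\<le>a. G u * (Rt ^^ u) (T (rank_one scaleU w (fs s)) h)) (tens (ws s) 1))
      = app (G c) (tens w h)"
proof -
  have c: "c < d" using assms by simp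
  obtain n :: nat and fs ws where fam: "\<And>s. s < n \<Longrightarrow> fs s \<in> Ps"
    "\<And>u. u < d \<Longrightarrow> (\<Sum>s<n. fs s ((t ^^ u) (ws s))) = (if u = c then 1 else 0)"
    by (fact dual_powers[OF c])
  have "(\<Sum>s<n. app (\<Sum>u\<le>a. G u * (Rt ^^ u) (T (rank_one scaleU w (fs s)) h)) (tens (ws s) 1))
      = app (G c) (tens w h)" for G w h
  proof -
    have "(\<Sum>s<n. app (\<Sum>u\<le>a. G u * (Rt ^^ u) (T (rank_one scaleU w (fs s)) h)) (tens (ws s) 1))
      = (\<Sum>s<n. \<Sum>u\<le>a. app (G u) (tens w (scaleH (fs s ((t ^^ u) (ws s))) h)))"
      by (intro sum.cong refl)
        (simp add: app_sum_left app_Rtn app_Tn_tens t_linear app_rank_one fam(1) tens_V pair_tens H_right[symmetric])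
    also have "\<dots> = (\<Sum>u\<le>a. app (G u) (tens w (scaleH (\<Sum>s<n. fs s ((t ^^ u) (ws s))) h)))"
      by (subst sum.swap) (simp add: H.scale_sum_left tens_sumr app_sum)
    also have "\<dots> = (\<Sum>u\<le>a. if u = c then app (G u) (tens w h) else 0)"
      using assms(1) by (intro sum.cong refl) (auto simp: fam(2))
    also have "\<dots> = app (G c) (tens w h)" using assms(2) by simp
    finally show ?thesis .
  qed
  with fam(1) show thesis by (rule that)
qed

lemma right_independent:
  assumes "a < d" "\<And>u. u \<le> a \<Longrightarrow> G u \<in> Qs" "\<And>x. x \<in> R \<Longrightarrow> (\<Sum>u\<le>a. G u * (Rt ^^ u) x) = 0"
  shows "\<forall>u\<le>a. G u = 0"
proof (intro allI impI)
  fix c assume c: "c \<le> a"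
  obtain n :: nat and fs ws where fs: "\<And>s. s < n \<Longrightarrow> fs s \<in> Ps" and ex:
    "\<And>G w h. (\<Sum>s<n. app (\<Sum>u\<le>a. G u * (Rt ^^ u) (T (rank_one scaleU w (fs s)) h)) (tens (ws s) 1))
      = app (G c) (tens w h)"
    by (fact extract_coefficient[OF assms(1) c])
  show "G c = 0"
  proof (rule Q_ext)
    show "app (G c) (tens w h) = app 0 (tens w h)" for w h
      unfolding ex[symmetric] by (simp add: assms(3) R_T rank_one_finrank fs)
  qed (use assms(2) c Q_0 in auto)
qed

lemma Cs_Qs: "Cs \<subseteq> Qs" by (auto simp: Cs_def)
lemma Cs_0: "0 \<in> Cs" by (simp add: Cs_def Q_0)
lemma Cs_diff: "x \<in> Cs \<Longrightarrow> y \<in> Cs \<Longrightarrow> x - y \<in> Cs" by (simp add: Cs_def Q_diff algebra_simps)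
lemma Cs_comm: "c \<in> Cs \<Longrightarrow> x \<in> Qs \<Longrightarrow> c * x = x * c" by (simp add: Cs_def)
lemma Tt_Q: "T t 1 \<in> Qs" by (rule T_Q[OF t_linear])

sublocale fi: fi_ops "(*)" L Rt Qs Cs R
  by unfold_locales
    (auto simp: algebra_simps Q_0 Q_diff Q_mul Tt_Q Cs_0 Cs_diff R_left R_right t_fin
      intro: R_Q[THEN subsetD] Cs_Qs[THEN subsetD] Cs_comm)

lemma app_L_mul: "app ((L ^^ v) x * q) z = (app (T t 1) ^^ v) (app x (app q z))"
  by (simp add: app_Ln)

lemma app_minus_sum: "x + y = 0 \<Longrightarrow> app x z = - app (y :: 'm aend) z"
  by (simp add: eq_neg_iff_add_eq_0 flip: app_plus)

text \<open>Extracting the coefficient of \<open>t\<^sup>c\<close> in \<open>y\<close> expresses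
  \<open>E c x\<close> at a vector \<open>z\<close> through vectors \<open>\<zeta> v\<close> that
  depend on \<open>z\<close> but not on \<open>x\<close>. Uniqueness of these vectors makes
  \<open>z \<mapsto> \<zeta> v\<close> an element of \<open>Qs\<close>, the coefficient
  sought.\<close>

lemma offdiag:
  assumes ab: "a < d" "b < d"
    and E: "\<And>u x. x \<in> R \<Longrightarrow> E u x \<in> Qs" and F: "\<And>v x. x \<in> R \<Longrightarrow> F v x \<in> Qs"
    and eq: "\<And>x y. x \<in> R \<Longrightarrow> y \<in> R \<Longrightarrow> (\<Sum>u\<le>a. E u x * (Rt ^^ u) y) + (\<Sum>v\<le>b. (L ^^ v) x * F v y) = 0"
  shows "\<exists>p. (\<forall>u\<le>a. \<forall>v\<le>b. p u v \<in> Qs) \<and> (\<forall>x\<in>R. \<forall>u\<le>a. E u x = (\<Sum>v\<le>b. (L ^^ v) x * p u v)) \<and>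
       (\<forall>y\<in>R. \<forall>v\<le>b. F v y = - (\<Sum>u\<le>a. p u v * (Rt ^^ u) y))"
proof -
  let ?t = "app (T t 1)"
  have step: "\<exists>p. (\<forall>v\<le>b. p v \<in> Qs) \<and> (\<forall>x\<in>R. E c x = (\<Sum>v\<le>b. (L ^^ v) x * p v))" if c: "c \<le> a" for c
  proof -
    obtain n :: nat and fs ws where fs: "\<And>s. s < n \<Longrightarrow> fs s \<in> Ps" and ex:
      "\<And>G w h. (\<Sum>s<n. app (\<Sum>u\<le>a. G u * (Rt ^^ u) (T (rank_one scaleU w (fs s)) h)) (tens (ws s) 1))
        = app (G c) (tens w h)"
      by (fact extract_coefficient[OF ab(1) c])
    define W where "W z \<zeta> \<longleftrightarrow> (\<forall>v\<le>b. \<zeta> v \<in> V) \<and> (\<forall>x\<in>R. app (E c x) z = (\<Sum>v\<le>b. (?t ^^ v) (app x (\<zeta> v))))"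
      for z \<zeta>
    have Wtens: "\<exists>\<zeta>. W (tens w h) \<zeta>" for w h
    proof -
      define y where "y s = T (rank_one scaleU w (fs s)) h" for s
      \<comment> \<open>\<open>x\<close> occurs only to the left of \<open>F v (y s)\<close> in the
        identity, so this vector is the same for all \<open>x\<close>.\<close>
      define \<zeta> where "\<zeta> v = - (\<Sum>s<n. app (F v (y s)) (tens (ws s) 1))" for v
      have y: "y s \<in> R" if "s < n" for s unfolding y_def by (intro R_T rank_one_finrank fs that)
      have "app (E c x) (tens w h) = (\<Sum>v\<le>b. (?t ^^ v) (app x (\<zeta> v)))" if x: "x \<in> R" for x
      proof -
        have "app (E c x) (tens w h) = (\<Sum>s<n. app (\<Sum>u\<le>a. E u x * (Rt ^^ u) (y s)) (tens (ws s) 1))"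
          unfolding y_def by (rule ex[of "\<lambda>u. E u x", symmetric])
        also have "\<dots> = (\<Sum>s<n. - app (\<Sum>v\<le>b. (L ^^ v) x * F v (y s)) (tens (ws s) 1))"
          by (intro sum.cong refl app_minus_sum eq x y) simp
        also have "\<dots> = - (\<Sum>v\<le>b. \<Sum>s<n. (?t ^^ v) (app x (app (F v (y s)) (tens (ws s) 1))))"
          by (simp add: app_sum_left app_L_mul sum_negf del: app_times) (rule sum.swap)
        also have "\<dots> = (\<Sum>v\<le>b. (?t ^^ v) (app x (\<zeta> v)))"
          by (simp add: \<zeta>_def app_minus app_sum app_funpow_uminus app_funpow_sum sum_negf)
        finally show ?thesis .
      qed
      moreover have "\<zeta> v \<in> V" for v unfolding \<zeta>_def by (intro V_uminus V_sum Q_V F y) simp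
      ultimately show ?thesis unfolding W_def by blast
    qed
    have Wadd: "W (z + z') (\<lambda>v. \<zeta> v + \<zeta>' v)" if "W z \<zeta>" "W z' \<zeta>'" for z z' \<zeta> \<zeta>'
      using that unfolding W_def by (simp add: V_add app_add app_funpow_add sum.distrib)
    have Wrho: "W (rho h z) (\<lambda>v. rho h (\<zeta> v))" if "z \<in> V" "W z \<zeta>" for z h \<zeta>
      unfolding W_def
    proof (intro conjI ballI allI impI)
      show "rho h (\<zeta> v) \<in> V" if "v \<le> b" for v using \<open>W z \<zeta>\<close> that by (simp add: W_def rho_V)
      fix x assume x: "x \<in> R"
      then have xQ: "x \<in> Qs" using R_Q by blast
      have "app (E c x) (rho h z) = rho h (\<Sum>v\<le>b. (?t ^^ v) (app x (\<zeta> v)))"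
        using that x by (simp add: Q_rho E W_def)
      also have "\<dots> = (\<Sum>v\<le>b. rho h ((?t ^^ v) (app x (\<zeta> v))))"
        by (intro rho_sum app_funpow_V Tt_Q Q_V xQ)
      also have "\<dots> = (\<Sum>v\<le>b. (?t ^^ v) (app x (rho h (\<zeta> v))))"
        using \<open>W z \<zeta>\<close> by (intro sum.cong refl) (simp add: W_def Q_rho xQ app_funpow_rho Tt_Q Q_V)
      finally show "app (E c x) (rho h z) = (\<Sum>v\<le>b. (?t ^^ v) (app x (rho h (\<zeta> v))))" .
    qed
    have Wex: "\<exists>\<zeta>. W z \<zeta>" if "z \<in> V" for z
      using that
    proof (rule V_induct)
      show "\<exists>\<zeta>. W 0 \<zeta>" by (rule exI[of _ "\<lambda>_. 0"]) (simp add: W_def V_0)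
      show "\<exists>\<zeta>. W (tens w h + z) \<zeta>" if "\<exists>\<zeta>. W z \<zeta>" for w h z
        using Wtens[of w h] that Wadd by blast
    qed
    \<comment> \<open>Uniqueness turns \<open>Wadd\<close> and \<open>Wrho\<close> into additivity
      and \<open>H\<close>-linearity of the arbitrary choice \<open>Z\<close>.\<close>
    have Wuniq: "\<zeta> v = \<zeta>' v" if "W z \<zeta>" "W z \<zeta>'" "v \<le> b" for z \<zeta> \<zeta>' v
    proof -
      have "\<zeta> v + - \<zeta>' v = 0"
      proof (rule powers_vectors_independent[OF ab(2) _ _ \<open>v \<le> b\<close>])
        show "\<zeta> v + - \<zeta>' v \<in> V" if "v \<le> b" for v
          using \<open>W z \<zeta>\<close> \<open>W z \<zeta>'\<close> that by (simp only: W_def V_add V_uminus)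
        show "(\<Sum>v\<le>b. (?t ^^ v) (app x (\<zeta> v + - \<zeta>' v))) = 0" if "x \<in> R" for x
          using \<open>W z \<zeta>\<close> \<open>W z \<zeta>'\<close> that unfolding W_def
          by (simp add: app_add app_minus app_funpow_add app_funpow_uminus sum.distrib sum_negf
              del: add_uminus_conv_diff)
      qed
      then show ?thesis by simp
    qed
    define Z where "Z z = (SOME \<zeta>. W z \<zeta>)" for z
    have Z: "W z (Z z)" if "z \<in> V" for z unfolding Z_def by (rule someI_ex[OF Wex[OF that]])
    have "\<exists>q\<in>Qs. \<forall>z\<in>V. app q z = Z z v" if v: "v \<le> b" for v
    proof (rule ex_Q[of "\<lambda>z. Z z v"])
      show "Z z v \<in> V" if "z \<in> V" for z using Z[OF that] v by (simp add: W_def)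
      show "Z (y + z) v = Z y v + Z z v" if "y \<in> V" "z \<in> V" for y z
        using Wuniq[OF Z[OF V_add[OF that]] Wadd[OF Z[OF that(1)] Z[OF that(2)]] v] .
      show "Z (rho h z) v = rho h (Z z v)" if "z \<in> V" for z h
        using Wuniq[OF Z[OF rho_V[OF that]] Wrho[OF that Z[OF that]] v] .
    qed blast
    then have "\<forall>v. \<exists>q. v \<le> b \<longrightarrow> q \<in> Qs \<and> (\<forall>z\<in>V. app q z = Z z v)" by blast
    from choice[OF this] obtain p where p: "\<And>v. v \<le> b \<Longrightarrow> p v \<in> Qs" "\<And>v z. v \<le> b \<Longrightarrow> z \<in> V \<Longrightarrow> app (p v) z = Z z v"
      by blast
    have "E c x = (\<Sum>v\<le>b. (L ^^ v) x * p v)" if x: "x \<in> R" for x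
    proof (rule Q_ext)
      show "(\<Sum>v\<le>b. (L ^^ v) x * p v) \<in> Qs"
        using x R_Q p(1) by (intro fi.Q_sum Q_mul fi.Q_Ln) auto
      show "app (E c x) (tens w h) = app (\<Sum>v\<le>b. (L ^^ v) x * p v) (tens w h)" for w h
        using Z[OF tens_V, of w h] x by (simp add: W_def app_sum_left app_L_mul p(2) tens_V del: app_times)
    qed (rule E[OF x])
    then show ?thesis using p(1) by blast
  qed
  then have "\<forall>c. \<exists>p. c \<le> a \<longrightarrow> (\<forall>v\<le>b. p v \<in> Qs) \<and> (\<forall>x\<in>R. E c x = (\<Sum>v\<le>b. (L ^^ v) x * p v))" by blast
  from choice[OF this] obtain p where p: "\<And>c v. c \<le> a \<Longrightarrow> v \<le> b \<Longrightarrow> p c v \<in> Qs"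
    "\<And>c x. c \<le> a \<Longrightarrow> x \<in> R \<Longrightarrow> E c x = (\<Sum>v\<le>b. (L ^^ v) x * p c v)" by blast
  have "F v y = - (\<Sum>u\<le>a. p u v * (Rt ^^ u) y)" if y: "y \<in> R" and v: "v \<le> b" for v y
  proof -
    \<comment> \<open>With the formula for \<open>E\<close> inserted, the identity is one in
      \<open>x\<close> alone, and left independence determines the \<open>F v y\<close>.\<close>
    have "\<forall>v\<le>b. F v y + (\<Sum>u\<le>a. p u v * (Rt ^^ u) y) = 0"
    proof (rule left_independent[OF ab(2)])
      show "F v y + (\<Sum>u\<le>a. p u v * (Rt ^^ u) y) \<in> Qs" if "v \<le> b" for v
        using y R_Q p(1) that by (intro fi.Q_add fi.Q_sum Q_mul fi.Q_Rtn F) auto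
      fix x assume x: "x \<in> R"
      have "(\<Sum>u\<le>a. E u x * (Rt ^^ u) y) = (\<Sum>u\<le>a. \<Sum>v\<le>b. (L ^^ v) x * (p u v * (Rt ^^ u) y))"
        by (intro sum.cong refl) (simp add: p(2) x sum_distrib_right mult.assoc)
      also have "\<dots> = (\<Sum>v\<le>b. (L ^^ v) x * (\<Sum>u\<le>a. p u v * (Rt ^^ u) y))"
        by (subst sum.swap) (simp add: sum_distrib_left)
      finally show "(\<Sum>v\<le>b. (L ^^ v) x * (F v y + (\<Sum>u\<le>a. p u v * (Rt ^^ u) y))) = 0"
        using eq[OF x y] by (simp add: distrib_left sum.distrib add.commute)
    qed
    then show ?thesis using v by (simp add: eq_neg_iff_add_eq_0)
  qed
  then show ?thesis using p by blast
qed

text \<open>Now \<open>x\<close> stands in both sums, so the rank one operators act in both.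
  \<open>E c\<close> turns out to be given by right multiplications of the \<open>H\<close>-factor
  by elements \<open>\<mu> v\<close>; its own \<open>H\<close>-linearity forces these to be
  central.\<close>

lemma diag:
  assumes ab: "a < d" "b < d"
    and E: "\<And>u. E u \<in> Qs" and F: "\<And>v. F v \<in> Qs"
    and eq: "\<And>x. x \<in> R \<Longrightarrow> (\<Sum>u\<le>a. E u * (Rt ^^ u) x) + (\<Sum>v\<le>b. (L ^^ v) x * F v) = 0"
  shows "\<exists>p. (\<forall>u\<le>a. \<forall>v\<le>b. p u v \<in> Cs) \<and> (\<forall>u\<le>a. E u = (\<Sum>v\<le>b. (L ^^ v) (p u v))) \<and>
       (\<forall>v\<le>b. F v = - (\<Sum>u\<le>a. (Rt ^^ u) (p u v)))"
proof -
  let ?t = "app (T t 1)"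
  have step: "\<exists>p. (\<forall>v\<le>b. p v \<in> Cs) \<and> E c = (\<Sum>v\<le>b. (L ^^ v) (p v))" if c: "c \<le> a" for c
  proof -
    obtain n :: nat and fs ws where fs: "\<And>s. s < n \<Longrightarrow> fs s \<in> Ps" and ex:
      "\<And>G w h. (\<Sum>s<n. app (\<Sum>u\<le>a. G u * (Rt ^^ u) (T (rank_one scaleU w (fs s)) h)) (tens (ws s) 1))
        = app (G c) (tens w h)"
      by (fact extract_coefficient[OF ab(1) c])
    \<comment> \<open>The scalar left when a rank one operator built from \<open>fs s\<close> is
      applied to \<open>F v (ws s \<otimes> 1)\<close>, summed over the extracting family.\<close>
    define \<mu> where "\<mu> v = - (\<Sum>s<n. pair (fs s) (app (F v) (tens (ws s) 1)))" for v
    have Et: "app (E c) (tens w h) = (\<Sum>v\<le>b. tens ((t ^^ v) w) (h * \<mu> v))" for w h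
    proof -
      define y where "y s = T (rank_one scaleU w (fs s)) h" for s
      have y: "y s \<in> R" if "s < n" for s unfolding y_def by (intro R_T rank_one_finrank fs that)
      have "app (E c) (tens w h) = (\<Sum>s<n. app (\<Sum>u\<le>a. E u * (Rt ^^ u) (y s)) (tens (ws s) 1))"
        unfolding y_def by (rule ex[symmetric])
      also have "\<dots> = (\<Sum>s<n. - app (\<Sum>v\<le>b. (L ^^ v) (y s) * F v) (tens (ws s) 1))"
        by (intro sum.cong refl app_minus_sum eq y) simp
      also have "\<dots> = (\<Sum>s<n. - (\<Sum>v\<le>b. tens ((t ^^ v) w) (h * pair (fs s) (app (F v) (tens (ws s) 1)))))"
        by (intro sum.cong refl) (simp add: app_sum_left app_L_mul y_def app_rank_one fs Q_V F app_Tn_tens t_linear del: app_times)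
      also have "\<dots> = - (\<Sum>v\<le>b. \<Sum>s<n. tens ((t ^^ v) w) (h * pair (fs s) (app (F v) (tens (ws s) 1))))"
        by (simp add: sum_negf) (rule sum.swap)
      also have "\<dots> = (\<Sum>v\<le>b. tens ((t ^^ v) w) (h * \<mu> v))"
        by (simp add: \<mu>_def tens_minusr tens_sumr sum_distrib_left sum_negf)
      finally show ?thesis .
    qed
    have central: "\<mu> v * k = k * \<mu> v" if v: "v \<le> b" for v k
    proof -
      \<comment> \<open>Both orders arise from \<open>E c\<close> at \<open>tens w k\<close>:
        directly, and by letting \<open>k\<close> act after evaluation at
        \<open>tens w 1\<close>.\<close>
      have "(\<Sum>v\<le>b. tens ((t ^^ v) w) (\<mu> v * k - k * \<mu> v)) = 0" for w
      proof -
        have "(\<Sum>v\<le>b. tens ((t ^^ v) w) (k * \<mu> v)) = app (E c) (rho k (tens w 1))"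
          by (simp add: rho_tens Et)
        also have "\<dots> = rho k (\<Sum>v\<le>b. tens ((t ^^ v) w) (\<mu> v))"
          by (simp add: Q_rho E tens_V Et)
        also have "\<dots> = (\<Sum>v\<le>b. tens ((t ^^ v) w) (\<mu> v * k))"
          by (simp add: rho_sum tens_V rho_tens)
        finally show ?thesis
          by (simp only: diff_conv_add_uminus tens_addr tens_minusr sum.distrib sum_negf) simp
      qed
      from powers_tens_independent[OF ab(2) this v] show ?thesis by simp
    qed
    have "\<exists>q\<in>Qs. \<forall>z\<in>V. app q z = rho (\<mu> v) z" if v: "v \<le> b" for v
    proof (rule ex_Q[of "rho (\<mu> v)"])
      show "rho (\<mu> v) (rho h z) = rho h (rho (\<mu> v) z)" if "z \<in> V" for z h
        using that by (rule V_induct) (simp_all add: rho_add rho_V tens_V rho_tens central[OF v] mult.assoc)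
    qed (auto simp: rho_V rho_add)
    then have "\<forall>v. \<exists>q. v \<le> b \<longrightarrow> q \<in> Qs \<and> (\<forall>z\<in>V. app q z = rho (\<mu> v) z)" by blast
    from choice[OF this] obtain p where p: "\<And>v. v \<le> b \<Longrightarrow> p v \<in> Qs"
      "\<And>v z. v \<le> b \<Longrightarrow> z \<in> V \<Longrightarrow> app (p v) z = rho (\<mu> v) z" by blast
    \<comment> \<open>On \<open>V\<close> the operator \<open>p v\<close> is the right action of
      \<open>\<mu> v\<close>, and elements of \<open>Qs\<close> commute with that action by
      definition.\<close>
    have "p v \<in> Cs" if v: "v \<le> b" for v
      unfolding Cs_def
    proof (intro CollectI conjI ballI p v)
      fix x assume x: "x \<in> Qs"
      show "p v * x = x * p v"
        by (rule Q_ext) (simp_all add: Q_mul p v x Q_V tens_V Q_rho)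
    qed
    moreover have "E c = (\<Sum>v\<le>b. (L ^^ v) (p v))"
    proof (rule Q_ext)
      show "(\<Sum>v\<le>b. (L ^^ v) (p v)) \<in> Qs" using p(1) by (intro fi.Q_sum fi.Q_Ln) auto
      show "app (E c) (tens w h) = app (\<Sum>v\<le>b. (L ^^ v) (p v)) (tens w h)" for w h
        by (simp add: Et app_sum_left app_Ln p(2) tens_V rho_tens app_Tn_tens t_linear)
    qed (rule E)
    ultimately show ?thesis by blast
  qed
  then have "\<forall>c. \<exists>p. c \<le> a \<longrightarrow> (\<forall>v\<le>b. p v \<in> Cs) \<and> E c = (\<Sum>v\<le>b. (L ^^ v) (p v))" by blast
  from choice[OF this] obtain p where p: "\<And>c v. c \<le> a \<Longrightarrow> v \<le> b \<Longrightarrow> p c v \<in> Cs"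
    "\<And>c. c \<le> a \<Longrightarrow> E c = (\<Sum>v\<le>b. (L ^^ v) (p c v))" by blast
  have pQ: "p c v \<in> Qs" if "c \<le> a" "v \<le> b" for c v using p(1)[OF that] Cs_Qs by blast
  have "\<forall>v\<le>b. F v + (\<Sum>u\<le>a. (Rt ^^ u) (p u v)) = 0"
  proof (rule left_independent[OF ab(2)])
    show "F v + (\<Sum>u\<le>a. (Rt ^^ u) (p u v)) \<in> Qs" if "v \<le> b" for v
      using that pQ by (intro fi.Q_add fi.Q_sum fi.Q_Rtn F) auto
    fix x assume x: "x \<in> R"
    have *: "(L ^^ v) (p u v) * (Rt ^^ u) x = (L ^^ v) x * (Rt ^^ u) (p u v)" if "u \<le> a" "v \<le> b" for u v
      using Cs_comm[OF p(1)[OF that], of x] R_Q x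
      by (simp add: fi.Ln_mul[symmetric] fi.Rtn_mul[symmetric] subset_iff)
    have "(\<Sum>u\<le>a. E u * (Rt ^^ u) x) = (\<Sum>u\<le>a. \<Sum>v\<le>b. (L ^^ v) x * (Rt ^^ u) (p u v))"
      by (intro sum.cong refl) (simp add: p(2) x sum_distrib_right *)
    also have "\<dots> = (\<Sum>v\<le>b. (L ^^ v) x * (\<Sum>u\<le>a. (Rt ^^ u) (p u v)))"
      by (subst sum.swap) (simp add: sum_distrib_left)
    finally show "(\<Sum>v\<le>b. (L ^^ v) x * (F v + (\<Sum>u\<le>a. (Rt ^^ u) (p u v)))) = 0"
      using eq[OF x] by (simp add: distrib_left sum.distrib add.commute)
  qed
  then have "F v = - (\<Sum>u\<le>a. (Rt ^^ u) (p u v))" if "v \<le> b" for v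
    using that by (simp add: eq_neg_iff_add_eq_0)
  then show ?thesis using p by blast
qed

theorem only_std_R:
  assumes "finite I" "card I + a \<le> d" "finite J" "card J + b \<le> d"
  shows "fi.only_std I J a b"
proof (rule fi.only_std_general[OF assms])
  show "\<forall>v\<le>b. G v = 0" if "b < d" "\<And>v. v \<le> b \<Longrightarrow> G v \<in> Qs"
      "\<And>x. x \<in> R \<Longrightarrow> (\<Sum>v\<le>b. (L ^^ v) x * G v) = 0" for b G
    using that by (rule left_independent)
  show "\<forall>u\<le>a. G u = 0" if "a < d" "\<And>u. u \<le> a \<Longrightarrow> G u \<in> Qs"
      "\<And>x. x \<in> R \<Longrightarrow> (\<Sum>u\<le>a. G u * (Rt ^^ u) x) = 0" for a G
    using that by (rule right_independent)
  show "fi.only_std {l} {k} a b" if "a < d" "b < d" for k l a b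
  proof (cases "l = k")
    case True
    then show ?thesis using diag[OF that] by (auto intro: fi.only_std_diag)
  next
    case False
    show ?thesis by (rule fi.only_std_offdiag[OF offdiag[OF that] False])
  qed
qed

end

section \<open>Opposite shifts and identities with central values\<close>

context tensor_rep
begin

lemma shifts_commuting:
  assumes "N \<in> finrank_ops scaleU Ps" "M \<in> finrank_ops scaleU Ps"
  shows "commuting_shifts ((*) (T N 1)) (\<lambda>x. x * T M 1) R Cs"
  by unfold_locales (use assms in \<open>auto simp: algebra_simps Cs_0 Cs_diff R_left R_right\<close>)

text \<open>The work lies in showing that a relation between the products of powers of
  \<open>N\<close> and \<open>M\<close> with central coefficients is trivial, by triangularity in
  \<open>s\<close> and dual functionals in \<open>r\<close>.\<close>

lemma only_zero_R:
  obtains N M where "N \<in> finrank_ops scaleU Ps" "M \<in> finrank_ops scaleU Ps"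
    "\<And>I J. finite I \<Longrightarrow> finite J \<Longrightarrow> card I < d \<Longrightarrow> card J < d \<Longrightarrow>
      commuting_shifts.only_zero ((*) (T N 1)) (\<lambda>x. x * T M 1) R Cs I J 0 0"
proof -
  interpret H: vector_space scaleH by (rule H_vs)
  obtain f :: "nat \<Rightarrow> 'u \<Rightarrow> 'f" and e where f: "\<And>i. i < d \<Longrightarrow> f i \<in> Ps"
    and fe: "\<And>i j. i < d \<Longrightarrow> j < d \<Longrightarrow> f i (e j) = (if i = j then 1 else 0)"
    using dual_basis by metis
  \<comment> \<open>The last index: \<open>N\<close> lowers and \<open>M\<close> raises the index
    along \<open>e 0, ..., e D\<close>.\<close>
  define D where "D = d - 1"
  define N where "N u = (\<Sum>i<D. scaleU (f (Suc i) u) (e i))" for u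
  define M where "M u = (\<Sum>i<D. scaleU (f i u) (e (Suc i)))" for u
  have N: "N \<in> finrank_ops scaleU Ps" and M: "M \<in> finrank_ops scaleU Ps"
    unfolding N_def[abs_def] M_def[abs_def] by (rule sum_rank_one_finrank, rule f, simp add: D_def)+
  have Nlin: "Vector_Spaces.linear scaleU scaleU N" and Mlin: "Vector_Spaces.linear scaleU scaleU M"
    using N M by (auto intro: finrank_linear)
  have if_scale: "scaleU (if b then 1 else 0) w = (if b then w else 0)" for b w by simp
  have Ne: "N (e (Suc i)) = e i" if "Suc i < d" for i
  proof -
    have "N (e (Suc i)) = (\<Sum>j<D. if j = i then e j else 0)"
      unfolding N_def using that by (intro sum.cong refl) (auto simp: D_def fe)
    moreover have "i < D" using that by (simp add: D_def)
    ultimately show ?thesis by simp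
  qed
  have Me: "M (e i) = (if Suc i < d then e (Suc i) else 0)" if "i < d" for i
  proof -
    have "M (e i) = (\<Sum>j<D. if j = i then e (Suc j) else 0)"
      unfolding M_def using that by (intro sum.cong refl) (auto simp: D_def fe)
    moreover have "i < D \<longleftrightarrow> Suc i < d" by (auto simp: D_def)
    ultimately show ?thesis by simp
  qed
  have M0: "M 0 = 0"
    using module_hom.zero[of scaleU scaleU M] Mlin by (simp add: Vector_Spaces.linear_def)
  have Nn: "(N ^^ r) (e D) = e (D - r)" if "r < d" for r
    using that
  proof (induction r)
    case (Suc r)
    then have "D - r = Suc (D - Suc r)" by (simp add: D_def)
    with Suc show ?case using Ne[of "D - Suc r"] by (simp add: D_def)
  qed simp
  have Mn: "(M ^^ s) (e (D - s0)) = (if s \<le> s0 then e (D - s0 + s) else 0)" if "s0 < d" for s s0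
  proof (induction s)
    case (Suc s)
    then show ?case using that Me[of "D - s0 + s"] by (auto simp: D_def M0)
  qed simp
  have tens0: "tens 0 h = 0" for h using tens_suml[of "\<lambda>_. 0" "{}" h] by simp
  have "commuting_shifts.only_zero ((*) (T N 1)) (\<lambda>x. x * T M 1) R Cs I J 0 0"
    if IJ: "finite I" "finite J" "card I < d" "card J < d" for I J
  proof (rule commuting_shifts.only_zero_general[OF shifts_commuting[OF N M] IJ(1,3,2,4)])
    fix c c' and \<theta> :: "nat \<Rightarrow> nat \<Rightarrow> 'm aend"
    assume c: "c < d" "c' < d" and \<theta>: "\<And>r s. r \<le> c \<Longrightarrow> s \<le> c' \<Longrightarrow> \<theta> r s \<in> Cs"
      and eq: "(\<Sum>r\<le>c. \<Sum>s\<le>c'. (((*) (T N 1)) ^^ r) (((\<lambda>x. x * T M 1) ^^ s) (\<theta> r s))) = 0"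
    have \<theta>Q: "\<theta> r s \<in> Qs" if "r \<le> c" "s \<le> c'" for r s using \<theta>[OF that] Cs_Qs by blast
    have comm: "app (\<theta> r s) (app q z) = app q (app (\<theta> r s) z)" if "r \<le> c" "s \<le> c'" "q \<in> Qs" for r s q z
      using arg_cong[OF Cs_comm[OF \<theta>[OF that(1,2)] that(3)], of "\<lambda>q. app q z"] by simp
    have commn: "app (\<theta> r s) ((app q ^^ n) z) = (app q ^^ n) (app (\<theta> r s) z)"
      if "r \<le> c" "s \<le> c'" "q \<in> Qs" for r s q z n
      by (induction n) (simp_all add: comm that)
    \<comment> \<open>Induction on \<open>s\<close>. At \<open>e (D - s0)\<close> the terms with
      \<open>s > s0\<close> vanish because \<open>M\<close> runs past \<open>e D\<close>, those with
      \<open>s < s0\<close> by induction, and \<open>s = s0\<close> gives \<open>e D\<close>. From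
      there the powers of \<open>N\<close> lead to the distinct vectors
      \<open>e (D - r)\<close>.\<close>
    have "\<forall>r\<le>c. \<theta> r s = 0" if "s \<le> c'" for s
      using that
    proof (induction s rule: less_induct)
      case (less s0)
      show ?case
      proof (intro allI impI)
        fix r0 assume r0: "r0 \<le> c"
        show "\<theta> r0 s0 = 0"
        proof (rule Q_ext)
          fix w h
          have inner: "(\<Sum>s\<le>c'. (app (T N 1) ^^ r) (app (\<theta> r s) ((app (T M 1) ^^ s) (tens (e (D - s0)) h))))
              = app (\<theta> r s0) (tens (e (D - r)) h)" if r: "r \<le> c" for r
          proof -
            have "(app (T N 1) ^^ r) (app (\<theta> r s) ((app (T M 1) ^^ s) (tens (e (D - s0)) h)))
              = (if s = s0 then app (\<theta> r s0) (tens (e (D - r)) h) else 0)" if s: "s \<le> c'" for s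
            proof (cases s s0 rule: linorder_cases)
              case less
              then show ?thesis using less.IH[OF less s] r by simp
            next
              case equal
              have "s0 < d" "s0 \<le> D" using less.prems c(2) by (auto simp: D_def)
              then have MD: "(M ^^ s0) (e (D - s0)) = e D" using Mn[of s0 s0] by simp
              have "(app (T N 1) ^^ r) (app (\<theta> r s0) ((app (T M 1) ^^ s0) (tens (e (D - s0)) h)))
                = app (\<theta> r s0) ((app (T N 1) ^^ r) (tens (e D) h))"
                using less.prems r MD by (simp add: app_Tn_tens[OF Mlin] commn T_Q Nlin)
              also have "\<dots> = app (\<theta> r s0) (tens (e (D - r)) h)"
                using r c by (simp add: app_Tn_tens Nlin Nn)
              finally show ?thesis using equal by simp
            next
              case greater
              then show ?thesis using less.prems c(2) by (simp add: app_Tn_tens Mlin Mn tens0)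
            qed
            then show ?thesis using less.prems by simp
          qed
          have "0 = app (\<Sum>r\<le>c. \<Sum>s\<le>c'. (((*) (T N 1)) ^^ r) (((\<lambda>x. x * T M 1) ^^ s) (\<theta> r s))) (tens (e (D - s0)) h)"
            by (simp add: eq)
          also have "\<dots> = (\<Sum>r\<le>c. app (\<theta> r s0) (tens (e (D - r)) h))"
            by (simp add: app_sum_left app_Ln app_Rtn inner)
          \<comment> \<open>The rank one operator passes through the central coefficients, selects
            \<open>r = r0\<close> by duality, and replaces the basis vector by the arbitrary
            \<open>w\<close>.\<close>
          finally have "0 = app (T (rank_one scaleU w (f (D - r0))) 1) (\<Sum>r\<le>c. app (\<theta> r s0) (tens (e (D - r)) h))"
            by (metis app_0)
          also have "\<dots> = (\<Sum>r\<le>c. app (\<theta> r s0) (app (T (rank_one scaleU w (f (D - r0))) 1) (tens (e (D - r)) h)))"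
            using less.prems f[of "D - r0"] c
            by (simp add: app_sum comm T_Q rank_one_linear D_def)
          also have "\<dots> = (\<Sum>r\<le>c. if r = r0 then app (\<theta> r s0) (tens w h) else 0)"
          proof (intro sum.cong refl)
            fix r assume "r \<in> {..c}"
            then have "r \<le> D" "r0 \<le> D" "D - r0 < d" "D - r < d" using r0 c by (auto simp: D_def)
            moreover from this have "D - r = D - r0 \<longleftrightarrow> r = r0" by auto
            ultimately show "app (\<theta> r s0) (app (T (rank_one scaleU w (f (D - r0))) 1) (tens (e (D - r)) h))
              = (if r = r0 then app (\<theta> r s0) (tens w h) else 0)"
              using f[of "D - r0"] fe[of "D - r0" "D - r"]
              by (auto simp: app_rank_one_tens)
          qed
          also have "\<dots> = app (\<theta> r0 s0) (tens w h)" using r0 by simp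
          finally show "app (\<theta> r0 s0) (tens w h) = app 0 (tens w h)" by simp
        qed (use \<theta>Q r0 less.prems Q_0 in auto)
      qed
    qed
    then show "\<forall>r\<le>c. \<forall>s\<le>c'. \<theta> r s = 0" by blast
  qed
  with N M show thesis by (rule that)
qed

end

section \<open>Rings with a carrier\<close>

lemma nths_eq_iff:
  "length xs = length ys \<Longrightarrow> nths xs A = nths ys A \<longleftrightarrow> (\<forall>i<length xs. i \<in> A \<longrightarrow> xs ! i = ys ! i)"
proof (induction xs ys arbitrary: A rule: list_induct2)
  case (Cons x xs y ys)
  then show ?case by (simp add: nths_Cons All_less_Suc2)
qed simp

lemma omit_eq_iff:
  "length xs = length ys \<Longrightarrow> omit K xs = omit K ys \<longleftrightarrow> (\<forall>i<length xs. i \<notin> K \<longrightarrow> xs ! i = ys ! i)"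
  by (simp add: omit_def nths_eq_iff)

lemma length_omit: "K \<subseteq> {..<length xs} \<Longrightarrow> length (omit K xs) = length xs - card K"
proof -
  assume K: "K \<subseteq> {..<length xs}"
  have "{i. i < length xs \<and> i \<in> - K} = {..<length xs} - K" by auto
  then show ?thesis using K
    by (simp add: omit_def length_nths card_Diff_subset finite_subset[OF K])
qed

lemma set_omit: "set (omit K xs) \<subseteq> set xs" by (simp add: omit_def set_nths_subset)

text \<open>\<open>\<phi> \<one>\<close> acts as a unit on \<open>S\<close> only, since the image of
  \<open>Q\<close> has its own identity. That \<open>Q\<close> is a ring is a conclusion
  (\<open>ring_Q\<close>): the laws hold for the images and \<open>\<phi>\<close> is
  injective.\<close>

locale ring_embedding =
  fixes Q :: "('a, 'b) ring_scheme" (structure) and \<phi> :: "'a \<Rightarrow> 'q::ring" and S :: "'q set"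
  assumes inj: "inj_on \<phi> (carrier Q)" and img: "\<phi> ` carrier Q = S"
    and add: "x \<in> carrier Q \<Longrightarrow> y \<in> carrier Q \<Longrightarrow> x \<oplus> y \<in> carrier Q \<and> \<phi> (x \<oplus> y) = \<phi> x + \<phi> y"
    and mult: "x \<in> carrier Q \<Longrightarrow> y \<in> carrier Q \<Longrightarrow> x \<otimes> y \<in> carrier Q \<and> \<phi> (x \<otimes> y) = \<phi> x * \<phi> y"
    and zero: "\<zero> \<in> carrier Q" "\<phi> \<zero> = 0"
    and one: "\<one> \<in> carrier Q" "q \<in> S \<Longrightarrow> \<phi> \<one> * q = q" "q \<in> S \<Longrightarrow> q * \<phi> \<one> = q"
    and S_uminus: "q \<in> S \<Longrightarrow> - q \<in> S"
begin

lemma eqI: "x \<in> carrier Q \<Longrightarrow> y \<in> carrier Q \<Longrightarrow> \<phi> x = \<phi> y \<Longrightarrow> x = y"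
  using inj by (auto dest: inj_onD)

lemma in_S: "x \<in> carrier Q \<Longrightarrow> \<phi> x \<in> S" using img by auto

lemma ring_Q: "ring Q"
proof (rule ringI)
  show "abelian_group Q"
  proof (rule abelian_groupI)
    fix x assume x: "x \<in> carrier Q"
    then have "- \<phi> x \<in> \<phi> ` carrier Q" using S_uminus in_S img by simp
    then obtain y where y: "y \<in> carrier Q" "\<phi> y = - \<phi> x" by auto
    then have "y \<oplus> x = \<zero>" using x by (intro eqI) (simp_all add: add zero)
    with y show "\<exists>y\<in>carrier Q. y \<oplus> x = \<zero>" by blast
  qed (use add zero in \<open>auto intro!: eqI simp: add.assoc add.commute\<close>)
  show "monoid Q"
    by (rule monoidI) (use mult one in_S in \<open>auto intro!: eqI simp: mult.assoc\<close>)
qed (use add mult in \<open>auto intro!: eqI simp: algebra_simps\<close>)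

sublocale Q: ring Q by (rule ring_Q)

lemma emb_minus: "x \<in> carrier Q \<Longrightarrow> \<phi> (\<ominus> x) = - \<phi> x"
proof -
  assume x: "x \<in> carrier Q"
  then have "\<phi> (\<ominus> x) + \<phi> x = 0"
    using add[of "\<ominus> x" x] zero by (simp add: Q.l_neg)
  then show ?thesis by (simp add: eq_neg_iff_add_eq_0)
qed

lemma emb_finsum: "(\<And>s. s \<in> A \<Longrightarrow> f s \<in> carrier Q) \<Longrightarrow> \<phi> (\<Oplus>s\<in>A. f s) = (\<Sum>s\<in>A. \<phi> (f s))"
proof (induction A rule: infinite_finite_induct)
  case (insert s A)
  have "(\<Oplus>s\<in>A. f s) \<in> carrier Q" using insert by (intro Q.finsum_closed) auto
  then show ?case using insert by (simp add: Q.finsum_insert Pi_def add)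
next
  case (infinite A)
  then show ?case by (simp add: Q.add.finprod_infinite zero)
qed (simp add: zero)

definition preim :: "'q \<Rightarrow> 'a" where "preim = the_inv_into (carrier Q) \<phi>"

lemma preim_closed: "q \<in> S \<Longrightarrow> preim q \<in> carrier Q"
  unfolding preim_def using the_inv_into_into[OF inj] img by blast
lemma emb_preim: "q \<in> S \<Longrightarrow> \<phi> (preim q) = q"
  unfolding preim_def using f_the_inv_into_f[OF inj] img by blast
lemma preim_emb: "x \<in> carrier Q \<Longrightarrow> preim (\<phi> x) = x"
  by (simp add: preim_def the_inv_into_f_f[OF inj])

definition center :: "'q set" where "center = {c \<in> S. \<forall>x\<in>S. c * x = x * c}"

lemma rcenter_iff: "x \<in> rcenter Q \<longleftrightarrow> x \<in> carrier Q \<and> \<phi> x \<in> center"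
proof -
  have "x \<otimes> y = y \<otimes> x \<longleftrightarrow> \<phi> x * \<phi> y = \<phi> y * \<phi> x" if "x \<in> carrier Q" "y \<in> carrier Q" for y
    using that mult[of x y] mult[of y x] eqI[of "x \<otimes> y" "y \<otimes> x"] by metis
  moreover have "c \<in> center \<longleftrightarrow> c \<in> S \<and> (\<forall>y\<in>carrier Q. c * \<phi> y = \<phi> y * c)" for c
    unfolding center_def using img by auto
  ultimately show ?thesis by (auto simp: rcenter_def in_S)
qed

lemma zero_rcenter: "\<zero> \<in> rcenter Q" by (simp add: rcenter_def)

text \<open>Membership in the carrier and the value of the image travel together, so large
  expressions can be translated by following their structure.\<close>

definition rel :: "'a \<Rightarrow> 'q \<Rightarrow> bool" where "rel x q \<longleftrightarrow> x \<in> carrier Q \<and> \<phi> x = q"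

lemma rel_unique: "rel x q \<Longrightarrow> rel y q \<Longrightarrow> x = y"
  unfolding rel_def using eqI by auto
lemma rel_add: "rel x p \<Longrightarrow> rel y q \<Longrightarrow> rel (x \<oplus> y) (p + q)"
  using add by (auto simp: rel_def)
lemma rel_mult: "rel x p \<Longrightarrow> rel y q \<Longrightarrow> rel (x \<otimes> y) (p * q)"
  using mult by (auto simp: rel_def)
lemma rel_minus: "rel x p \<Longrightarrow> rel (\<ominus> x) (- p)"
  using emb_minus by (auto simp: rel_def)
lemma rel_sum: "(\<And>s. s \<in> A \<Longrightarrow> rel (f s) (g s)) \<Longrightarrow> rel (\<Oplus>s\<in>A. f s) (\<Sum>s\<in>A. g s)"
  unfolding rel_def by (auto simp: emb_finsum intro!: Q.finsum_closed)

text \<open>Powers of \<open>t\<close> occur only next to another factor; as iterated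
  multiplications they also make sense in the class \<open>ring\<close>, which has no unit.\<close>

lemma rel_pow_right:
  assumes "rel t \<tau>" "rel y q" shows "rel (y \<otimes> t [^] (u::nat)) (((\<lambda>x. x * \<tau>) ^^ u) q)"
proof (induction u)
  case (Suc u)
  have "y \<otimes> t [^] Suc u = (y \<otimes> t [^] u) \<otimes> t" using assms by (simp add: Q.m_assoc rel_def)
  then show ?case using rel_mult[OF Suc assms(1)] by simp
qed (use assms in \<open>simp add: rel_def\<close>)

lemma rel_pow_left:
  assumes "rel t \<tau>" "rel y q" shows "rel (t [^] (u::nat) \<otimes> y) (((*) \<tau> ^^ u) q)"
proof (induction u)
  case (Suc u)
  have "t [^] Suc u \<otimes> y = t \<otimes> (t [^] u \<otimes> y)"
    using assms by (simp only: Q.nat_pow_Suc2 rel_def) (simp add: Q.m_assoc)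
  then show ?case using rel_mult[OF assms(1) Suc] by simp
qed (use assms in \<open>simp add: rel_def\<close>)

end

text \<open>\<open>r0\<close> pads a list to a function on \<open>nat\<close> (see
  \<open>fn\<close>), as such tuples must have all their entries in \<open>R\<close>.\<close>

locale embedded_subset = ring_embedding Q \<phi> S + fi: fi_ops "(*)" "(*) (\<phi> t)" "\<lambda>x. x * \<phi> t" S center "\<phi> ` R"
  for Q :: "('a, 'b) ring_scheme" (structure) and \<phi> :: "'a \<Rightarrow> 'q::ring" and S R t +
  fixes r0 :: 'a
  assumes R_carrier: "R \<subseteq> carrier Q" and t_carrier: "t \<in> carrier Q" and r0: "r0 \<in> R"
begin

abbreviation L :: "'q \<Rightarrow> 'q" where "L \<equiv> (*) (\<phi> t)"
abbreviation Rt :: "'q \<Rightarrow> 'q" where "Rt \<equiv> \<lambda>x. x * \<phi> t"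

definition lst :: "nat \<Rightarrow> (nat \<Rightarrow> 'q) \<Rightarrow> 'a list" where
  "lst m x = map (\<lambda>i. preim (x i)) [0..<m]"

definition fn :: "'a list \<Rightarrow> nat \<Rightarrow> 'q" where
  "fn xs i = (if i < length xs then \<phi> (xs ! i) else \<phi> r0)"

lemma preim_R: "q \<in> \<phi> ` R \<Longrightarrow> preim q \<in> R" using R_carrier preim_emb by auto

lemma length_lst [simp]: "length (lst m x) = m" by (simp add: lst_def)
lemma nth_lst [simp]: "i < m \<Longrightarrow> lst m x ! i = preim (x i)" by (simp add: lst_def)
lemma lst_R: "x \<in> fi.X \<Longrightarrow> lst m x \<in> lists R"
  using preim_R fi.X_R by (auto simp: lst_def)
lemma fn_X: "xs \<in> lists R \<Longrightarrow> fn xs \<in> fi.X"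
  using r0 by (auto simp: fi.X_def fn_def dest: nth_mem)
lemma lst_fn: "xs \<in> lists R \<Longrightarrow> lst (length xs) (fn xs) = xs"
  using R_carrier by (intro nth_equalityI) (auto simp: fn_def intro!: preim_emb dest!: nth_mem)
lemma emb_nth_lst: "x \<in> fi.X \<Longrightarrow> i < m \<Longrightarrow> \<phi> (lst m x ! i) = x i"
  using fi.X_Q by (simp add: emb_preim)
lemma nth_carrier: "xs \<in> lists R \<Longrightarrow> i < length xs \<Longrightarrow> xs ! i \<in> carrier Q"
  using R_carrier nth_mem by blast

lemma omit_R: "xs \<in> lists R \<Longrightarrow> omit K xs \<in> lists R" using set_omit by fastforce

lemma maps_intoD:
  assumes "maps_into R (m - 1) f A" "xs \<in> lists R" "length xs = m" "i < m"
  shows "f (omit {i} xs) \<in> A"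
  using assms omit_R[of xs "{i}"] length_omit[of "{i}" xs] by (simp add: maps_into_def)

lemma omit_lst_upd: "omit {i} (lst m (x(i := r))) = omit {i} (lst m x)"
  by (subst omit_eq_iff) auto

lemma coef_lift:
  assumes f: "maps_into R (m - 1) f (carrier Q)" and i: "i < m"
  shows "fi.coef i (\<lambda>x. \<phi> (f (omit {i} (lst m x))))"
  unfolding fi.coef_def fi.indep_def
  using maps_intoD[OF f lst_R _ i] in_S by (simp add: omit_lst_upd)

lemma rel_t: "rel t (\<phi> t)" using t_carrier by (simp add: rel_def)

lemma rel_nth: "xs \<in> lists R \<Longrightarrow> i < length xs \<Longrightarrow> rel (xs ! i) (\<phi> (xs ! i))"
  using nth_carrier by (simp add: rel_def)

lemma rel_omit:
  assumes "maps_into R (m - 1) f (carrier Q)" "xs \<in> lists R" "length xs = m" "i < m"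
  shows "rel (f (omit {i} xs)) (\<phi> (f (omit {i} xs)))"
  using maps_intoD[OF assms] by (simp add: rel_def)

lemma rel_tFI_expr:
  assumes "xs \<in> lists R" "length xs = m" "I \<subseteq> {..<m}" "J \<subseteq> {..<m}"
    and "\<forall>i\<in>I. \<forall>u\<le>a. maps_into R (m - 1) (E i u) (carrier Q)"
    and "\<forall>j\<in>J. \<forall>v\<le>b. maps_into R (m - 1) (F j v) (carrier Q)"
  shows "rel (tFI_expr Q t a b I J E F xs)
     ((\<Sum>i\<in>I. \<Sum>u\<le>a. \<phi> (E i u (omit {i} xs)) * (Rt ^^ u) (\<phi> (xs ! i)))
      + (\<Sum>j\<in>J. \<Sum>v\<le>b. (L ^^ v) (\<phi> (xs ! j)) * \<phi> (F j v (omit {j} xs))))"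
  unfolding tFI_expr_def fi.Rtn_mul[symmetric]
proof (intro rel_add rel_sum)
  fix i u assume iu: "i \<in> I" "u \<in> {..a}"
  show "rel (E i u (omit {i} xs) \<otimes> xs ! i \<otimes> t [^] u) ((Rt ^^ u) (\<phi> (E i u (omit {i} xs)) * \<phi> (xs ! i)))"
    by (intro rel_pow_right rel_t rel_mult rel_omit[of m] rel_nth) (use assms iu in auto)
next
  fix j v assume jv: "j \<in> J" "v \<in> {..b}"
  show "rel (t [^] v \<otimes> xs ! j \<otimes> F j v (omit {j} xs)) ((L ^^ v) (\<phi> (xs ! j)) * \<phi> (F j v (omit {j} xs)))"
    by (rule rel_mult; (intro rel_pow_left rel_t rel_nth)?; (rule rel_omit[of m])?) (use assms jv in auto)
qed

lemma rel_FI_expr: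
  assumes "xs \<in> lists R" "length xs = m" "I \<subseteq> {..<m}" "J \<subseteq> {..<m}"
    and "\<forall>i\<in>I. maps_into R (m - 1) (E i) (carrier Q)"
    and "\<forall>j\<in>J. maps_into R (m - 1) (F j) (carrier Q)"
  shows "rel (FI_expr Q I J E F xs)
     ((\<Sum>i\<in>I. \<phi> (E i (omit {i} xs)) * \<phi> (xs ! i)) + (\<Sum>j\<in>J. \<phi> (xs ! j) * \<phi> (F j (omit {j} xs))))"
  unfolding FI_expr_def by (intro rel_add rel_sum rel_mult rel_omit[of m] rel_nth) (use assms in auto)

text \<open>A function of \<open>m\<close> variables that is independent of the omitted ones, as a function of the remaining
  ones; the value on lists that do not arise by omission is immaterial.\<close>
definition descend :: "nat \<Rightarrow> nat set \<Rightarrow> ((nat \<Rightarrow> 'q) \<Rightarrow> 'q) \<Rightarrow> 'a list \<Rightarrow> 'a" where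
  "descend m K G ys = (if \<exists>xs\<in>lists R. length xs = m \<and> omit K xs = ys
     then preim (G (fn (SOME xs. xs \<in> lists R \<and> length xs = m \<and> omit K xs = ys))) else \<zero>)"

text \<open>The representative chosen in \<open>descend\<close> may differ from \<open>xs\<close> at
  positions \<open>i\<close> and \<open>j\<close> only, and \<open>G\<close> ignores these. The case
  \<open>i = j\<close> is included and serves the central coefficients.\<close>

lemma descend_omit:
  assumes G: "fi.indep i G" "fi.indep j G" and xs: "xs \<in> lists R" "length xs = m" and ij: "i < m" "j < m"
  shows "descend m {i, j} G (omit {i, j} xs) = preim (G (fn xs))"
proof -
  define P where "P zs \<longleftrightarrow> zs \<in> lists R \<and> length zs = m \<and> omit {i, j} zs = omit {i, j} xs" for zs
  define ys where "ys = (SOME zs. P zs)"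
  have "P xs" using xs by (simp add: P_def)
  then have "P ys" unfolding ys_def by (rule someI)
  then have ys: "ys \<in> lists R" "length ys = m" "omit {i, j} ys = omit {i, j} xs" by (auto simp: P_def)
  then have agree: "ys ! k = xs ! k" if "k < m" "k \<noteq> i" "k \<noteq> j" for k
    using omit_eq_iff[of ys xs "{i, j}"] xs that by auto
  \<comment> \<open>Beyond position \<open>m\<close> both functions take the padding value, so two
    updates suffice.\<close>
  have "fn ys = (fn xs)(i := fn ys i, j := fn ys j)"
    using agree ys xs by (auto simp: fun_eq_iff fn_def)
  then have "G (fn ys) = G ((fn xs)(i := fn ys i, j := fn ys j))" by simp
  also have "\<dots> = G ((fn xs)(i := fn ys i))"
    using G(2) fi.X_upd[OF fn_X[OF xs(1)] fi.X_R[OF fn_X[OF ys(1)]]] fi.X_R[OF fn_X[OF ys(1)]]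
    unfolding fi.indep_def by blast
  also have "\<dots> = G (fn xs)"
    using G(1) fn_X[OF xs(1)] fi.X_R[OF fn_X[OF ys(1)]] unfolding fi.indep_def by blast
  finally show ?thesis using \<open>P xs\<close> unfolding descend_def P_def[symmetric] ys_def[symmetric]
    by (auto simp: P_def)
qed

lemma descend_in:
  assumes "\<And>x. x \<in> fi.X \<Longrightarrow> G x \<in> D" "\<And>q. q \<in> D \<Longrightarrow> preim q \<in> A" "\<zero> \<in> A"
  shows "descend m K G ys \<in> A"
proof (cases "\<exists>xs\<in>lists R. length xs = m \<and> omit K xs = ys")
  case True
  then have "\<exists>xs. xs \<in> lists R \<and> length xs = m \<and> omit K xs = ys" by blast
  from someI_ex[OF this] show ?thesis unfolding descend_def using True assms(1,2) fn_X by simp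
next
  case False
  then show ?thesis unfolding descend_def by (subst if_not_P) (auto intro: assms(3))
qed

text \<open>Reconciles the diagonal summands of \<open>lterm\<close>, which have powers of
  \<open>t\<close> on the left, with \<open>t_std_sol\<close>, which puts them to the right of
  \<open>lam\<close>.\<close>

lemma central_pow: "c \<in> center \<Longrightarrow> (L ^^ v) c = (Rt ^^ v) c"
proof (induction v)
  case (Suc v)
  have "(L ^^ Suc v) c = L ((Rt ^^ v) c)" using Suc by simp
  also have "\<dots> = (Rt ^^ v) (L c)" by (rule fi.Rtn_L[symmetric])
  also have "L c = Rt c" using Suc.prems in_S[OF t_carrier] by (simp add: center_def)
  finally show ?case using funpow_swap1[of Rt v c] by simp
qed simp

text \<open>Common source of both notions of standard solution, phrased through images under
  \<open>\<phi>\<close> so that only the translation back to \<open>Q\<close> remains in each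
  case.\<close>

lemma standard_solution:
  assumes only: "fi.only_std I J a b" and IJ: "I \<subseteq> {..<m}" "J \<subseteq> {..<m}"
    and E: "\<forall>i\<in>I. \<forall>u\<le>a. maps_into R (m - 1) (E i u) (carrier Q)"
    and F: "\<forall>j\<in>J. \<forall>v\<le>b. maps_into R (m - 1) (F j v) (carrier Q)"
    and id: "\<And>xs. xs \<in> lists R \<Longrightarrow> length xs = m \<Longrightarrow>
      (\<Sum>i\<in>I. \<Sum>u\<le>a. \<phi> (E i u (omit {i} xs)) * (Rt ^^ u) (\<phi> (xs ! i)))
      + (\<Sum>j\<in>J. \<Sum>v\<le>b. (L ^^ v) (\<phi> (xs ! j)) * \<phi> (F j v (omit {j} xs))) = 0"
  obtains P lam where "\<And>i u j v ys. i \<in> I \<Longrightarrow> u \<le> a \<Longrightarrow> j \<in> J \<Longrightarrow> v \<le> b \<Longrightarrow> P i u j v ys \<in> carrier Q"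
    "\<And>k u v ys. u \<le> a \<Longrightarrow> v \<le> b \<Longrightarrow> lam k u v ys \<in> rcenter Q"
    "\<And>k u v ys. k \<notin> I \<inter> J \<Longrightarrow> lam k u v ys = \<zero>"
    "\<And>xs i u. xs \<in> lists R \<Longrightarrow> length xs = m \<Longrightarrow> i \<in> I \<Longrightarrow> u \<le> a \<Longrightarrow> \<phi> (E i u (omit {i} xs)) =
      (\<Sum>j\<in>J - {i}. \<Sum>v\<le>b. (L ^^ v) (\<phi> (xs ! j)) * \<phi> (P i u j v (omit {i, j} xs)))
      + (\<Sum>v\<le>b. (Rt ^^ v) (\<phi> (lam i u v (omit {i} xs))))"
    "\<And>xs j v. xs \<in> lists R \<Longrightarrow> length xs = m \<Longrightarrow> j \<in> J \<Longrightarrow> v \<le> b \<Longrightarrow> \<phi> (F j v (omit {j} xs)) =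
      - (\<Sum>i\<in>I - {j}. \<Sum>u\<le>a. \<phi> (P i u j v (omit {i, j} xs)) * (Rt ^^ u) (\<phi> (xs ! i)))
      + - (\<Sum>u\<le>a. (Rt ^^ u) (\<phi> (lam j u v (omit {j} xs))))"
proof -
  have finIJ: "finite I" "finite J" using IJ finite_subset by auto
  let ?E = "\<lambda>i u x. \<phi> (E i u (omit {i} (lst m x)))" and ?F = "\<lambda>j v x. \<phi> (F j v (omit {j} (lst m x)))"
  have sol: "fi.sol I J a b ?E ?F"
  proof (rule fi.only_stdD[OF only])
    show "fi.coef i (?E i u)" if "i \<in> I" "u \<le> a" for i u using E IJ that by (intro coef_lift) auto
    show "fi.coef j (?F j v)" if "j \<in> J" "v \<le> b" for j v using F IJ that by (intro coef_lift) auto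
    fix x assume x: "x \<in> fi.X"
    show "fi.lhs I J a b ?E ?F x = 0"
      unfolding fi.lhs_def id[OF lst_R[OF x] length_lst, symmetric]
      using IJ x by (intro arg_cong2[of _ _ _ _ "(+)"] sum.cong refl) (auto simp: emb_nth_lst simp del: nth_lst)
  qed
  obtain p where p: "\<And>i u j v. i \<in> I \<Longrightarrow> u \<le> a \<Longrightarrow> j \<in> J \<Longrightarrow> v \<le> b \<Longrightarrow> fi.coef2 i j (p i u j v)"
    "\<And>x i u. x \<in> fi.X \<Longrightarrow> i \<in> I \<Longrightarrow> u \<le> a \<Longrightarrow> ?E i u x = (\<Sum>j\<in>J. \<Sum>v\<le>b. fi.lterm i j v x (p i u j v x))"
    "\<And>x j v. x \<in> fi.X \<Longrightarrow> j \<in> J \<Longrightarrow> v \<le> b \<Longrightarrow> ?F j v x = - (\<Sum>i\<in>I. \<Sum>u\<le>a. fi.rterm i j u x (p i u j v x))"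
    by (fact fi.solE[OF sol])
  have pS: "p i u j v x \<in> S" if "x \<in> fi.X" "i \<in> I" "u \<le> a" "j \<in> J" "v \<le> b" for i u j v x
    using p(1)[OF that(2-5)] that(1) fi.C_Q unfolding fi.coef2_def by (auto split: if_splits)
  have pC: "p k u k v x \<in> center" if "x \<in> fi.X" "k \<in> I \<inter> J" "u \<le> a" "v \<le> b" for k u v x
    using p(1)[of k u k v] that unfolding fi.coef2_def by auto
  define P where "P i u j v = descend m {i, j} (p i u j v)" for i u j v
  \<comment> \<open>The diagonal part of the family: as \<open>{k, k} = {k}\<close>,
    \<open>P k u k v\<close> is a function of tuples with just one omitted entry.\<close>
  define lam where "lam k u v ys = (if k \<in> I \<inter> J then P k u k v ys else \<zero>)" for k u v ys
  have emb_P: "\<phi> (P i u j v (omit {i, j} xs)) = p i u j v (fn xs)"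
    if "i \<in> I" "u \<le> a" "j \<in> J" "v \<le> b" "xs \<in> lists R" "length xs = m" for i u j v xs
  proof -
    have "P i u j v (omit {i, j} xs) = preim (p i u j v (fn xs))"
      unfolding P_def using p(1)[OF that(1-4)] that IJ unfolding fi.coef2_def by (intro descend_omit) auto
    then show ?thesis using pS[OF fn_X] that by (simp add: emb_preim)
  qed
  have emb_lam: "\<phi> (lam k u v (omit {k} xs)) = (if k \<in> I \<inter> J then p k u k v (fn xs) else 0)"
    if "u \<le> a" "v \<le> b" "xs \<in> lists R" "length xs = m" for k u v xs
    using emb_P[of k u k v xs] that by (simp add: lam_def zero)
  have Rt0: "(Rt ^^ v) 0 = 0" for v using fi.Rtn_mul[of v 0 0] by simp
  have eqE: "\<phi> (E i u (omit {i} xs)) =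
      (\<Sum>j\<in>J - {i}. \<Sum>v\<le>b. (L ^^ v) (\<phi> (xs ! j)) * \<phi> (P i u j v (omit {i, j} xs)))
      + (\<Sum>v\<le>b. (Rt ^^ v) (\<phi> (lam i u v (omit {i} xs))))" (is "_ = ?A + ?B")
    if xs: "xs \<in> lists R" "length xs = m" and i: "i \<in> I" and u: "u \<le> a" for xs i u
  proof -
    let ?x = "fn xs"
    have x: "?x \<in> fi.X" by (rule fn_X[OF xs(1)])
    have "\<phi> (E i u (omit {i} xs)) = (\<Sum>j\<in>J. \<Sum>v\<le>b. fi.lterm i j v ?x (p i u j v ?x))"
      using p(2)[OF x i u] lst_fn[OF xs(1)] xs(2) by simp
    also have "\<dots> = (\<Sum>j\<in>J - {i}. \<Sum>v\<le>b. fi.lterm i j v ?x (p i u j v ?x))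
        + (\<Sum>v\<le>b. if i \<in> J then fi.lterm i i v ?x (p i u i v ?x) else 0)"
      using finIJ(2) by (cases "i \<in> J") (simp_all add: sum.remove[of J i] add.commute)
    also have "(\<Sum>j\<in>J - {i}. \<Sum>v\<le>b. fi.lterm i j v ?x (p i u j v ?x)) = ?A"
      using xs i u IJ by (intro sum.cong refl) (auto simp: fi.lterm_def fn_def emb_P)
    also have "(\<Sum>v\<le>b. if i \<in> J then fi.lterm i i v ?x (p i u i v ?x) else 0) = ?B"
      using central_pow[OF pC[OF x _ u]] i xs u
      by (intro sum.cong refl) (auto simp: fi.lterm_def emb_lam Rt0)
    finally show ?thesis .
  qed
  have eqF: "\<phi> (F j v (omit {j} xs)) =
      - (\<Sum>i\<in>I - {j}. \<Sum>u\<le>a. \<phi> (P i u j v (omit {i, j} xs)) * (Rt ^^ u) (\<phi> (xs ! i)))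
      + - (\<Sum>u\<le>a. (Rt ^^ u) (\<phi> (lam j u v (omit {j} xs))))" (is "_ = - ?A + - ?B")
    if xs: "xs \<in> lists R" "length xs = m" and j: "j \<in> J" and v: "v \<le> b" for xs j v
  proof -
    let ?x = "fn xs"
    have x: "?x \<in> fi.X" by (rule fn_X[OF xs(1)])
    have "\<phi> (F j v (omit {j} xs)) = - (\<Sum>i\<in>I. \<Sum>u\<le>a. fi.rterm i j u ?x (p i u j v ?x))"
      using p(3)[OF x j v] lst_fn[OF xs(1)] xs(2) by simp
    also have "\<dots> = - (\<Sum>i\<in>I - {j}. \<Sum>u\<le>a. fi.rterm i j u ?x (p i u j v ?x))
        + - (\<Sum>u\<le>a. if j \<in> I then fi.rterm j j u ?x (p j u j v ?x) else 0)"
      using finIJ(1) by (cases "j \<in> I") (simp_all add: sum.remove[of I j])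
    also have "(\<Sum>i\<in>I - {j}. \<Sum>u\<le>a. fi.rterm i j u ?x (p i u j v ?x)) = ?A"
      using xs j v IJ by (intro sum.cong refl) (auto simp: fi.rterm_def fn_def emb_P)
    also have "(\<Sum>u\<le>a. if j \<in> I then fi.rterm j j u ?x (p j u j v ?x) else 0) = ?B"
      using j xs v by (intro sum.cong refl) (auto simp: fi.rterm_def emb_lam Rt0)
    finally show ?thesis .
  qed
  show thesis
  proof (rule that[of P lam])
    show "P i u j v ys \<in> carrier Q" if "i \<in> I" "u \<le> a" "j \<in> J" "v \<le> b" for i u j v ys
      unfolding P_def using pS that by (intro descend_in[where D = S] preim_closed) auto
    have "P k u k v ys \<in> rcenter Q" if "k \<in> I \<inter> J" "u \<le> a" "v \<le> b" for k u v ys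
      unfolding P_def using pC that
      by (intro descend_in[where D = center] zero_rcenter)
        (auto simp: rcenter_iff center_def emb_preim preim_closed)
    then show "lam k u v ys \<in> rcenter Q" if "u \<le> a" "v \<le> b" for k u v ys
      using that zero_rcenter by (simp add: lam_def)
    show "lam k u v ys = \<zero>" if "k \<notin> I \<inter> J" for k u v ys
      unfolding lam_def using that by (rule if_not_P)
  qed (fact eqE eqF)+
qed

lemma t_std_sol_if_only_std:
  assumes only: "fi.only_std I J a b" and IJ: "I \<subseteq> {..<m}" "J \<subseteq> {..<m}"
    and E: "\<forall>i\<in>I. \<forall>u\<le>a. maps_into R (m - 1) (E i u) (carrier Q)"
    and F: "\<forall>j\<in>J. \<forall>v\<le>b. maps_into R (m - 1) (F j v) (carrier Q)"
    and id: "\<forall>xs\<in>lists R. length xs = m \<longrightarrow> tFI_expr Q t a b I J E F xs = \<zero>"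
  shows "t_std_sol Q R t a b m I J E F"
proof (rule standard_solution[OF only IJ E F])
  show "(\<Sum>i\<in>I. \<Sum>u\<le>a. \<phi> (E i u (omit {i} xs)) * (Rt ^^ u) (\<phi> (xs ! i)))
      + (\<Sum>j\<in>J. \<Sum>v\<le>b. (L ^^ v) (\<phi> (xs ! j)) * \<phi> (F j v (omit {j} xs))) = 0"
    if "xs \<in> lists R" "length xs = m" for xs
    using rel_tFI_expr[OF that IJ E F] id that by (simp add: rel_def zero)
  fix P lam
  assume P: "\<And>i u j v ys. i \<in> I \<Longrightarrow> u \<le> a \<Longrightarrow> j \<in> J \<Longrightarrow> v \<le> b \<Longrightarrow> P i u j v ys \<in> carrier Q"
    and lam: "\<And>k u v ys. u \<le> a \<Longrightarrow> v \<le> b \<Longrightarrow> lam k u v ys \<in> rcenter Q"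
    and lam0: "\<And>k u v ys. k \<notin> I \<inter> J \<Longrightarrow> lam k u v ys = \<zero>"
    and eqE: "\<And>xs i u. xs \<in> lists R \<Longrightarrow> length xs = m \<Longrightarrow> i \<in> I \<Longrightarrow> u \<le> a \<Longrightarrow> \<phi> (E i u (omit {i} xs)) =
      (\<Sum>j\<in>J - {i}. \<Sum>v\<le>b. (L ^^ v) (\<phi> (xs ! j)) * \<phi> (P i u j v (omit {i, j} xs)))
      + (\<Sum>v\<le>b. (Rt ^^ v) (\<phi> (lam i u v (omit {i} xs))))"
    and eqF: "\<And>xs j v. xs \<in> lists R \<Longrightarrow> length xs = m \<Longrightarrow> j \<in> J \<Longrightarrow> v \<le> b \<Longrightarrow> \<phi> (F j v (omit {j} xs)) =
      - (\<Sum>i\<in>I - {j}. \<Sum>u\<le>a. \<phi> (P i u j v (omit {i, j} xs)) * (Rt ^^ u) (\<phi> (xs ! i)))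
      + - (\<Sum>u\<le>a. (Rt ^^ u) (\<phi> (lam j u v (omit {j} xs))))"
  have relP: "rel (P i u j v ys) (\<phi> (P i u j v ys))" if "i \<in> I" "u \<le> a" "j \<in> J" "v \<le> b" for i u j v ys
    using P[OF that] by (simp add: rel_def)
  have rel_lam: "rel (lam k u v ys) (\<phi> (lam k u v ys))" if "u \<le> a" "v \<le> b" for k u v ys
    using lam[OF that] by (simp add: rel_def rcenter_def)
  have 1: "E i u (omit {i} xs) =
      (\<Oplus>j\<in>J - {i}. \<Oplus>v\<in>{..b}. t [^] v \<otimes> xs ! j \<otimes> P i u j v (omit {i, j} xs))
      \<oplus> (\<Oplus>v\<in>{..b}. lam i u v (omit {i} xs) \<otimes> t [^] v)"
    if xs: "xs \<in> lists R" "length xs = m" and i: "i \<in> I" and u: "u \<le> a" for xs i u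
  proof (rule rel_unique)
    show "rel (E i u (omit {i} xs)) (\<phi> (E i u (omit {i} xs)))"
      using E i u IJ xs by (intro rel_omit[of m]) auto
    show "rel ((\<Oplus>j\<in>J - {i}. \<Oplus>v\<in>{..b}. t [^] v \<otimes> xs ! j \<otimes> P i u j v (omit {i, j} xs))
      \<oplus> (\<Oplus>v\<in>{..b}. lam i u v (omit {i} xs) \<otimes> t [^] v)) (\<phi> (E i u (omit {i} xs)))"
      unfolding eqE[OF xs i u]
      by (rule rel_add; (intro rel_sum)?; (rule rel_pow_right[OF rel_t rel_lam] rel_mult[OF rel_pow_left[OF rel_t rel_nth] relP])?)
        (use xs i u IJ in auto)
  qed
  have 2: "F j v (omit {j} xs) =
      (\<ominus> (\<Oplus>i\<in>I - {j}. \<Oplus>u\<in>{..a}. P i u j v (omit {i, j} xs) \<otimes> xs ! i \<otimes> t [^] u))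
      \<oplus> (\<ominus> (\<Oplus>u\<in>{..a}. lam j u v (omit {j} xs) \<otimes> t [^] u))"
    if xs: "xs \<in> lists R" "length xs = m" and j: "j \<in> J" and v: "v \<le> b" for xs j v
  proof (rule rel_unique)
    show "rel (F j v (omit {j} xs)) (\<phi> (F j v (omit {j} xs)))"
      using F j v IJ xs by (intro rel_omit[of m]) auto
    show "rel ((\<ominus> (\<Oplus>i\<in>I - {j}. \<Oplus>u\<in>{..a}. P i u j v (omit {i, j} xs) \<otimes> xs ! i \<otimes> t [^] u))
      \<oplus> (\<ominus> (\<Oplus>u\<in>{..a}. lam j u v (omit {j} xs) \<otimes> t [^] u))) (\<phi> (F j v (omit {j} xs)))"
      unfolding eqF[OF xs j v] fi.Rtn_mul[symmetric]
      by (intro rel_add rel_minus rel_sum rel_pow_right[OF rel_t] rel_lam rel_mult relP rel_nth)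
        (use xs j v IJ in auto)
  qed
  show ?thesis unfolding t_std_sol_def
    by (intro exI[of _ P] exI[of _ lam]) (use P lam lam0 1 2 in \<open>simp add: maps_into_def\<close>)
qed

lemma std_sol_if_only_std:
  assumes only: "fi.only_std I J 0 0" and IJ: "I \<subseteq> {..<m}" "J \<subseteq> {..<m}"
    and E: "\<forall>i\<in>I. maps_into R (m - 1) (E i) (carrier Q)"
    and F: "\<forall>j\<in>J. maps_into R (m - 1) (F j) (carrier Q)"
    and id: "\<forall>xs\<in>lists R. length xs = m \<longrightarrow> FI_expr Q I J E F xs = \<zero>"
  shows "std_sol Q R m I J E F"
proof (rule standard_solution[OF only IJ, of "\<lambda>i u. E i" "\<lambda>j v. F j"])
  show "(\<Sum>i\<in>I. \<Sum>u\<le>0. \<phi> (E i (omit {i} xs)) * (Rt ^^ u) (\<phi> (xs ! i)))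
      + (\<Sum>j\<in>J. \<Sum>v\<le>0. (L ^^ v) (\<phi> (xs ! j)) * \<phi> (F j (omit {j} xs))) = 0"
    if "xs \<in> lists R" "length xs = m" for xs
    using rel_FI_expr[OF that IJ E F] id that by (simp add: rel_def zero)
  fix P lam
  assume P: "\<And>i u j v ys. i \<in> I \<Longrightarrow> u \<le> 0 \<Longrightarrow> j \<in> J \<Longrightarrow> v \<le> 0 \<Longrightarrow> P i u j v ys \<in> carrier Q"
    and lam: "\<And>k u v ys. u \<le> 0 \<Longrightarrow> v \<le> 0 \<Longrightarrow> lam k u v ys \<in> rcenter Q"
    and lam0: "\<And>k u v ys. k \<notin> I \<inter> J \<Longrightarrow> lam k u v ys = \<zero>"
    and eqE: "\<And>xs i u. xs \<in> lists R \<Longrightarrow> length xs = m \<Longrightarrow> i \<in> I \<Longrightarrow> u \<le> 0 \<Longrightarrow> \<phi> (E i (omit {i} xs)) =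
      (\<Sum>j\<in>J - {i}. \<Sum>v\<le>0. (L ^^ v) (\<phi> (xs ! j)) * \<phi> (P i u j v (omit {i, j} xs)))
      + (\<Sum>v\<le>0. (Rt ^^ v) (\<phi> (lam i u v (omit {i} xs))))"
    and eqF: "\<And>xs j v. xs \<in> lists R \<Longrightarrow> length xs = m \<Longrightarrow> j \<in> J \<Longrightarrow> v \<le> 0 \<Longrightarrow> \<phi> (F j (omit {j} xs)) =
      - (\<Sum>i\<in>I - {j}. \<Sum>u\<le>0. \<phi> (P i u j v (omit {i, j} xs)) * (Rt ^^ u) (\<phi> (xs ! i)))
      + - (\<Sum>u\<le>0. (Rt ^^ u) (\<phi> (lam j u v (omit {j} xs))))"
  have relP: "rel (P i 0 j 0 ys) (\<phi> (P i 0 j 0 ys))" if "i \<in> I" "j \<in> J" for i j ys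
    using P[OF that(1) _ that(2)] by (simp add: rel_def)
  have rel_lam: "rel (lam k 0 0 ys) (\<phi> (lam k 0 0 ys))" for k ys
    using lam by (simp add: rel_def rcenter_def)
  have 1: "E i (omit {i} xs) = (\<Oplus>j\<in>J - {i}. xs ! j \<otimes> P i 0 j 0 (omit {i, j} xs)) \<oplus> lam i 0 0 (omit {i} xs)"
    if xs: "xs \<in> lists R" "length xs = m" and i: "i \<in> I" for xs i
  proof (rule rel_unique)
    show "rel (E i (omit {i} xs)) (\<phi> (E i (omit {i} xs)))"
      using E i IJ xs by (intro rel_omit[of m]) auto
    have eq: "\<phi> (E i (omit {i} xs)) =
      (\<Sum>j\<in>J - {i}. \<phi> (xs ! j) * \<phi> (P i 0 j 0 (omit {i, j} xs))) + \<phi> (lam i 0 0 (omit {i} xs))"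
      using eqE[OF xs i order.refl] by simp
    show "rel ((\<Oplus>j\<in>J - {i}. xs ! j \<otimes> P i 0 j 0 (omit {i, j} xs)) \<oplus> lam i 0 0 (omit {i} xs)) (\<phi> (E i (omit {i} xs)))"
      unfolding eq by (intro rel_add rel_sum rel_mult rel_lam relP rel_nth) (use xs i IJ in auto)
  qed
  have 2: "F j (omit {j} xs) = (\<ominus> (\<Oplus>i\<in>I - {j}. P i 0 j 0 (omit {i, j} xs) \<otimes> xs ! i)) \<oplus> (\<ominus> lam j 0 0 (omit {j} xs))"
    if xs: "xs \<in> lists R" "length xs = m" and j: "j \<in> J" for xs j
  proof (rule rel_unique)
    show "rel (F j (omit {j} xs)) (\<phi> (F j (omit {j} xs)))"
      using F j IJ xs by (intro rel_omit[of m]) auto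
    have eq: "\<phi> (F j (omit {j} xs)) =
      - (\<Sum>i\<in>I - {j}. \<phi> (P i 0 j 0 (omit {i, j} xs)) * \<phi> (xs ! i)) + - \<phi> (lam j 0 0 (omit {j} xs))"
      using eqF[OF xs j order.refl] by simp
    show "rel ((\<ominus> (\<Oplus>i\<in>I - {j}. P i 0 j 0 (omit {i, j} xs) \<otimes> xs ! i)) \<oplus> (\<ominus> lam j 0 0 (omit {j} xs))) (\<phi> (F j (omit {j} xs)))"
      unfolding eq by (intro rel_add rel_minus rel_sum rel_mult rel_lam relP rel_nth) (use xs j IJ in auto)
  qed
  show ?thesis unfolding std_sol_def
    by (intro exI[of _ "\<lambda>i j. P i 0 j 0"] exI[of _ "\<lambda>k. lam k 0 0"])
      (use P lam lam0 1 2 in \<open>simp add: maps_into_def\<close>)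
qed (use E F in auto)

text \<open>\<open>E i\<close> ignores \<open>x\<^sub>i\<close>, so its summand is equivariant under
  right multiplication of \<open>x\<^sub>i\<close> by \<open>M\<close>, and dually for
  \<open>F j\<close> and \<open>N\<close>. The central value itself is the family
  \<open>\<theta>\<close>, with \<open>r = s = 0\<close>.\<close>

lemma FI_zero_if_only_zero:
  assumes "commuting_shifts ((*) N) (\<lambda>x. x * M) (\<phi> ` R) center"
    and only: "commuting_shifts.only_zero ((*) N) (\<lambda>x. x * M) (\<phi> ` R) center I J 0 0"
    and IJ: "I \<subseteq> {..<m}" "J \<subseteq> {..<m}"
    and E: "\<forall>i\<in>I. maps_into R (m - 1) (E i) (carrier Q)"
    and F: "\<forall>j\<in>J. maps_into R (m - 1) (F j) (carrier Q)"
    and id: "\<forall>xs\<in>lists R. length xs = m \<longrightarrow> FI_expr Q I J E F xs \<in> rcenter Q"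
    and xs: "xs \<in> lists R" "length xs = m"
  shows "FI_expr Q I J E F xs = \<zero>"
proof (rule eqI)
  interpret sh: commuting_shifts "(*) N" "\<lambda>x. x * M" "\<phi> ` R" center by fact
  have X: "sh.X = fi.X" unfolding sh.X_def fi.X_def by simp
  define g where "g i x = \<phi> (E i (omit {i} (lst m x))) * x i" for i x
  define f where "f j x = x j * \<phi> (F j (omit {j} (lst m x)))" for j x
  define \<theta> :: "nat \<Rightarrow> nat \<Rightarrow> (nat \<Rightarrow> 'q) \<Rightarrow> 'q" where "\<theta> r s x = \<phi> (FI_expr Q I J E F (lst m x))" for r s x
  have "\<theta> 0 0 (fn xs) = 0"
  proof (rule sh.only_zeroD[OF only, where g = g and f = f and \<theta> = \<theta>])
    show "g i (x(i := x i * M)) = g i x * M" for i x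
      by (simp add: g_def omit_lst_upd mult.assoc)
    show "f j (x(j := N * x j)) = N * f j x" for j x
      by (simp add: f_def omit_lst_upd mult.assoc)
    show "\<theta> r s x \<in> center" if "x \<in> sh.X" for r s x
      using id lst_R[of x m] that by (simp add: \<theta>_def rcenter_iff X)
    show "fn xs \<in> sh.X" using fn_X[OF xs(1)] by (simp add: X)
    fix x assume "x \<in> sh.X"
    then have x: "x \<in> fi.X" by (simp add: X)
    have "\<theta> 0 0 x = (\<Sum>i\<in>I. g i x) + (\<Sum>j\<in>J. f j x)"
      unfolding \<theta>_def g_def f_def rel_FI_expr[OF lst_R[OF x] length_lst IJ E F, unfolded rel_def, THEN conjunct2]
      using IJ x by (intro arg_cong2[of _ _ _ _ "(+)"] sum.cong refl) (auto simp: emb_nth_lst simp del: nth_lst)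
    then show "(\<Sum>i\<in>I. g i x) + (\<Sum>j\<in>J. f j x) = (\<Sum>r\<le>0. \<Sum>s\<le>0. ((*) N ^^ r) (((\<lambda>x. x * M) ^^ s) (\<theta> r s x)))"
      by simp
  qed simp_all
  then show "\<phi> (FI_expr Q I J E F xs) = \<phi> \<zero>" using lst_fn[OF xs(1)] xs(2) by (simp add: \<theta>_def zero)
  show "FI_expr Q I J E F xs \<in> carrier Q" using rel_FI_expr[OF xs IJ E F] by (simp add: rel_def)
qed simp

end

section \<open>The tensor product as a quotient\<close>

abbreviation "single \<equiv> Poly_Mapping.single"
abbreviation "lookup \<equiv> Poly_Mapping.lookup"
abbreviation "keys \<equiv> Poly_Mapping.keys"

text \<open>Additive extension from the basis of the free space. The coefficient is an argument of
  \<open>G\<close>, so that \<open>ractV\<close>, \<open>TmapV\<close> and \<open>pair\<close> are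
  all instances.\<close>

definition lext :: "('k \<Rightarrow> 'c::zero \<Rightarrow> 'b::comm_monoid_add) \<Rightarrow> ('k \<Rightarrow>\<^sub>0 'c) \<Rightarrow> 'b" where
  "lext G x = (\<Sum>p\<in>keys x. G p (lookup x p))"

lemma lext_superset:
  assumes "\<And>p. G p 0 = 0" "finite K" "keys x \<subseteq> K"
  shows "lext G x = (\<Sum>p\<in>K. G p (lookup x p))"
  unfolding lext_def
  by (rule sum.mono_neutral_left) (use assms in \<open>auto simp: in_keys_iff\<close>)

lemma lext_add:
  assumes "\<And>p. G p 0 = 0" "\<And>p a b. G p (a + b) = G p a + G p b"
  shows "lext G (x + y) = lext G x + lext G y"
proof -
  let ?K = "keys x \<union> keys y"
  have "lext G (x + y) = (\<Sum>p\<in>?K. G p (lookup (x + y) p))"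
    by (rule lext_superset) (use assms Poly_Mapping.keys_add[of x y] in auto)
  also have "\<dots> = (\<Sum>p\<in>?K. G p (lookup x p)) + (\<Sum>p\<in>?K. G p (lookup y p))"
    by (simp add: lookup_add assms(2) sum.distrib)
  also have "(\<Sum>p\<in>?K. G p (lookup x p)) = lext G x"
    by (rule lext_superset[symmetric]) (use assms in auto)
  also have "(\<Sum>p\<in>?K. G p (lookup y p)) = lext G y"
    by (rule lext_superset[symmetric]) (use assms in auto)
  finally show ?thesis .
qed

lemma lext_single: "(\<And>p. G p 0 = 0) \<Longrightarrow> lext G (single p c) = G p c"
  by (cases "c = 0") (simp_all add: lext_def)

lemma poly_mapping_sum_single:
  "x = (\<Sum>p\<in>keys x. single p (lookup x p))"
proof (rule poly_mapping_eqI)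
  fix k
  have "(\<Sum>p\<in>keys x. lookup (single p (lookup x p)) k)
     = (\<Sum>p\<in>keys x. if p = k then lookup x k else 0)"
    by (intro sum.cong refl) (auto simp: lookup_single when_def)
  also have "\<dots> = lookup x k" by (simp add: in_keys_iff)
  finally show "lookup x k
    = lookup (\<Sum>p\<in>keys x. single p (lookup x p)) k"
    by (simp add: lookup_sum)
qed

lemma lookup_vscale: "lookup (vscale c x) p = c * lookup x p"
  by (simp add: vscale_def Poly_Mapping.map.rep_eq when_def)

lemma vscale_single: "vscale c (single p a) = single p (c * a)"
  by (rule poly_mapping_eqI) (simp add: lookup_vscale lookup_single when_def)

lemma vector_space_vscale: "vector_space (vscale :: 'f::field \<Rightarrow> ('a \<Rightarrow>\<^sub>0 'f) \<Rightarrow> _)"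
  by unfold_locales (auto intro!: poly_mapping_eqI simp: lookup_vscale lookup_add algebra_simps)

lemma lext_single_vscale:
  fixes g :: "'a \<Rightarrow> 'b" and k :: "'f::field"
  shows "lext (\<lambda>p c. single (g p) c) (vscale k x) = vscale k (lext (\<lambda>p c. single (g p) c) x)"
proof -
  interpret M: vector_space "vscale :: 'f \<Rightarrow> ('b \<Rightarrow>\<^sub>0 'f) \<Rightarrow> _" by (rule vector_space_vscale)
  have "keys (vscale k x) \<subseteq> keys x" by (auto simp: in_keys_iff lookup_vscale)
  then have "lext (\<lambda>p c. single (g p) c) (vscale k x)
    = (\<Sum>p\<in>keys x. single (g p) (k * lookup x p))"
    by (subst lext_superset[where K = "keys x"]) (auto simp: lookup_vscale)
  also have "\<dots> = vscale k (lext (\<lambda>p c. single (g p) c) x)"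
    by (simp add: lext_def M.scale_sum_right vscale_single)
  finally show ?thesis .
qed

lemma additive_diff:
  assumes "\<And>x y. f (x + y) = f x + f y" shows "f (x - y :: 'a::ab_group_add) = f x - (f y :: 'b::ab_group_add)"
  using assms[of "x - y" y] by (simp add: algebra_simps)

type_synonym ('u, 'h, 'f) pretensor = "('u \<times> 'h) \<Rightarrow>\<^sub>0 'f"

locale tensor_setup =
  fixes scaleU :: "'f::field \<Rightarrow> 'u::ab_group_add \<Rightarrow> 'u" and scaleH :: "'f \<Rightarrow> 'h::ring_1 \<Rightarrow> 'h"
  assumes U_vs: "vector_space scaleU" and H_vs: "vector_space scaleH"
    and H_left: "scaleH c (x * y) = scaleH c x * y" and H_right: "scaleH c (x * y) = x * scaleH c y"
begin

interpretation U: vector_space scaleU by (rule U_vs)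
interpretation H: vector_space scaleH by (rule H_vs)

abbreviation linop :: "('u \<Rightarrow> 'u) \<Rightarrow> bool" where "linop \<equiv> Vector_Spaces.linear scaleU scaleU"
abbreviation N :: "('u, 'h, 'f) pretensor set" where "N \<equiv> tensN scaleU scaleH"
abbreviation cls :: "('u, 'h, 'f) pretensor \<Rightarrow> ('u, 'h, 'f) pretensor set" where "cls \<equiv> tclass scaleU scaleH"
abbreviation UHs :: "('u, 'h, 'f) pretensor set set" where "UHs \<equiv> UH scaleU scaleH"

lemma N_uminus: "x \<in> N \<Longrightarrow> - x \<in> N"
proof -
  assume "x \<in> N"
  then have "vscale (-1) x \<in> N" by (rule tensN.smul)
  moreover have "vscale (-1) x = - x" by (rule poly_mapping_eqI) (simp add: lookup_vscale)
  ultimately show ?thesis by simp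
qed

lemma N_diff: "x \<in> N \<Longrightarrow> y \<in> N \<Longrightarrow> x - y \<in> N"
  using tensN.sum[of x scaleU scaleH "- y"] N_uminus[of y] by simp

text \<open>Extend a basis of the subspace of relations to the whole free space, kill the former and
  fix the added vectors. The range is then a complement that is isomorphic to the quotient and gives
  additive representatives of the classes.\<close>

lemma ex_projector:
  "\<exists>\<pi>. (\<forall>x y. \<pi> (x + y) = \<pi> x + \<pi> y) \<and> (\<forall>x\<in>N. \<pi> x = 0) \<and> (\<forall>x. x - \<pi> x \<in> N)"
proof -
  interpret M: vector_space "vscale :: 'f \<Rightarrow> ('u, 'h, 'f) pretensor \<Rightarrow> _" by (rule vector_space_vscale)
  interpret P: vector_space_pair "vscale :: 'f \<Rightarrow> ('u, 'h, 'f) pretensor \<Rightarrow> _" "vscale :: 'f \<Rightarrow> ('u, 'h, 'f) pretensor \<Rightarrow> _"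
    by unfold_locales
  obtain B where B: "B \<subseteq> N" "M.independent B" "N \<subseteq> M.span B"
    using M.maximal_independent_subset[of N] by blast
  obtain B' where B': "B \<subseteq> B'" "B' \<subseteq> UNIV" "M.independent B'" "UNIV \<subseteq> M.span B'"
    by (rule M.maximal_independent_subset_extend[OF subset_UNIV B(2)])
  obtain g where g: "Vector_Spaces.linear vscale vscale g" "\<forall>x\<in>B'. g x = (if x \<in> B then 0 else x)"
    using P.linear_independent_extend[OF B'(3), of "\<lambda>x. if x \<in> B then 0 else x"] by (elim exE conjE) (rule that)
  interpret g: Vector_Spaces.linear vscale vscale g by (rule g(1))
  have "g x = 0" if "x \<in> N" for x
  proof -
    have "x \<in> M.span B" using that B(3) by blast
    then show ?thesis
      by (induction rule: M.span_induct_alt) (use g(2) B'(1) in \<open>auto simp: g.add g.scale\<close>)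
  qed
  moreover have "x - g x \<in> N" for x
  proof -
    have "x \<in> M.span B'" using B'(4) by blast
    then show ?thesis
    proof (induction rule: M.span_induct_alt)
      case base
      show ?case by (simp add: tensN.zero)
    next
      case (step c x y)
      have "x - g x \<in> N" using g(2) step.hyps B(1) by (auto simp: tensN.zero)
      then have "vscale c (x - g x) + (y - g y) \<in> N" using step.IH by (intro tensN.sum tensN.smul)
      then show ?case by (simp add: g.add g.scale M.scale_right_diff_distrib algebra_simps)
    qed
  qed
  ultimately show ?thesis using g.add by blast
qed

definition pr :: "('u, 'h, 'f) pretensor \<Rightarrow> ('u, 'h, 'f) pretensor" where
  "pr = (SOME \<pi>. (\<forall>x y. \<pi> (x + y) = \<pi> x + \<pi> y) \<and> (\<forall>x\<in>N. \<pi> x = 0) \<and> (\<forall>x. x - \<pi> x \<in> N))"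

lemma pr_add: "pr (x + y) = pr x + pr y" and pr_N: "x \<in> N \<Longrightarrow> pr x = 0" and pr_cong: "x - pr x \<in> N"
  using someI_ex[OF ex_projector] unfolding pr_def[symmetric] by blast+

lemma pr_diff: "pr (x - y) = pr x - pr y" by (rule additive_diff) (rule pr_add)
lemma pr_0 [simp]: "pr 0 = 0" by (rule pr_N) (rule tensN.zero)
lemma pr_pr [simp]: "pr (pr x) = pr x" using pr_N[OF pr_cong[of x]] by (simp add: pr_diff)
lemma pr_eq: "x - y \<in> N \<Longrightarrow> pr x = pr y" using pr_N[of "x - y"] by (simp add: pr_diff)

lemma cls_eq_iff: "cls x = cls y \<longleftrightarrow> x - y \<in> N"
proof
  assume "cls x = cls y"
  then have "y \<in> cls x" by (simp add: tclass_def tensN.zero)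
  then show "x - y \<in> N" by (simp add: tclass_def)
next
  assume xy: "x - y \<in> N"
  have "x - z \<in> N \<longleftrightarrow> y - z \<in> N" for z
    using N_diff[OF _ xy, of "x - z"] tensN.sum[OF xy, of "y - z"] by auto
  then show "cls x = cls y" by (auto simp: tclass_def)
qed

lemma cls_pr [simp]: "cls (pr x) = cls x"
  using pr_cong[of x] cls_eq_iff[of x "pr x"] by simp

lemma cadd_cls: "cadd (cls x) (cls y) = cls (x + y)"
proof (rule Set.set_eqI)
  fix z
  have "\<exists>x' y'. z = x' + y' \<and> x - x' \<in> N \<and> y - y' \<in> N" if "x + y - z \<in> N"
    by (rule exI[of _ x], rule exI[of _ "z - x"]) (use that in \<open>simp add: tensN.zero algebra_simps\<close>)
  moreover have "x + y - (x' + y') \<in> N" if "x - x' \<in> N" "y - y' \<in> N" for x' y'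
    using tensN.sum[OF that] by (simp add: algebra_simps)
  ultimately show "z \<in> cadd (cls x) (cls y) \<longleftrightarrow> z \<in> cls (x + y)"
    unfolding cadd_def tclass_def by blast
qed

lemma cls_UH [simp]: "cls x \<in> UHs" by (simp add: UH_def)

definition rep :: "('u, 'h, 'f) pretensor set \<Rightarrow> ('u, 'h, 'f) pretensor" where
  "rep X = pr (SOME x. x \<in> X)"

lemma rep_cls [simp]: "rep (cls x) = pr x"
proof -
  have "x \<in> cls x" by (simp add: tclass_def tensN.zero)
  then have "(SOME y. y \<in> cls x) \<in> cls x" by (rule someI)
  then have "x - (SOME y. y \<in> cls x) \<in> N" by (simp add: tclass_def)
  from pr_eq[OF this] show ?thesis by (simp add: rep_def)
qed

lemma cls_rep [simp]: "X \<in> UHs \<Longrightarrow> cls (rep X) = X"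
  by (auto simp: UH_def)

lemma pr_rep [simp]: "X \<in> UHs \<Longrightarrow> pr (rep X) = rep X"
  by (auto simp: UH_def)

text \<open>Rule induction on the relations for an additive map. The target \<open>K\<close> is the
  set of relations again for \<open>ractV\<close> and \<open>TmapV\<close>, and \<open>{0}\<close>
  for \<open>pair\<close>.\<close>

lemma tensN_map:
  assumes "x \<in> N" and add: "\<And>x y. f (x + y) = f x + f y"
    and gens: "\<And>u u' h. f (single (u + u', h) 1) - f (single (u, h) 1) - f (single (u', h) 1) \<in> K"
      "\<And>u h h'. f (single (u, h + h') 1) - f (single (u, h) 1) - f (single (u, h') 1) \<in> K"
      "\<And>u h c. f (single (scaleU c u, h) 1) - f (single (u, h) c) \<in> K"
      "\<And>u h c. f (single (u, scaleH c h) 1) - f (single (u, h) c) \<in> K"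
    and K: "0 \<in> K" "\<And>x y. x \<in> K \<Longrightarrow> y \<in> K \<Longrightarrow> x + y \<in> K" "\<And>c x. f x \<in> K \<Longrightarrow> f (vscale c x) \<in> K"
  shows "(f x :: 'b::ab_group_add) \<in> K"
proof -
  have diff: "f (x - y) = f x - f y" for x y by (rule additive_diff) (rule add)
  have f0: "f 0 = 0" using diff[of 0 0] by simp
  show ?thesis using assms(1)
    by induction (auto simp: f0 diff gens K add)
qed

lemma ractV_lext: "ractV x h = lext (\<lambda>p c. single (fst p, snd p * h) c) x"
  by (simp add: ractV_def lext_def)
lemma TmapV_lext: "TmapV a h x = lext (\<lambda>p c. single (a (fst p), h * snd p) c) x"
  by (simp add: TmapV_def lext_def)

lemma ractV_add: "ractV (x + y) h = ractV x h + ractV y h"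
  and TmapV_add: "TmapV a h (x + y) = TmapV a h x + TmapV a h y"
  unfolding ractV_lext TmapV_lext by (rule lext_add; simp add: single_add)+

lemma ractV_single [simp]: "ractV (single (u, k) c) h = single (u, k * h) c"
  and TmapV_single [simp]: "TmapV a h (single (u, k) c) = single (a u, h * k) c"
  unfolding ractV_lext TmapV_lext by (simp_all add: lext_single)

lemma ractV_vscale: "ractV (vscale c x) h = vscale c (ractV x h)"
  and TmapV_vscale: "TmapV a h (vscale c x) = vscale c (TmapV a h x)"
  unfolding ractV_lext TmapV_lext by (rule lext_single_vscale)+

lemma ractV_N: "x \<in> N \<Longrightarrow> ractV x h \<in> N"
  by (rule tensN_map[where f = "\<lambda>x. ractV x h"])
    (simp_all add: ractV_add ractV_vscale distrib_right H_left[symmetric] tensN.intros)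

lemma TmapV_N:
  assumes "linop a" "x \<in> N" shows "TmapV a h x \<in> N"
proof -
  interpret a: Vector_Spaces.linear scaleU scaleU a by (rule assms(1))
  show ?thesis using assms(2)
    by (rule tensN_map[where f = "TmapV a h"])
      (simp_all add: TmapV_add TmapV_vscale distrib_left H_right[symmetric] a.add a.scale tensN.intros)
qed

lemma ractV_cong: "x - y \<in> N \<Longrightarrow> ractV x h - ractV y h \<in> N"
proof -
  assume "x - y \<in> N"
  moreover have "ractV (x - y) h = ractV x h - ractV y h" by (rule additive_diff) (rule ractV_add)
  ultimately show ?thesis using ractV_N[of "x - y" h] by simp
qed

lemma TmapV_cong: "linop a \<Longrightarrow> x - y \<in> N \<Longrightarrow> TmapV a h x - TmapV a h y \<in> N"
proof -
  assume "linop a" "x - y \<in> N"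
  moreover have "TmapV a h (x - y) = TmapV a h x - TmapV a h y" by (rule additive_diff) (rule TmapV_add)
  ultimately show ?thesis using TmapV_N[of a "x - y" h] by simp
qed

lemma ract_cls: "ract scaleU scaleH (cls x) h = cls (ractV x h)"
proof -
  have "cls (ractV y h) = cls (ractV x h)" if "y \<in> cls x" for y
  proof -
    have "x - y \<in> N" using that by (simp add: tclass_def)
    then have "cls (ractV x h) = cls (ractV y h)" unfolding cls_eq_iff by (rule ractV_cong)
    then show ?thesis by simp
  qed
  moreover have "x \<in> cls x" by (simp add: tclass_def tensN.zero)
  ultimately show ?thesis unfolding ract_def by blast
qed

lemma Tmap_cls:
  assumes "linop a"
  shows "Tmap scaleU scaleH a h (cls x) = cls (TmapV a h x)"
proof -
  have "cls (TmapV a h y) = cls (TmapV a h x)" if "y \<in> cls x" for y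
  proof -
    have "x - y \<in> N" using that by (simp add: tclass_def)
    then have "cls (TmapV a h x) = cls (TmapV a h y)" unfolding cls_eq_iff by (rule TmapV_cong[OF assms])
    then show ?thesis by simp
  qed
  moreover have "x \<in> cls x" by (simp add: tclass_def tensN.zero)
  ultimately have "(\<Union>y\<in>cls x. cls (TmapV a h y)) = cls (TmapV a h x)" by blast
  then show ?thesis unfolding Tmap_def by simp
qed

lemma UH_cases: "X \<in> UHs \<Longrightarrow> (\<And>x. X = cls x \<Longrightarrow> P) \<Longrightarrow> P"
  by (auto simp: UH_def)

text \<open>\<open>Q\<close> acts on the complement \<open>range pr\<close> of \<open>tensN\<close>, extended by zero on \<open>tensN\<close>; this turns it into a
  subring (with a different identity, namely \<open>pr\<close>) of a ring in the type class sense.\<close>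
definition emb :: "(('u, 'h, 'f) pretensor set \<Rightarrow> ('u, 'h, 'f) pretensor set) \<Rightarrow> ('u, 'h, 'f) pretensor aend" where
  "emb F = Aend (\<lambda>z. rep (F (cls z)))"

definition rho :: "'h \<Rightarrow> ('u, 'h, 'f) pretensor \<Rightarrow> ('u, 'h, 'f) pretensor" where "rho h z = pr (ractV z h)"

definition Qs :: "('u, 'h, 'f) pretensor aend set" where
  "Qs = {q. (\<forall>z. app q z \<in> range pr) \<and> (\<forall>z. app q (pr z) = app q z) \<and>
      (\<forall>z\<in>range pr. \<forall>h. app q (rho h z) = rho h (app q z))}"

lemma Qset_UH: "F \<in> Qset scaleU scaleH \<Longrightarrow> X \<in> UHs \<Longrightarrow> F X \<in> UHs"
  and Qset_cadd: "F \<in> Qset scaleU scaleH \<Longrightarrow> X \<in> UHs \<Longrightarrow> Y \<in> UHs \<Longrightarrow> F (cadd X Y) = cadd (F X) (F Y)"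
  and Qset_ract: "F \<in> Qset scaleU scaleH \<Longrightarrow> X \<in> UHs \<Longrightarrow> F (ract scaleU scaleH X h) = ract scaleU scaleH (F X) h"
  and Qset_undef: "F \<in> Qset scaleU scaleH \<Longrightarrow> X \<notin> UHs \<Longrightarrow> F X = undefined"
  by (auto simp: Qset_def)

lemma rep_cadd: "X \<in> UHs \<Longrightarrow> Y \<in> UHs \<Longrightarrow> rep (cadd X Y) = rep X + rep Y"
  by (auto elim!: UH_cases simp: cadd_cls pr_add)

lemma rep_ract: "X \<in> UHs \<Longrightarrow> rep (ract scaleU scaleH X h) = rho h (rep X)"
proof (elim UH_cases)
  fix x assume "X = cls x"
  moreover have "pr (ractV x h) = pr (ractV (pr x) h)" by (intro pr_eq ractV_cong pr_cong)
  ultimately show ?thesis by (simp add: ract_cls rho_def)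
qed

lemma app_emb:
  assumes "F \<in> Qset scaleU scaleH" shows "app (emb F) z = rep (F (cls z))"
proof -
  have "app (emb F) = (\<lambda>z. rep (F (cls z)))" unfolding emb_def
    by (rule Aend_inverse)
      (simp add: cadd_cls[symmetric] Qset_cadd[OF assms] rep_cadd Qset_UH[OF assms])
  then show ?thesis by simp
qed

lemma emb_Qs:
  assumes "F \<in> Qset scaleU scaleH" shows "emb F \<in> Qs"
  unfolding Qs_def
proof (intro CollectI conjI allI ballI)
  show "app (emb F) z \<in> range pr" for z
    using pr_rep[OF Qset_UH[OF assms cls_UH[of z]]] by (metis app_emb[OF assms] rangeI)
  show "app (emb F) (pr z) = app (emb F) z" for z by (simp add: app_emb[OF assms])
  show "app (emb F) (rho h z) = rho h (app (emb F) z)" for z h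
    by (simp add: app_emb[OF assms] rho_def[of h z] ract_cls[symmetric] Qset_ract[OF assms]
        rep_ract Qset_UH[OF assms])
qed

lemma emb_inj: "inj_on emb (Qset scaleU scaleH)"
proof (rule inj_onI, rule ext)
  fix F G X assume F: "F \<in> Qset scaleU scaleH" and G: "G \<in> Qset scaleU scaleH" and eq: "emb F = emb G"
  show "F X = G X"
  proof (cases "X \<in> UHs")
    case True
    have "F X = cls (rep (F X))" by (rule cls_rep[OF Qset_UH[OF F True], symmetric])
    also have "rep (F X) = rep (G X)"
      using app_emb[OF F, of "rep X"] app_emb[OF G, of "rep X"] eq True by simp
    also have "cls (rep (G X)) = G X" by (rule cls_rep[OF Qset_UH[OF G True]])
    finally show ?thesis .
  qed (simp add: Qset_undef F G)
qed

lemma rho_add: "rho k (x + y) = rho k x + rho k y"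
  by (simp add: rho_def ractV_add pr_add)

lemma emb_img: "emb ` Qset scaleU scaleH = Qs"
proof
  show "emb ` Qset scaleU scaleH \<subseteq> Qs" using emb_Qs by blast
  show "Qs \<subseteq> emb ` Qset scaleU scaleH"
  proof
    fix q assume q: "q \<in> Qs"
    define F where "F X = (if X \<in> UHs then cls (app q (rep X)) else undefined)" for X
    have Fc: "F (cls z) = cls (app q z)" for z
      using q by (simp add: F_def Qs_def)
    have F: "F \<in> Qset scaleU scaleH"
      unfolding Qset_def
    proof (intro CollectI conjI ballI allI impI)
      show "F X \<in> UHs" if "X \<in> UHs" for X using that by (simp add: F_def)
      show "F (cadd X Y) = cadd (F X) (F Y)" if "X \<in> UHs" "Y \<in> UHs" for X Y
        using that by (elim UH_cases) (simp add: cadd_cls Fc app_add)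
      show "F (ract scaleU scaleH X h) = ract scaleU scaleH (F X) h" if "X \<in> UHs" for X h
      proof -
        from that obtain x where x: "X = cls x" by (rule UH_cases)
        have X: "X = cls (pr x)" using x by simp
        have "F (ract scaleU scaleH X h) = cls (app q (pr (ractV (pr x) h)))"
          unfolding X ract_cls Fc using q by (simp add: Qs_def)
        also have "\<dots> = cls (rho h (app q (pr x)))" using q by (simp add: Qs_def rho_def[symmetric])
        also have "\<dots> = ract scaleU scaleH (F X) h" unfolding X Fc by (simp add: rho_def ract_cls)
        finally show ?thesis .
      qed
      show "F X = undefined" if "X \<notin> UHs" for X using that by (simp add: F_def)
    qed
    have "emb F = q"
    proof (rule aend_eqI)
      fix z
      have "app q z \<in> range pr" using q by (simp add: Qs_def)
    then obtain y where "app q z = pr y" by blast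
      then show "app (emb F) z = app q z" by (simp add: app_emb[OF F] Fc)
    qed
    then show "q \<in> emb ` Qset scaleU scaleH" using F by blast
  qed
qed

lemma cadd_UH: "X \<in> UHs \<Longrightarrow> Y \<in> UHs \<Longrightarrow> cadd X Y \<in> UHs"
  by (auto elim!: UH_cases simp: cadd_cls)
lemma ract_UH: "X \<in> UHs \<Longrightarrow> ract scaleU scaleH X h \<in> UHs"
  by (auto elim!: UH_cases simp: ract_cls)

lemma Tmap_Qset:
  assumes a: "linop a" shows "Tmap scaleU scaleH a h \<in> Qset scaleU scaleH"
  unfolding Qset_def
proof (intro CollectI conjI ballI allI impI)
  have com: "TmapV a h (ractV x k) = ractV (TmapV a h x) k" for x k
  proof -
    have T0: "TmapV a h 0 = 0" and r0: "ractV 0 k = 0" by (simp_all add: TmapV_def ractV_def)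
    have "TmapV a h (ractV (\<Sum>p\<in>K. single p (c p)) k) = ractV (TmapV a h (\<Sum>p\<in>K. single p (c p))) k"
      if "finite K" for K c
      using that by (induction K) (auto simp: T0 r0 ractV_add TmapV_add mult.assoc)
    from this[of "keys x" "lookup x"] poly_mapping_sum_single[of x]
    show ?thesis by simp
  qed
  show "Tmap scaleU scaleH a h X \<in> UHs" if "X \<in> UHs" for X
    using that by (auto elim!: UH_cases simp: Tmap_cls[OF a])
  show "Tmap scaleU scaleH a h (cadd X Y) = cadd (Tmap scaleU scaleH a h X) (Tmap scaleU scaleH a h Y)"
    if "X \<in> UHs" "Y \<in> UHs" for X Y
    using that by (auto elim!: UH_cases simp: Tmap_cls[OF a] cadd_cls TmapV_add)
  show "Tmap scaleU scaleH a h (ract scaleU scaleH X k) = ract scaleU scaleH (Tmap scaleU scaleH a h X) k"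
    if "X \<in> UHs" for X k
    using that by (auto elim!: UH_cases simp: Tmap_cls[OF a] ract_cls com)
  show "Tmap scaleU scaleH a h X = undefined" if "X \<notin> UHs" for X using that by (simp add: Tmap_def)
qed

lemma Qs_uminus: "q \<in> Qs \<Longrightarrow> - q \<in> Qs"
proof -
  assume q: "q \<in> Qs"
  have m: "pr (- x) = - pr x" for x using pr_diff[of 0 x] by simp
  have "rho h (- z) = - rho h z" for h z using additive_diff[of "rho h", OF rho_add, of 0 z] rho_add[of h 0 0] by simp
  moreover have "- app q z \<in> range pr" for z
    using q m by (auto simp: Qs_def image_iff) (metis)
  ultimately show ?thesis using q by (simp add: Qs_def)
qed

text \<open>The identity of \<open>Qring\<close> goes to \<open>pr\<close>, which fixes the values
  of every map in \<open>Qs\<close> and disappears when such a map follows it.\<close>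

sublocale emb: ring_embedding "Qring scaleU scaleH" emb Qs
proof
  let ?Q = "Qring scaleU scaleH"
  have car: "carrier ?Q = Qset scaleU scaleH" by (simp add: Qring_def)
  show "inj_on emb (carrier ?Q)" unfolding car by (rule emb_inj)
  show "emb ` carrier ?Q = Qs" unfolding car by (rule emb_img)
  fix F G assume "F \<in> carrier ?Q" "G \<in> carrier ?Q"
  then have F: "F \<in> Qset scaleU scaleH" and G: "G \<in> Qset scaleU scaleH" by (auto simp: car)
  have caddc: "cadd (cadd X Y) (cadd X' Y') = cadd (cadd X X') (cadd Y Y')"
    if "X \<in> UHs" "Y \<in> UHs" "X' \<in> UHs" "Y' \<in> UHs" for X Y X' Y'
    using that by (elim UH_cases) (simp add: cadd_cls algebra_simps)
  have ractc: "ract scaleU scaleH (cadd X Y) h = cadd (ract scaleU scaleH X h) (ract scaleU scaleH Y h)"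
    if "X \<in> UHs" "Y \<in> UHs" for X Y h
    using that by (elim UH_cases) (simp add: cadd_cls ract_cls ractV_add)
  have FG: "F \<oplus>\<^bsub>?Q\<^esub> G = (\<lambda>X. if X \<in> UHs then cadd (F X) (G X) else undefined)" by (simp add: Qring_def)
  have FGQ: "F \<oplus>\<^bsub>?Q\<^esub> G \<in> Qset scaleU scaleH"
    unfolding FG Qset_def
    by (auto simp: cadd_UH ract_UH Qset_UH F G Qset_cadd[OF F] Qset_cadd[OF G] Qset_ract[OF F] Qset_ract[OF G] caddc ractc)
  moreover have "emb (F \<oplus>\<^bsub>?Q\<^esub> G) = emb F + emb G"
    by (rule aend_eqI) (simp add: app_emb F G FGQ, simp add: FG rep_cadd Qset_UH F G)
  ultimately show "F \<oplus>\<^bsub>?Q\<^esub> G \<in> carrier ?Q \<and> emb (F \<oplus>\<^bsub>?Q\<^esub> G) = emb F + emb G" by (simp add: car)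
  have FG: "F \<otimes>\<^bsub>?Q\<^esub> G = (\<lambda>X. if X \<in> UHs then F (G X) else undefined)" by (simp add: Qring_def)
  have FGQ: "F \<otimes>\<^bsub>?Q\<^esub> G \<in> Qset scaleU scaleH"
    unfolding FG Qset_def
    by (auto simp: cadd_UH ract_UH Qset_UH F G Qset_cadd[OF F] Qset_cadd[OF G] Qset_ract[OF F] Qset_ract[OF G])
  moreover have "emb (F \<otimes>\<^bsub>?Q\<^esub> G) = emb F * emb G"
    by (rule aend_eqI) (simp add: app_emb F G FGQ, simp add: FG Qset_UH F G)
  ultimately show "F \<otimes>\<^bsub>?Q\<^esub> G \<in> carrier ?Q \<and> emb (F \<otimes>\<^bsub>?Q\<^esub> G) = emb F * emb G" by (simp add: car)
next
  let ?Q = "Qring scaleU scaleH"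
  have car: "carrier ?Q = Qset scaleU scaleH" by (simp add: Qring_def)
  have z: "\<zero>\<^bsub>?Q\<^esub> = (\<lambda>X. if X \<in> UHs then cls 0 else undefined)" by (simp add: Qring_def)
  have r0: "ractV 0 h = 0" for h by (simp add: ractV_def)
  have zQ: "\<zero>\<^bsub>?Q\<^esub> \<in> Qset scaleU scaleH"
    unfolding z Qset_def by (auto simp: cadd_UH ract_UH cadd_cls ract_cls r0)
  then show "\<zero>\<^bsub>?Q\<^esub> \<in> carrier ?Q" by (simp add: car)
  show "emb \<zero>\<^bsub>?Q\<^esub> = 0" by (rule aend_eqI) (simp add: app_emb[OF zQ], simp add: z)
  have o: "\<one>\<^bsub>?Q\<^esub> = (\<lambda>X. if X \<in> UHs then X else undefined)" by (simp add: Qring_def)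
  have oQ: "\<one>\<^bsub>?Q\<^esub> \<in> Qset scaleU scaleH"
    unfolding o Qset_def by (auto simp: cadd_UH ract_UH)
  then show "\<one>\<^bsub>?Q\<^esub> \<in> carrier ?Q" by (simp add: car)
  have ao: "app (emb \<one>\<^bsub>?Q\<^esub>) z = pr z" for z by (simp add: app_emb[OF oQ], simp add: o)
  fix q assume q: "q \<in> Qs"
  show "emb \<one>\<^bsub>?Q\<^esub> * q = q"
  proof (rule aend_eqI)
    fix z
    have "app q z \<in> range pr" using q by (simp add: Qs_def)
    then obtain y where "app q z = pr y" by blast
    then show "app (emb \<one>\<^bsub>?Q\<^esub> * q) z = app q z" by (simp add: ao)
  qed
  show "q * emb \<one>\<^bsub>?Q\<^esub> = q" by (rule aend_eqI) (use q in \<open>simp add: ao Qs_def\<close>)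
  show "- q \<in> Qs" using q by (rule Qs_uminus)
qed

end

lemma additive_eq_on_singles:
  fixes f g :: "('k \<Rightarrow>\<^sub>0 'c::comm_monoid_add) \<Rightarrow> 'b::cancel_comm_monoid_add"
  assumes f: "\<And>x y. f (x + y) = f x + f y" and g: "\<And>x y. g (x + y) = g x + g y"
    and eq: "\<And>p c. f (single p c) = g (single p c)"
  shows "f x = g x"
proof -
  have "f 0 = 0" "g 0 = 0" using f[of 0 0] g[of 0 0] by simp_all
  then have "f (\<Sum>p\<in>K. single p (c p)) = g (\<Sum>p\<in>K. single p (c p))" for K c
    by (induction K rule: infinite_finite_induct) (simp_all add: f g eq)
  from this[of "lookup x" "keys x"] show ?thesis
    by (simp add: poly_mapping_sum_single[symmetric])
qed

section \<open>Pure tensors, contractions and the image of \<open>A \<otimes> H\<close>\<close>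

context tensor_setup
begin

interpretation U: vector_space scaleU by (rule U_vs)
interpretation H: vector_space scaleH by (rule H_vs)

definition tens :: "'u \<Rightarrow> 'h \<Rightarrow> ('u, 'h, 'f) pretensor" where
  "tens u h = pr (single (u, h) 1)"

definition pair :: "('u \<Rightarrow> 'f) \<Rightarrow> ('u, 'h, 'f) pretensor \<Rightarrow> 'h" where
  "pair f = lext (\<lambda>p c. scaleH (c * f (fst p)) (snd p))"

definition T :: "('u \<Rightarrow> 'u) \<Rightarrow> 'h \<Rightarrow> ('u, 'h, 'f) pretensor aend" where
  "T a h = emb (Tmap scaleU scaleH a h)"

lemma tens_addl: "tens (u + u') h = tens u h + tens u' h"
  using pr_eq[of "single (u + u', h) 1" "single (u, h) 1 + single (u', h) 1"]
    tensN.addl[of u u' h scaleU scaleH] by (simp add: tens_def pr_add diff_diff_eq)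

lemma tens_addr: "tens u (h + h') = tens u h + tens u h'"
  using pr_eq[of "single (u, h + h') 1" "single (u, h) 1 + single (u, h') 1"]
    tensN.addr[of u h h' scaleU scaleH] by (simp add: tens_def pr_add diff_diff_eq)

lemma pr_single: "pr (single (u, h) c) = tens u (scaleH c h)"
  using pr_eq[OF tensN.scr, of u c h] by (simp add: tens_def)

lemma tens_scale: "tens (scaleU c u) h = tens u (scaleH c h)"
  using pr_eq[OF tensN.scl, of c u h] pr_single[of u h c] by (simp add: tens_def)

text \<open>Pure tensors generate additively because scalars can be moved into the second
  factor.\<close>

lemma pr_induct:
  assumes "z \<in> range pr" "P 0" "\<And>w h z. z \<in> range pr \<Longrightarrow> P z \<Longrightarrow> P (tens w h + z)"
  shows "P z"
proof -
  obtain x where x: "z = pr x" using assms(1) by blast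
  have "P (pr (\<Sum>p\<in>K. single p (c p)))" for K c
  proof (induction K rule: infinite_finite_induct)
    case (insert p K)
    then show ?case using pr_single[of "fst p" "snd p" "c p"] assms(3) by (simp add: pr_add)
  qed (simp_all add: assms(2))
  from this[of "lookup x" "keys x"] show ?thesis
    using x by (simp add: poly_mapping_sum_single[symmetric])
qed

lemma rho_range: "rho k z \<in> range pr" by (simp add: rho_def)

lemma rho_tens: "rho k (tens w h) = tens w (h * k)"
proof -
  have "pr (ractV (pr (single (w, h) 1)) k) = pr (ractV (single (w, h) 1) k)"
    by (rule pr_eq[symmetric]) (intro ractV_cong pr_cong)
  then show ?thesis by (simp add: rho_def tens_def)
qed

lemma pair_add: "pair f (x + y) = pair f x + pair f y"
  unfolding pair_def by (rule lext_add) (simp_all add: distrib_right H.scale_left_distrib)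

lemma pair_single: "pair f (single (u, h) c) = scaleH (c * f u) h"
  unfolding pair_def by (subst lext_single) simp_all

lemma pair_vscale: "pair f (vscale k x) = scaleH k (pair f x)"
  by (rule additive_eq_on_singles[of "\<lambda>x. pair f (vscale k x)" "\<lambda>x. scaleH k (pair f x)"])
    (auto simp: vector_space.vector_space_assms(1)[OF vector_space_vscale] pair_add H.scale_right_distrib
      vscale_single pair_single mult.assoc)

text \<open>For linear \<open>f\<close> the map \<open>pair f\<close> vanishes on the relations, so
  it has the same value at \<open>x\<close> and at its representative \<open>pr x\<close>.\<close>

lemma pair_tens:
  assumes "Vector_Spaces.linear scaleU (*) f" shows "pair f (tens w h) = scaleH (f w) h"
proof -
  interpret f: Vector_Spaces.linear scaleU "(*)" f by (rule assms)
  have "pair f x \<in> {0}" if "x \<in> N" for x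
    using that by (rule tensN_map[where f = "pair f"])
      (auto simp: pair_add pair_single f.add f.scale H.scale_left_distrib H.scale_right_distrib pair_vscale mult.commute)
  moreover have "pair f (x - y) = pair f x - pair f y" for x y by (rule additive_diff) (rule pair_add)
  ultimately have "pair f (pr x) = pair f x" for x using pr_cong[of x] by fastforce
  then show ?thesis by (simp add: tens_def pair_single)
qed

lemma carrier_Qring: "carrier (Qring scaleU scaleH) = Qset scaleU scaleH" by (simp add: Qring_def)

lemma T_Qs: "linop a \<Longrightarrow> T a h \<in> Qs"
  unfolding T_def by (intro emb_Qs Tmap_Qset)

lemma T_tens: "linop a \<Longrightarrow> app (T a h) (tens w k) = tens (a w) (h * k)"
  by (simp add: T_def app_emb Tmap_Qset tens_def Tmap_cls)

lemma Tmap_mult: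
  assumes a: "linop a" and b: "linop b"
    and ab: "linop (a \<circ> b)"
  shows "Tmap scaleU scaleH a h \<otimes>\<^bsub>Qring scaleU scaleH\<^esub> Tmap scaleU scaleH b k = Tmap scaleU scaleH (a \<circ> b) (h * k)"
proof (rule ext)
  fix X
  have com: "TmapV a h (TmapV b k x) = TmapV (a \<circ> b) (h * k) x" for x
    by (rule additive_eq_on_singles[of "\<lambda>x. TmapV a h (TmapV b k x)"]) (auto simp: TmapV_add mult.assoc)
  show "(Tmap scaleU scaleH a h \<otimes>\<^bsub>Qring scaleU scaleH\<^esub> Tmap scaleU scaleH b k) X = Tmap scaleU scaleH (a \<circ> b) (h * k) X"
  proof (cases "X \<in> UHs")
    case True
    then obtain x where "X = cls x" by (rule UH_cases)
    then show ?thesis by (simp add: Qring_def Tmap_cls a b ab com)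
  next
    case False
    then show ?thesis by (simp add: Qring_def Tmap_def)
  qed
qed

lemma AtensH_carrier:
  assumes "\<And>a. a \<in> A \<Longrightarrow> linop a"
  shows "AtensH scaleU scaleH A \<subseteq> carrier (Qring scaleU scaleH)"
  using assms Tmap_Qset by (auto simp: AtensH_def carrier_Qring[symmetric] intro!: emb.Q.finsum_closed)

lemma AtensH_Tmap:
  assumes "a \<in> A" "linop a"
  shows "Tmap scaleU scaleH a h \<in> AtensH scaleU scaleH A"
proof -
  have "(\<Oplus>\<^bsub>Qring scaleU scaleH\<^esub> i\<in>{..<1::nat}. Tmap scaleU scaleH a h) = Tmap scaleU scaleH a h"
    using emb.Q.finsum_insert[of "{}" "0::nat" "\<lambda>_. Tmap scaleU scaleH a h"] Tmap_Qset[OF assms(2)]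
    by (simp add: carrier_Qring lessThan_Suc)
  then show ?thesis unfolding AtensH_def
    by (intro CollectI exI[of _ "1::nat"] exI[of _ "\<lambda>_. a"] exI[of _ "\<lambda>_. h"]) (use assms(1) in auto)
qed

lemma AtensH_mult:
  assumes lin: "\<And>a. a \<in> A \<Longrightarrow> linop a"
    and mult: "\<And>a b. a \<in> A \<Longrightarrow> b \<in> A \<Longrightarrow> a \<circ> b \<in> A"
    and s: "s \<in> A" and x: "x \<in> AtensH scaleU scaleH A"
  shows "Tmap scaleU scaleH s 1 \<otimes>\<^bsub>Qring scaleU scaleH\<^esub> x \<in> AtensH scaleU scaleH A"
    and "x \<otimes>\<^bsub>Qring scaleU scaleH\<^esub> Tmap scaleU scaleH s 1 \<in> AtensH scaleU scaleH A"
proof -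
  let ?Q = "Qring scaleU scaleH"
  from x obtain n :: nat and as hs where x: "x = (\<Oplus>\<^bsub>?Q\<^esub> i\<in>{..<n}. Tmap scaleU scaleH (as i) (hs i))"
    and as: "\<forall>i<n. as i \<in> A" unfolding AtensH_def by blast
  have c: "Tmap scaleU scaleH s 1 \<in> carrier ?Q" "\<And>i. i < n \<Longrightarrow> Tmap scaleU scaleH (as i) (hs i) \<in> carrier ?Q"
    using as s lin by (auto simp: carrier_Qring intro!: Tmap_Qset)
  have "Tmap scaleU scaleH s 1 \<otimes>\<^bsub>?Q\<^esub> x = (\<Oplus>\<^bsub>?Q\<^esub> i\<in>{..<n}. Tmap scaleU scaleH s 1 \<otimes>\<^bsub>?Q\<^esub> Tmap scaleU scaleH (as i) (hs i))"
    unfolding x by (rule emb.Q.finsum_rdistr) (use c in auto)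
  also have "\<dots> = (\<Oplus>\<^bsub>?Q\<^esub> i\<in>{..<n}. Tmap scaleU scaleH (s \<circ> as i) (hs i))"
    by (rule emb.Q.finsum_cong') (use as s lin mult in \<open>auto simp: Tmap_mult carrier_Qring intro!: Tmap_Qset\<close>)
  finally show "Tmap scaleU scaleH s 1 \<otimes>\<^bsub>?Q\<^esub> x \<in> AtensH scaleU scaleH A"
    unfolding AtensH_def using as mult[OF s]
    by (intro CollectI exI[of _ n] exI[of _ "\<lambda>i. s \<circ> as i"] exI[of _ hs]) auto
  have "x \<otimes>\<^bsub>?Q\<^esub> Tmap scaleU scaleH s 1 = (\<Oplus>\<^bsub>?Q\<^esub> i\<in>{..<n}. Tmap scaleU scaleH (as i) (hs i) \<otimes>\<^bsub>?Q\<^esub> Tmap scaleU scaleH s 1)"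
    unfolding x by (rule emb.Q.finsum_ldistr) (use c in auto)
  also have "\<dots> = (\<Oplus>\<^bsub>?Q\<^esub> i\<in>{..<n}. Tmap scaleU scaleH (as i \<circ> s) (hs i))"
    by (rule emb.Q.finsum_cong') (use as s lin mult in \<open>auto simp: Tmap_mult carrier_Qring intro!: Tmap_Qset\<close>)
  finally show "x \<otimes>\<^bsub>?Q\<^esub> Tmap scaleU scaleH s 1 \<in> AtensH scaleU scaleH A"
    unfolding AtensH_def using as mult[OF _ s]
    by (intro CollectI exI[of _ n] exI[of _ "\<lambda>i. as i \<circ> s"] exI[of _ hs]) auto
qed

end

theorem theorem4p6:
  fixes scaleU :: "'f::field \<Rightarrow> 'u::ab_group_add \<Rightarrow> 'u"
    and scaleH :: "'f \<Rightarrow> 'h::ring_1 \<Rightarrow> 'h"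
    and Ps :: "('u \<Rightarrow> 'f) set"
    and A :: "('u \<Rightarrow> 'u) set"
    and t :: "'u \<Rightarrow> 'u"
    and d :: nat
  assumes U_vs: "vector_space scaleU"
    and H_vs: "vector_space scaleH"
    and H_alg: "\<And>c x y. scaleH c (x * y) = scaleH c x * y \<and> scaleH c (x * y) = x * scaleH c y"
    and Pi_dual: "\<And>f. f \<in> Ps \<Longrightarrow> Vector_Spaces.linear scaleU (*) f"
    and Pi_zero: "(\<lambda>_. 0) \<in> Ps"
    and Pi_add: "\<And>f g. f \<in> Ps \<Longrightarrow> g \<in> Ps \<Longrightarrow> (\<lambda>u. f u + g u) \<in> Ps"
    and Pi_scale: "\<And>c f. f \<in> Ps \<Longrightarrow> (\<lambda>u. c * f u) \<in> Ps"
    and Pi_total: "\<And>u. u \<noteq> 0 \<Longrightarrow> \<exists>f\<in>Ps. f u \<noteq> 0"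
    and A_End: "\<And>a. a \<in> A \<Longrightarrow> Vector_Spaces.linear scaleU scaleU a"
    and A_zero: "(\<lambda>_. 0) \<in> A"
    and A_add: "\<And>a b. a \<in> A \<Longrightarrow> b \<in> A \<Longrightarrow> (\<lambda>u. a u + b u) \<in> A"
    and A_scale: "\<And>c a. a \<in> A \<Longrightarrow> (\<lambda>u. scaleU c (a u)) \<in> A"
    and A_mult: "\<And>a b. a \<in> A \<Longrightarrow> b \<in> A \<Longrightarrow> a \<circ> b \<in> A"
    and FPi_A: "finrank_ops scaleU Ps \<subseteq> A"
    and t_FPi: "t \<in> finrank_ops scaleU Ps"
    and d_ge: "1 \<le> d"
    and d_le: "d \<le> deg_op scaleU t"
  shows "td_free (AtensH scaleU scaleH A) (Qring scaleU scaleH) (Tmap scaleU scaleH t 1) d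
         \<and> d_free (AtensH scaleU scaleH A) (Qring scaleU scaleH) d"
proof -
  let ?Q = "Qring scaleU scaleH" and ?R = "AtensH scaleU scaleH A" and ?t = "Tmap scaleU scaleH t 1"
  interpret tensor_setup scaleU scaleH
    by (rule tensor_setup.intro[OF U_vs H_vs]) (use H_alg in blast)+
  have RQ: "?R \<subseteq> carrier ?Q" by (rule AtensH_carrier[OF A_End])
  have tA: "t \<in> A" using t_FPi FPi_A by blast
  have T_carrier: "Tmap scaleU scaleH a h \<in> carrier ?Q" if "a \<in> A" for a h
    using Tmap_Qset[OF A_End[OF that]] by (simp add: carrier_Qring)
  have tR: "?t \<in> ?R" by (rule AtensH_Tmap[OF tA A_End[OF tA]])
  interpret rep: tensor_rep scaleU Ps t d scaleH "range pr" tens rho pair pr T Qs "emb ` ?R"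
  proof (intro tensor_rep.intro total_space_op.intro total_space.intro total_space_op_axioms.intro tensor_rep_axioms.intro)
    show "0 \<in> range pr" using rangeI[of pr 0] by simp
    show "x + y \<in> range pr" if "x \<in> range pr" "y \<in> range pr" for x y
      using that by (auto simp: pr_add[symmetric])
    show "- x \<in> range pr" if "x \<in> range pr" for x
      using that pr_diff[of 0] by (auto simp: image_iff) (metis diff_0)
    show "tens u h \<in> range pr" for u h by (simp add: tens_def)
    show "P z" if "z \<in> range pr" "P 0" "\<And>w h z. z \<in> range pr \<Longrightarrow> P z \<Longrightarrow> P (tens w h + z)" for P z
      using that by (rule pr_induct)
    show "pair f (tens w h) = scaleH (f w) h" if "f \<in> Ps" for f w h by (rule pair_tens[OF Pi_dual[OF that]])
    show "pr z = z" if "z \<in> range pr" for z using that by auto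
    show "emb ` ?R \<subseteq> Qs" using RQ emb.in_S by auto
    show "T a h \<in> Qs" if "Vector_Spaces.linear scaleU scaleU a" for a h using that by (rule T_Qs)
    show "Qs = {q. (\<forall>z. app q z \<in> range pr) \<and> (\<forall>z. app q (pr z) = app q z) \<and>
      (\<forall>z\<in>range pr. \<forall>h. app q (rho h z) = rho h (app q z))}" by (rule Qs_def)
    show "T a h \<in> emb ` ?R" if "a \<in> finrank_ops scaleU Ps" for a h
      unfolding T_def using that FPi_A A_End by (intro imageI AtensH_Tmap) auto
    show "T a 1 * q \<in> emb ` ?R" "q * T a 1 \<in> emb ` ?R" if "a \<in> finrank_ops scaleU Ps" "q \<in> emb ` ?R" for a q
    proof -
      from that obtain x where x: "x \<in> ?R" "q = emb x" by auto
      have a: "a \<in> A" using that FPi_A by blast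
      have "T a 1 * q = emb (Tmap scaleU scaleH a 1 \<otimes>\<^bsub>?Q\<^esub> x)" "q * T a 1 = emb (x \<otimes>\<^bsub>?Q\<^esub> Tmap scaleU scaleH a 1)"
        using emb.mult[OF T_carrier[OF a], of x] emb.mult[OF _ T_carrier[OF a], of x] x RQ by (auto simp: T_def)
      then show "T a 1 * q \<in> emb ` ?R" "q * T a 1 \<in> emb ` ?R"
        using AtensH_mult[OF A_End A_mult a x(1)] by auto
    qed
  qed (use assms in \<open>auto simp: H_left H_right tens_addl tens_addr tens_scale rho_range rho_add rho_tens pair_add
      pr_add T_tens intro: U_vs H_vs\<close>)
  have Cs: "rep.Cs = emb.center" by (simp add: rep.Cs_def emb.center_def)
  interpret es: embedded_subset ?Q emb Qs ?R ?t ?t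
    using rep.fi.fi_ops_axioms RQ tR T_carrier[OF tA]
    by (intro embedded_subset.intro embedded_subset_axioms.intro emb.ring_embedding_axioms)
      (auto simp: Cs T_def)
  have only: "es.fi.only_std I J a b" if "finite I" "card I + a \<le> d" "finite J" "card J + b \<le> d" for I J a b
    using rep.only_std_R[OF that] by (simp add: Cs T_def)
  have "td_free ?R ?Q ?t d"
    unfolding td_free_def
  proof (intro conjI allI impI ballI RQ T_carrier tA)
    show "?t \<otimes>\<^bsub>?Q\<^esub> x \<in> ?R" if "x \<in> ?R" for x by (rule AtensH_mult(1)[OF A_End A_mult tA that])
    fix m I J a b E F
    assume "1 \<le> m" and IJ: "I \<subseteq> {..<m}" "J \<subseteq> {..<m}" "max (card I + a) (card J + b) \<le> d"
      and *: "\<forall>i\<in>I. \<forall>u\<le>a. maps_into ?R (m - 1) (E i u) (carrier ?Q)"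
      "\<forall>j\<in>J. \<forall>v\<le>b. maps_into ?R (m - 1) (F j v) (carrier ?Q)"
      "\<forall>xs\<in>lists ?R. length xs = m \<longrightarrow> tFI_expr ?Q ?t a b I J E F xs = \<zero>\<^bsub>?Q\<^esub>"
    show "t_std_sol ?Q ?R ?t a b m I J E F"
      by (rule es.t_std_sol_if_only_std[OF only IJ(1,2) *]) (use IJ finite_subset in auto)
  qed
  moreover have "d_free ?R ?Q d"
    unfolding d_free_def
  proof (intro conjI allI impI RQ)
    fix m I J E F
    assume "1 \<le> m" and IJ: "I \<subseteq> {..<m}" "J \<subseteq> {..<m}"
      and EF: "\<forall>i\<in>I. maps_into ?R (m - 1) (E i) (carrier ?Q)" "\<forall>j\<in>J. maps_into ?R (m - 1) (F j) (carrier ?Q)"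
    have fin: "finite I" "finite J" using IJ finite_subset by auto
    \<comment> \<open>The case \<open>a = b = 0\<close> of \<open>only\<close>.\<close>
    have std: "std_sol ?Q ?R m I J E F" if "max (card I) (card J) \<le> d"
      "\<forall>xs\<in>lists ?R. length xs = m \<longrightarrow> FI_expr ?Q I J E F xs = \<zero>\<^bsub>?Q\<^esub>"
      by (rule es.std_sol_if_only_std[OF only IJ EF that(2)]) (use fin that(1) in auto)
    then show "std_sol ?Q ?R m I J E F" if "max (card I) (card J) \<le> d"
      "\<forall>xs\<in>lists ?R. length xs = m \<longrightarrow> FI_expr ?Q I J E F xs = \<zero>\<^bsub>?Q\<^esub>" using that by blast
    assume card: "max (card I) (card J) \<le> d - 1"
      and center: "\<forall>xs\<in>lists ?R. length xs = m \<longrightarrow> FI_expr ?Q I J E F xs \<in> rcenter ?Q"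
    obtain N M where NM: "N \<in> finrank_ops scaleU Ps" "M \<in> finrank_ops scaleU Ps"
      "commuting_shifts.only_zero ((*) (T N 1)) (\<lambda>x. x * T M 1) (emb ` ?R) rep.Cs I J 0 0"
    proof (rule rep.only_zero_R)
      fix N M
      assume "N \<in> finrank_ops scaleU Ps" "M \<in> finrank_ops scaleU Ps"
        and oz: "\<And>I J. finite I \<Longrightarrow> finite J \<Longrightarrow> card I < d \<Longrightarrow> card J < d \<Longrightarrow>
          commuting_shifts.only_zero ((*) (T N 1)) (\<lambda>x. x * T M 1) (emb ` ?R) rep.Cs I J 0 0"
      then show thesis using that oz[OF fin] card d_ge by auto
    qed
    \<comment> \<open>A central value is forced to be zero, so the second half of d-freeness reduces
      to the first.\<close>
    have "FI_expr ?Q I J E F xs = \<zero>\<^bsub>?Q\<^esub>" if "xs \<in> lists ?R" "length xs = m" for xs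
      using rep.shifts_commuting[OF NM(1,2)] NM(3) unfolding Cs
      by (rule es.FI_zero_if_only_zero[OF _ _ IJ EF center that])
    moreover have "max (card I) (card J) \<le> d" using card by linarith
    ultimately show "std_sol ?Q ?R m I J E F" by (intro std) auto
  qed
  ultimately show ?thesis ..
qed

end
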